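(* Let $r, m \in \mathbb{N}$, let $0 \le x_1 < x_2 < \dots < x_l < 2\pi$, and let $k_1,\dots,k_l$ be non-negative integers with $k_i \le r-1$ for all $i$ and $\sum_{j=1}^{l}(k_j+1) = 2m+1$. Then for every $f \in L_\infty^r$ there exist a real number $\xi$ and a spline $s \in \xi\Gamma_{2m}^r$ such that $$s^{(j)}(x_i) = f^{(j)}(x_i),\qquad j=0,\dots,k_i,\ \ i=1,\dots,l,$$ and moreover $$\|s^{(r)}\|_\infty = |\xi| \le \|f^{(r)}\|_\infty .$$ In particular, for any $0\le x_1<\dots<x_{2m+1}<2\pi$ and $f\in L_\infty^r$ there exist $\xi$ and $s\in\xi\Gamma_{2m}^r$ with $s(x_i)=f(x_i)$, $i=1,\dots,2m+1$, and $\|s^{(r)}\|_\infty=|\xi|\le\|f^{(r)}\|_\infty$.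
   Context: All functions are $2\pi$-periodic real functions on $\mathbb{R}$. $C^{m}$ ($m\in\mathbb{Z}_+$) denotes the space of $2\pi$-periodic $m$ times continuously differentiable functions ($C=C^0$ continuous ones). $L_\infty$ is the space of measurable $2\pi$-periodic functions with finite norm $\|f\|_\infty$ (essential supremum). For $r\in\mathbb{N}$, $L_\infty^r$ is the space of $f\in C$ such that $f^{(r-1)}$ is absolutely continuous and $f^{(r)}\in L_\infty$. A function $s\in C^{r-1}$ is a (periodic) spline of order $r$ with knots $t_0<t_1<\dots<t_n<t_{n+1}:=t_0+2\pi$ if on each $[t_i,t_{i+1}]$, $i=0,\dots,n$, it coincides with an algebraic polynomial of degree at most $r$. Such a spline is a perfect spline of order $r$ if there is $\epsilon\in\{1,-1\}$ with $s^{(r)}(t)=(-1)^i\epsilon$ for $t\in(t_i,t_{i+1})$, $i=0,\dots,n$. For $r,n\in\mathbb{N}$, $\Gamma_n^r$ denotes the set of $2\pi$-periodic perfect splines of order $r$ having at most $n$ knots in a period, and for $\xi\in\mathbb{R}$, $\xi\Gamma_n^r=\{\xi s: s\in\Gamma_n^r\}$.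
   Formalization: For ξ = 0 the class ξΓ is taken to contain all constant functions, not just the zero function; read literally the claim fails for f a nonzero constant, since then ξ = 0 and s = 0 does not interpolate f. *)

theory Defs
  imports "HOL-Analysis.Analysis" "HOL-Probability.Essential_Supremum"
          "HOL-Computational_Algebra.Polynomial"
begin

definition periodic2pi :: "(real \<Rightarrow> real) \<Rightarrow> bool" where
  "periodic2pi f \<longleftrightarrow> (\<forall>x. f (x + 2 * pi) = f x)"

definition Ck :: "nat \<Rightarrow> (real \<Rightarrow> real) \<Rightarrow> bool" where
  "Ck m f \<longleftrightarrow> (\<forall>j<m. \<forall>x. ((deriv ^^ j) f) differentiable (at x))
                \<and> continuous_on UNIV ((deriv ^^ m) f)"

definition abs_cont_on :: "real \<Rightarrow> real \<Rightarrow> (real \<Rightarrow> real) \<Rightarrow> bool" where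
  "abs_cont_on u v g \<longleftrightarrow>
     (\<forall>e>0. \<exists>d>0. \<forall>(n::nat) (a::nat \<Rightarrow> real) b.
        (\<forall>i<n. u \<le> a i \<and> a i \<le> b i \<and> b i \<le> v) \<and>
        (\<forall>i<n. \<forall>j<n. i \<noteq> j \<longrightarrow> b i \<le> a j \<or> b j \<le> a i) \<and>
        (\<Sum>i<n. b i - a i) < d
        \<longrightarrow> (\<Sum>i<n. \<bar>g (b i) - g (a i)\<bar>) < e)"

text \<open>Essential sup norm of g w.r.t. Lebesgue measure (infinite if not measurable).\<close>
definition Linf_norm :: "(real \<Rightarrow> real) \<Rightarrow> ereal" where
  "Linf_norm g = esssup lebesgue (\<lambda>x. ereal \<bar>g x\<bar>)"

text \<open>The class L_\<infinity>^r: f \<in> C, f^(r-1) absolutely continuous, f^(r) \<in> L_\<infinity>,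
  where f^(r) is the (a.e. existing) derivative of f^(r-1).\<close>
definition Linf_r :: "nat \<Rightarrow> (real \<Rightarrow> real) \<Rightarrow> bool" where
  "Linf_r r f \<longleftrightarrow> periodic2pi f \<and> Ck (r - 1) f \<and>
     (\<forall>u v. abs_cont_on u v ((deriv ^^ (r - 1)) f)) \<and>
     Linf_norm ((deriv ^^ r) f) < \<infinity>"

definition knot :: "real list \<Rightarrow> nat \<Rightarrow> real" where
  "knot ts i = (if i < length ts then ts ! i else hd ts + 2 * pi)"

definition scaled_perfect_spline :: "nat \<Rightarrow> nat \<Rightarrow> real \<Rightarrow> (real \<Rightarrow> real) \<Rightarrow> bool" where
  "scaled_perfect_spline r n \<xi> s \<longleftrightarrow>
     periodic2pi s \<and> Ck (r - 1) s \<and>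
     (\<exists>ts (\<epsilon>::real). 1 \<le> length ts \<and> length ts \<le> n \<and> sorted_wrt (<) ts \<and>
        last ts < hd ts + 2 * pi \<and> (\<epsilon> = 1 \<or> \<epsilon> = -1) \<and>
        (\<forall>i<length ts.
           (\<exists>p::real poly. degree p \<le> r \<and>
               (\<forall>t\<in>{knot ts i .. knot ts (Suc i)}. s t = poly p t)) \<and>
           (\<forall>t\<in>{knot ts i <..< knot ts (Suc i)}.
               (deriv ^^ r) s t = (-1) ^ i * \<epsilon> * \<xi>)))"

end

(* Smooth everything with the kernel proportional to cos(t/2)^(2n) and let n tend to infinity.
   After splitting multiple nodes into clusters of simple ones, the functional assigning to
   coefficients a (with sum 0) and c the number sum a_y f_n(y), where f_n is the smoothed f, is bounded
   by M = ||f^(r)|| times the L1-norm of w(t) = c + sum a_y beta_r(y - t), with beta_r the r-th periodic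
   primitive of the kernel minus its mean.  At a pair (a, c) maximising the ratio, the functional
   equals rho times integration against sgn w with 0 <= rho <= M, which says that the smoothed perfect
   spline with s^(r) = +-rho sgn w interpolates f_n.  By Rolle, w has no more cyclic sign changes than
   its r-th derivative, a sum of translates of cos(t/2)^(2n) with 2m+1 nodes, and each application of
   2 cos((t-v)/2) d/dt + d sin((t-v)/2) removes one node and at most one sign change of such a sum of
   degree d; hence w has at most 2m sign changes.  A compactness argument in the knots concludes. *)
theory Submission
  imports Defs "HOL-Real_Asymp.Real_Asymp"
begin

section \<open>Absolutely continuous functions with bounded derivative are Lipschitz\<close>

text \<open>Duality replaces a search for knots by reading off the sign pattern of an extremal
  function. The constant c belongs to the dual pair because the r-th derivative of a periodic spline
  must have mean zero: varying c in the extremal problem gives exactly that. The coefficients have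
  sum 0 because the r-th derivative determines a periodic function only up to an additive constant.
  Without smoothing, w could vanish on a whole interval and its sign would say nothing there;
  smoothed, w has finitely many zeros in a period, so the L1-norm is differentiable at w. The price
  is the limit in n, where knots may collide, also across the end of the period; colliding pairs
  cancel. The bound M is known only through the almost everywhere values of \<open>deriv\<close>,
  which are arbitrary where f^(r-1) is not differentiable. Hence almost everywhere differentiability
  of absolutely continuous functions is proved as well; it yields that f^(r-1) is Lipschitz with
  constant M, and from there on only this Lipschitz bound is used.\<close>

definition inc :: "(real \<Rightarrow> real) \<Rightarrow> real set \<Rightarrow> real" where
  "inc g K = (if K = {} then 0 else g (Sup K) - g (Inf K))"

lemma inc_atLeastAtMost [simp]: "a \<le> b \<Longrightarrow> inc g {a..b} = g b - g a"
  by (simp add: inc_def)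

lemma inc_empty [simp]: "inc g {} = 0"
  by (simp add: inc_def)

lemma division_of_interval:
  fixes K :: "real set"
  assumes "D division_of S" "K \<in> D"
  shows "\<exists>a b. a \<le> b \<and> K = {a..b}"
proof -
  obtain a b where "K = cbox a b" "K \<noteq> {}"
    using division_ofD(3,4)[OF assms] by metis
  then show ?thesis by (intro exI[of _ a] exI[of _ b]) auto
qed

lemma inc_division:
  assumes "q division_of {a..b}" "a \<le> b"
  shows "(\<Sum>K\<in>q. inc g K) = g b - g a"
proof -
  let ?f = "(\<lambda>K::real set. if K = {} then 0 else g (interval_upperbound K) - g (interval_lowerbound K))"
  interpret operative_real plus 0 ?f
    rewrites "comm_monoid_set.F (+) 0 = sum"
    by standard[1] (auto simp add: sum_def)
  have "sum ?f q = ?f (cbox a b)"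
    using division[of q a b] assms(1) by simp
  also have "sum ?f q = (\<Sum>K\<in>q. inc g K)"
    using division_ofD(4)[OF assms(1)] division_ofD(3)[OF assms(1)]
    by (intro sum.cong) (auto simp: inc_def)
  finally show ?thesis using assms by simp
qed

text \<open>One division \<open>D\<close> of the gaps serves every \<open>g\<close>. It is applied
  to \<open>g\<close> and to the identity at once, so that a small total length of the gaps makes
  the increments of \<open>g\<close> over them small.\<close>

lemma division_gaps:
  assumes F: "F division_of \<Union>F" "\<Union>F \<subseteq> {a..b}" and ab: "a \<le> b"
  obtains D where "D division_of \<Union>D" "\<Union>D \<subseteq> {a..b}"
    "\<And>g. g b - g a = (\<Sum>K\<in>F. inc g K) + (\<Sum>K\<in>D. inc g K)"
proof -
  obtain q where q: "F \<subseteq> q" "q division_of {a..b}"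
    using partial_division_extend_interval[OF F(1), of a b] F(2) by auto
  have fin: "finite q" using q(2) by auto
  show thesis
  proof
    show "q - F division_of \<Union>(q - F)"
      using division_of_subset[OF division_of_union_self[OF q(2)]] by blast
    show "\<Union>(q - F) \<subseteq> {a..b}"
      using q(2) division_ofD(6) by blast
    show "g b - g a = (\<Sum>K\<in>F. inc g K) + (\<Sum>K\<in>q - F. inc g K)" for g
      using inc_division[OF q(2) ab, of g] sum.subset_diff[OF q(1) fin, of "inc g"] by simp
  qed
qed

text \<open>The form in which absolute continuity is used: indexed families of endpoints give way to
  divisions, whose gaps and intersections are easier to handle.\<close>

lemma abs_cont_on_division:
  assumes ac: "abs_cont_on A B g" and e: "e > 0"
  obtains d where "d > 0"
    "\<And>D. D division_of \<Union>D \<Longrightarrow> \<Union>D \<subseteq> {A..B} \<Longrightarrow> (\<Sum>K\<in>D. inc (\<lambda>x. x) K) < d \<Longrightarrow>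
        (\<Sum>K\<in>D. \<bar>inc g K\<bar>) < e"
proof -
  obtain d where d0: "d > 0" and d1: "\<forall>(n::nat) (a::nat \<Rightarrow> real) b.
        (\<forall>i<n. A \<le> a i \<and> a i \<le> b i \<and> b i \<le> B) \<and>
        (\<forall>i<n. \<forall>j<n. i \<noteq> j \<longrightarrow> b i \<le> a j \<or> b j \<le> a i) \<and>
        (\<Sum>i<n. b i - a i) < d
        \<longrightarrow> (\<Sum>i<n. \<bar>g (b i) - g (a i)\<bar>) < e"
    using mp[OF spec[OF ac[unfolded abs_cont_on_def], of e] e] by (elim exE conjE) (rule that)
  show thesis
  proof
    show "d > 0" by (fact d0)
    fix D assume D: "D division_of \<Union>D" "\<Union>D \<subseteq> {A..B}" "(\<Sum>K\<in>D. inc (\<lambda>x. x) K) < d"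
    have int: "\<exists>a b. K = {a..b} \<and> a \<le> b" if "K \<in> D" for K
      using division_of_interval[OF D(1) that] by blast
    \<comment> \<open>A one-point member of a division has empty interior and may lie inside another
      member, which the ordering condition of \<open>abs_cont_on\<close> forbids. Such members have
      increment 0 and are dropped.\<close>
    define D' where "D' = {K\<in>D. Inf K < Sup K}"
    have fD: "finite D" using D(1) by auto
    then have fD': "finite D'" by (simp add: D'_def)
    have eqD: "(\<Sum>K\<in>D. \<phi> (inc h K)) = (\<Sum>K\<in>D'. \<phi> (h (Sup K) - h (Inf K)))"
      if "\<phi> 0 = 0" for \<phi> h :: "real \<Rightarrow> real"
      unfolding D'_def
    proof (intro sum.mono_neutral_cong_right fD ballI)
      fix K assume "K \<in> D - {K \<in> D. Inf K < Sup K}"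
      with int[of K] that show "\<phi> (inc h K) = 0" by (auto simp: inc_def)
    next
      fix K assume "K \<in> {K \<in> D. Inf K < Sup K}"
      with int[of K] show "\<phi> (inc h K) = \<phi> (h (Sup K) - h (Inf K))" by auto
    qed auto
    obtain h where h: "bij_betw h {..<card D'} D'"
      using ex_bij_betw_nat_finite[OF fD'] by (auto simp: lessThan_atLeast0)
    have hD: "h i \<in> D'" if "i < card D'" for i
      using h that by (auto simp: bij_betw_def)
    have "(\<Sum>i<card D'. \<bar>g (Sup (h i)) - g (Inf (h i))\<bar>) < e"
    proof (rule d1[THEN spec, THEN spec, THEN spec, THEN mp], intro conjI allI impI)
      fix i assume i: "i < card D'"
      obtain a b where ab: "h i = {a..b}" "a < b"
        using hD[OF i] int[of "h i"] unfolding D'_def by auto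
      have "h i \<in> D" using hD[OF i] by (simp add: D'_def)
      then have "{a..b} \<subseteq> {A..B}" using ab(1) D(2) by blast
      with ab show "A \<le> Inf (h i)" "Inf (h i) \<le> Sup (h i)" "Sup (h i) \<le> B" by auto
      fix j assume j: "j < card D'" "i \<noteq> j"
      obtain a' b' where ab': "h j = {a'..b'}" "a' < b'"
        using hD[OF j(1)] int[of "h j"] unfolding D'_def by auto
      have "h i \<noteq> h j" using h i j unfolding bij_betw_def inj_on_def by blast
      then have "interior (h i) \<inter> interior (h j) = {}"
        using division_ofD(5)[OF D(1)] hD[OF i] hD[OF j(1)] unfolding D'_def by blast
      then have *: "{max a a'<..<min b b'} = {}" using ab ab' by (auto simp: interior_atLeastAtMost_real)
      then have "min b b' \<le> max a a'" by (simp add: greaterThanLessThan_empty_iff del: max_less_iff_conj)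
      then show "Sup (h i) \<le> Inf (h j) \<or> Sup (h j) \<le> Inf (h i)"
        using ab ab' by auto
    next
      have "(\<Sum>i<card D'. Sup (h i) - Inf (h i)) = (\<Sum>K\<in>D'. Sup K - Inf K)"
        using sum.reindex_bij_betw[OF h, of "\<lambda>K. Sup K - Inf K"] .
      also have "\<dots> = (\<Sum>K\<in>D. inc (\<lambda>x. x) K)" using eqD[of "\<lambda>x. x" "\<lambda>x. x"] by simp
      finally show "(\<Sum>i<card D'. Sup (h i) - Inf (h i)) < d" using D(3) by simp
    qed
    moreover have "(\<Sum>i<card D'. \<bar>g (Sup (h i)) - g (Inf (h i))\<bar>) = (\<Sum>K\<in>D'. \<bar>g (Sup K) - g (Inf K)\<bar>)"
      using sum.reindex_bij_betw[OF h, of "\<lambda>K. \<bar>g (Sup K) - g (Inf K)\<bar>"] .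
    ultimately show "(\<Sum>K\<in>D. \<bar>inc g K\<bar>) < e" using eqD[of abs g] by simp
  qed
qed

section \<open>Vitali coverings by intervals\<close>

lemma division_of_disjoint_intervals:
  assumes "finite F" "pairwise disjnt F" "\<And>K. K \<in> F \<Longrightarrow> \<exists>a b. a < b \<and> K = {a..b::real}"
  shows "F division_of \<Union>F"
proof (rule division_ofI)
  fix K assume K: "K \<in> F"
  then obtain a b where "a < b" "K = {a..b}" using assms(3) by blast
  then show "K \<noteq> {}" "\<exists>a b. K = cbox a b" "K \<subseteq> \<Union>F" using K by auto
  fix L assume "L \<in> F" "K \<noteq> L"
  then have "K \<inter> L = {}" using assms(2) K by (auto simp: pairwise_def disjnt_def)
  then show "interior K \<inter> interior L = {}" using interior_subset by blast
qed (use assms in auto)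

lemma measure_disjoint_intervals:
  assumes "finite F" "pairwise disjnt F" "\<And>K. K \<in> F \<Longrightarrow> \<exists>a b. a < b \<and> K = {a..b::real}"
  shows "measure lebesgue (\<Union>F) = (\<Sum>K\<in>F. inc (\<lambda>x. x) K)"
proof -
  have "measure lebesgue (\<Union>F) = (\<Sum>K\<in>F. measure lebesgue K)"
    using assms by (intro measure_negligible_finite_Union) (fastforce simp: pairwise_def disjnt_def)+
  also have "\<dots> = (\<Sum>K\<in>F. inc (\<lambda>x. x) K)"
    using assms(3) by (intro sum.cong) (auto dest!: assms(3))
  finally show ?thesis .
qed

lemma lmeasurable_open_interval_subset:
  assumes "open U" "U \<subseteq> {A<..<B::real}"
  shows "U \<in> lmeasurable"
proof -
  have "U \<subseteq> {A..B}" using assms(2) by force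
  then show ?thesis
    using assms(1) bounded_subset[OF compact_imp_bounded[OF compact_Icc]] lmeasurable_open by blast
qed

text \<open>The number \<open>\<mu>\<close> stands for (a lower bound of) the outer measure of \<open>E\<close>.\<close>

lemma finite_Vitali:
  assumes E: "E \<subseteq> U" "open U" "U \<subseteq> {A<..<B}"
    and P: "\<And>x d::real. x \<in> E \<Longrightarrow> d > 0 \<Longrightarrow> \<exists>s t::real. s < t \<and> t - s < d \<and> s \<le> x \<and> x \<le> t \<and> P s t"
    and \<mu>: "\<And>V. open V \<Longrightarrow> E \<subseteq> V \<Longrightarrow> V \<subseteq> {A<..<B} \<Longrightarrow> \<mu> \<le> measure lebesgue V"
    and \<eta>: "\<eta> > 0"
  obtains F where "finite F" "pairwise disjnt F" "\<And>K. K \<in> F \<Longrightarrow> \<exists>s t. s < t \<and> K = {s..t} \<and> P s t"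
    "\<Union>F \<subseteq> U" "\<mu> - \<eta> < measure lebesgue (\<Union>F)"
proof -
  \<comment> \<open>An interval is recoded as a ball about its midpoint, so the point to be covered
    need not be the centre.\<close>
  define KK where "KK = {(c::real, r). r > 0 \<and> cball c r \<subseteq> U \<and> P (c - r) (c + r)}"
  have cover: "\<exists>i. i \<in> KK \<and> x \<in> cball (fst i) (snd i) \<and> snd i < d" if x: "x \<in> E" "0 < d" for x d
  proof -
    obtain e where e: "e > 0" "ball x e \<subseteq> U" using E x(1) by (meson in_mono openE)
    obtain s t where st: "s < t" "t - s < min d e" "s \<le> x" "x \<le> t" "P s t"
      using P[OF x(1), of "min d e"] x(2) e(1) by auto
    have cb: "cball ((s + t)/2) ((t - s)/2) = {s..t}"
      by (auto simp: cball_eq_atLeastAtMost field_simps)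
    have "{s..t} \<subseteq> ball x e" using st by (auto simp: dist_real_def)
    then have "{s..t} \<subseteq> U" using e(2) by blast
    moreover have "(s + t)/2 - (t - s)/2 = s" "(s + t)/2 + (t - s)/2 = t" by (simp_all add: field_simps)
    ultimately have "((s + t)/2, (t - s)/2) \<in> KK"
      unfolding KK_def using st(1,5) cb by simp
    then show ?thesis using cb st(1-4)
      by (intro exI[of _ "((s + t)/2, (t - s)/2)"] conjI) simp_all
  qed
  have r0: "0 < snd i" if "i \<in> KK" for i using that by (auto simp: KK_def)
  obtain C where C: "countable C" "C \<subseteq> KK"
     "pairwise (\<lambda>i j. disjnt (cball (fst i) (snd i)) (cball (fst j) (snd j))) C"
     "negligible (E - (\<Union>i \<in> C. cball (fst i) (snd i)))"
    by (rule Vitali_covering_theorem_cballs[of KK snd E fst, OF r0 cover])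
  define D where "D = (\<lambda>i. cball (fst i) (snd i)) ` C"
  have "cball (fst i) (snd i) \<subseteq> U" if "i \<in> C" for i
    using subsetD[OF C(2) that] by (simp add: KK_def split_def)
  then have DU: "\<Union>D \<subseteq> U" unfolding D_def by blast
  have Dm: "\<Union>D \<in> sets lebesgue" using C(1) unfolding D_def
    by (intro sets.countable_Union) auto
  have Um: "U \<in> lmeasurable"
    using lmeasurable_open_interval_subset E(2,3) by blast
  have Dlm: "\<Union>D \<in> lmeasurable" using DU Dm Um measurable_measure_Diff
    by (meson fmeasurableI2)
  have \<mu>D: "\<mu> \<le> measure lebesgue (\<Union>D)"
  proof (rule field_le_epsilon)
    fix e :: real assume e: "e > 0"
    let ?S = "\<Union>D \<union> (E - \<Union>D)"
    have neg: "negligible (E - \<Union>D)" using C(4) unfolding D_def by simp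
    then have Slm: "?S \<in> lmeasurable"
      using Dlm by (meson fmeasurable.Un negligible_imp_measurable)
    \<comment> \<open>\<open>E\<close> need not be measurable. An open \<open>T\<close> slightly
      larger than \<open>\<Union>D\<close> together with the null remainder yields the open set
      \<open>T \<inter> U\<close> around \<open>E\<close>, to which the lower bound
      \<open>\<mu>\<close> applies.\<close>
    obtain T where T: "open T" "?S \<subseteq> T" "(T - ?S) \<in> lmeasurable" "emeasure lebesgue (T - ?S) < ennreal e"
      using sets_lebesgue_outer_open[OF fmeasurableD[OF Slm] e] .
    have "\<mu> \<le> measure lebesgue (T \<inter> U)"
      using E T by (intro \<mu>) auto
    also have "\<dots> \<le> measure lebesgue (\<Union>D \<union> ((E - \<Union>D) \<union> (T - ?S)))"
    proof (rule measure_mono_fmeasurable)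
      show "T \<inter> U \<subseteq> \<Union>D \<union> ((E - \<Union>D) \<union> (T - ?S))" by blast
      show "T \<inter> U \<in> sets lebesgue" using T(1) E(2) by (simp add: open_Int)
      show "\<Union>D \<union> ((E - \<Union>D) \<union> (T - ?S)) \<in> lmeasurable"
        using Dlm T(3) negligible_imp_measurable[OF neg] by (intro fmeasurable.Un)
    qed
    also have "\<dots> \<le> measure lebesgue (\<Union>D) + measure lebesgue ((E - \<Union>D) \<union> (T - ?S))"
      using Dm neg T(3) negligible_imp_measurable by (intro measure_Un_le) auto
    also have "measure lebesgue ((E - \<Union>D) \<union> (T - ?S)) \<le> measure lebesgue (E - \<Union>D) + measure lebesgue (T - ?S)"
      using neg T(3) negligible_imp_measurable by (intro measure_Un_le) auto
    also have "measure lebesgue (E - \<Union>D) = 0" using neg negligible_imp_measure0 by blast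
    also have "measure lebesgue (T - ?S) \<le> e"
      using T(3,4) e by (metis emeasure_eq_measure2 ennreal_less_iff less_imp_le measure_nonneg)
    finally show "\<mu> \<le> measure lebesgue (\<Union>D) + e" by simp
  qed
  obtain F where F: "F \<subseteq> D" "finite F" "measure lebesgue (\<Union>D) - \<eta> < measure lebesgue (\<Union>F)"
  proof (rule measure_countable_Union_approachable[of D \<eta> "measure lebesgue U"])
    show "countable D" using C(1) by (simp add: D_def)
    show "d \<in> lmeasurable" if "d \<in> D" for d using that by (auto simp: D_def)
    show "measure lebesgue (\<Union>D') \<le> measure lebesgue U" if "D' \<subseteq> D" "finite D'" for D'
      using that DU Um by (intro measure_mono_fmeasurable) (auto intro!: sets.finite_Union simp: D_def)
  qed (use \<eta> in auto)
  show thesis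
  proof
    show "finite F" by fact
    show "pairwise disjnt F"
    proof (rule pairwiseI)
      fix K L assume "K \<in> F" "L \<in> F" "K \<noteq> L"
      then obtain i j where "i \<in> C" "j \<in> C" "K = cball (fst i) (snd i)" "L = cball (fst j) (snd j)" "i \<noteq> j"
        using F(1) unfolding D_def by blast
      then show "disjnt K L" using pairwiseD[OF C(3)] by simp
    qed
    show "\<Union>F \<subseteq> U" using F(1) DU by blast
    show "\<mu> - \<eta> < measure lebesgue (\<Union>F)" using F(3) \<mu>D by simp
    show "\<exists>s t. s < t \<and> K = {s..t} \<and> P s t" if K: "K \<in> F" for K
    proof -
      obtain c r where "(c, r) \<in> KK" "K = cball c r" using K F(1) C(2) unfolding D_def by force
      then show ?thesis unfolding KK_def
        by (intro exI[of _ "c - r"] exI[of _ "c + r"]) (auto simp: cball_eq_atLeastAtMost)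
    qed
  qed
qed

lemma inc_id_measure:
  assumes "\<exists>a b. a < b \<and> I = {a..b::real}" "\<exists>a b. a < b \<and> J = {a..b::real}"
  shows "inc (\<lambda>x. x) (I \<inter> J) = measure lebesgue (I \<inter> J)"
proof -
  obtain a b c d where "I = {a..b}" "J = {c..d}" using assms by blast
  then have "I \<inter> J = {max a c..min b d}" by auto
  then show ?thesis by (cases "max a c \<le> min b d") auto
qed

text \<open>The part of \<open>F1\<close> outside \<open>F2\<close> splits into finitely many gap
  intervals of total length below \<open>d\<close>, so by absolute continuity the increments over
  \<open>F1\<close> differ little from those over the pairwise intersections. The double sum is
  symmetric in the two families, which makes it a common reference for comparing them.\<close>

lemma inc_comparison:
  assumes d: "\<And>D. D division_of \<Union>D \<Longrightarrow> \<Union>D \<subseteq> {A..B} \<Longrightarrow> (\<Sum>K\<in>D. inc (\<lambda>x. x) K) < d \<Longrightarrow>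
        (\<Sum>K\<in>D. \<bar>inc g K\<bar>) < e"
    and F1: "finite F1" "pairwise disjnt F1" "\<And>K. K \<in> F1 \<Longrightarrow> \<exists>a b. a < b \<and> K = {a..b::real}" "\<Union>F1 \<subseteq> {A..B}"
    and F2: "finite F2" "pairwise disjnt F2" "\<And>K. K \<in> F2 \<Longrightarrow> \<exists>a b. a < b \<and> K = {a..b::real}"
    and small: "measure lebesgue (\<Union>F1) - measure lebesgue (\<Union>F1 \<inter> \<Union>F2) < d"
  shows "\<bar>(\<Sum>I\<in>F1. inc g I) - (\<Sum>I\<in>F1. \<Sum>J\<in>F2. inc g (I \<inter> J))\<bar> < e"
proof -
  \<comment> \<open>A division has no empty members, so empty intersections are removed; they
    contribute nothing because \<open>inc\<close> is 0 on the empty set.\<close>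
  define P where "P I = (\<lambda>J. I \<inter> J) ` F2 - {{}}" for I :: "real set"
  have sumP: "(\<Sum>K\<in>P I. inc h K) = (\<Sum>J\<in>F2. inc h (I \<inter> J))" for h I
  proof -
    have "(\<Sum>K\<in>P I. inc h K) = (\<Sum>K\<in>(\<lambda>J. I \<inter> J) ` F2. inc h K)"
      unfolding P_def using F2(1) by (intro sum.mono_neutral_left) auto
    also have "\<dots> = (\<Sum>J\<in>F2. inc h (I \<inter> J))"
    proof (rule sum.reindex_nontrivial[OF F2(1), unfolded o_def])
      fix J J' assume "J \<in> F2" "J' \<in> F2" "J \<noteq> J'" "I \<inter> J = I \<inter> J'"
      then have "I \<inter> J = {}" using F2(2) by (auto simp: pairwise_def disjnt_def)
      then show "inc h (I \<inter> J) = 0" by simp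
    qed
    finally show ?thesis .
  qed
  have "\<exists>D. D division_of \<Union>D \<and> \<Union>D \<subseteq> I \<and>
     (\<forall>h. inc h I = (\<Sum>J\<in>F2. inc h (I \<inter> J)) + (\<Sum>K\<in>D. inc h K))" if I: "I \<in> F1" for I
  proof -
    obtain a b where ab: "a < b" "I = {a..b}" using F1(3)[OF I] by blast
    have "P I division_of \<Union>(P I)"
    proof (rule division_ofI)
      show "finite (P I)" using F2(1) by (simp add: P_def)
      fix K assume K: "K \<in> P I"
      then obtain J where J: "J \<in> F2" "K = I \<inter> J" by (auto simp: P_def)
      obtain c d where "J = {c..d}" using F2(3)[OF J(1)] by blast
      then have "K = cbox (max a c) (min b d)" using J ab by auto
      then show "\<exists>a b. K = cbox a b" by blast
      show "K \<subseteq> \<Union>(P I)" using K by auto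
      show "K \<noteq> {}" using K by (auto simp: P_def)
      fix L assume L: "L \<in> P I" "K \<noteq> L"
      then obtain J' where J': "J' \<in> F2" "L = I \<inter> J'" by (auto simp: P_def)
      then have "J \<noteq> J'" using L J by auto
      then have "K \<inter> L = {}" using F2(2) J J' by (auto simp: pairwise_def disjnt_def)
      then show "interior K \<inter> interior L = {}" using interior_subset by blast
    qed auto
    moreover have "\<Union>(P I) \<subseteq> {a..b}" using ab by (auto simp: P_def)
    ultimately obtain D where D: "D division_of \<Union>D" "\<Union>D \<subseteq> {a..b}"
      "\<And>h. h b - h a = (\<Sum>K\<in>P I. inc h K) + (\<Sum>K\<in>D. inc h K)"
      by (rule division_gaps[of "P I" a b]) (use ab in auto)
    then show ?thesis using ab sumP[of _ I] by (intro exI[of _ D]) auto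
  qed
  then obtain D where D: "\<And>I. I \<in> F1 \<Longrightarrow> D I division_of \<Union>(D I)" "\<And>I. I \<in> F1 \<Longrightarrow> \<Union>(D I) \<subseteq> I"
    "\<And>I h. I \<in> F1 \<Longrightarrow> inc h I = (\<Sum>J\<in>F2. inc h (I \<inter> J)) + (\<Sum>K\<in>D I. inc h K)"
    by metis
  define DD where "DD = (\<Union>I\<in>F1. D I)"
  have finD: "finite (D I)" if "I \<in> F1" for I using D(1)[OF that] by auto
  have DD_div: "DD division_of \<Union>DD"
  proof (rule division_ofI)
    show "finite DD" unfolding DD_def using F1(1) finD by blast
    fix K assume K: "K \<in> DD"
    then obtain I where I: "I \<in> F1" "K \<in> D I" by (auto simp: DD_def)
    show "K \<subseteq> \<Union>DD" using K by blast
    show "K \<noteq> {}" "\<exists>a b. K = cbox a b" using division_ofD(3,4)[OF D(1)[OF I(1)] I(2)] by auto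
    fix L assume "L \<in> DD" "K \<noteq> L"
    then obtain I' where I': "I' \<in> F1" "L \<in> D I'" by (auto simp: DD_def)
    show "interior K \<inter> interior L = {}"
    proof (cases "I = I'")
      case True
      then show ?thesis using division_ofD(5)[OF D(1)[OF I(1)] I(2)] I' \<open>K \<noteq> L\<close> by blast
    next
      case False
      then have "I \<inter> I' = {}" using F1(2) I I' by (auto simp: pairwise_def disjnt_def)
      then have "K \<inter> L = {}" using D(2)[OF I(1)] D(2)[OF I'(1)] I(2) I'(2) by blast
      then show ?thesis using interior_subset by blast
    qed
  qed auto
  have sumDD: "(\<Sum>K\<in>DD. inc h K) = (\<Sum>I\<in>F1. inc h I) - (\<Sum>I\<in>F1. \<Sum>J\<in>F2. inc h (I \<inter> J))" for h
  proof -
    have "(\<Sum>K\<in>DD. inc h K) = (\<Sum>I\<in>F1. \<Sum>K\<in>D I. inc h K)"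
      unfolding DD_def
    proof (rule sum.UNION_disjoint[OF F1(1)])
      show "\<forall>I\<in>F1. finite (D I)" using finD by blast
      show "\<forall>I\<in>F1. \<forall>J\<in>F1. I \<noteq> J \<longrightarrow> D I \<inter> D J = {}"
      proof (intro ballI impI)
        fix I I' assume I: "I \<in> F1" "I' \<in> F1" "I \<noteq> I'"
        then have "I \<inter> I' = {}" using F1(2) by (auto simp: pairwise_def disjnt_def)
        moreover have "K \<noteq> {}" if "K \<in> D I" for K using division_ofD(3)[OF D(1)[OF I(1)] that] .
        ultimately show "D I \<inter> D I' = {}" using D(2)[OF I(1)] D(2)[OF I(2)] by fastforce
      qed
    qed
    also have "\<dots> = (\<Sum>I\<in>F1. inc h I - (\<Sum>J\<in>F2. inc h (I \<inter> J)))"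
      using D(3) by (intro sum.cong) auto
    finally show ?thesis by (simp add: sum_subtractf)
  qed
  have "(\<Sum>I\<in>F1. \<Sum>J\<in>F2. inc (\<lambda>x. x) (I \<inter> J)) = (\<Sum>x\<in>F1 \<times> F2. measure lebesgue (fst x \<inter> snd x))"
    using inc_id_measure F1(3) F2(3) by (simp add: sum.cartesian_product split_def)
  also have "\<dots> = measure lebesgue (\<Union>x\<in>F1 \<times> F2. fst x \<inter> snd x)"
  proof (rule measure_negligible_finite_Union_image[symmetric])
    show "finite (F1 \<times> F2)" using F1 F2 by simp
    show "fst x \<inter> snd x \<in> lmeasurable" if "x \<in> F1 \<times> F2" for x
    proof -
      have "\<exists>a b. a < b \<and> fst x = {a..b}" "\<exists>a b. a < b \<and> snd x = {a..b}"
        using that F1(3) F2(3) by auto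
      then obtain a b c d where "fst x = {a..b}" "snd x = {c..d}" by blast
      then show ?thesis by simp
    qed
    show "pairwise (\<lambda>x y. negligible (fst x \<inter> snd x \<inter> (fst y \<inter> snd y))) (F1 \<times> F2)"
    proof (rule pairwiseI)
      fix x y assume "x \<in> F1 \<times> F2" "y \<in> F1 \<times> F2" "x \<noteq> y"
      then consider "fst x \<in> F1" "fst y \<in> F1" "fst x \<noteq> fst y" | "snd x \<in> F2" "snd y \<in> F2" "snd x \<noteq> snd y"
        by (cases x; cases y) auto
      then have "fst x \<inter> snd x \<inter> (fst y \<inter> snd y) = {}"
        by cases (use F1(2) F2(2) in \<open>force simp: pairwise_def disjnt_def\<close>)+
      then show "negligible (fst x \<inter> snd x \<inter> (fst y \<inter> snd y))" by simp
    qed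
  qed
  also have "(\<Union>x\<in>F1 \<times> F2. fst x \<inter> snd x) = \<Union>F1 \<inter> \<Union>F2" by auto
  finally have "(\<Sum>K\<in>DD. inc (\<lambda>x. x) K) < d"
    using small sumDD[of "\<lambda>x. x"] measure_disjoint_intervals[OF F1(1-3)] by simp
  moreover have "\<Union>DD \<subseteq> {A..B}" using D(2) F1(4) by (fastforce simp: DD_def)
  ultimately have "(\<Sum>K\<in>DD. \<bar>inc g K\<bar>) < e" using d DD_div by blast
  moreover have "\<bar>\<Sum>K\<in>DD. inc g K\<bar> \<le> (\<Sum>K\<in>DD. \<bar>inc g K\<bar>)" by (rule sum_abs)
  ultimately show ?thesis using sumDD[of g] by simp
qed

section \<open>Almost everywhere differentiability\<close>

lemma negligible_if_outer_measure_le_0: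
  assumes E: "E \<subseteq> {A<..<B::real}"
    and \<mu>: "\<And>\<mu>. \<mu> > 0 \<Longrightarrow> (\<And>V. open V \<Longrightarrow> E \<subseteq> V \<Longrightarrow> V \<subseteq> {A<..<B} \<Longrightarrow> \<mu> \<le> measure lebesgue V) \<Longrightarrow>
          (\<And>\<eta>. \<eta> > 0 \<Longrightarrow> \<exists>U. open U \<and> E \<subseteq> U \<and> U \<subseteq> {A<..<B} \<and> measure lebesgue U < \<mu> + \<eta>) \<Longrightarrow> False"
  shows "negligible E"
proof -
  define MM where "MM = measure lebesgue ` {V. open V \<and> E \<subseteq> V \<and> V \<subseteq> {A<..<B}}"
  have ne: "MM \<noteq> {}" using E open_greaterThanLessThan unfolding MM_def by blast
  have bdd: "bdd_below MM" unfolding MM_def by (rule bdd_belowI[of _ 0]) auto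
  \<comment> \<open>\<open>Inf MM\<close> is the outer measure of \<open>E\<close>; were it
    positive, it would satisfy every hypothesis on \<open>\<mu>\<close>.\<close>
  have "Inf MM \<le> 0"
  proof (rule ccontr)
    assume "\<not> Inf MM \<le> 0"
    then have pos: "Inf MM > 0" by simp
    have up: "\<exists>U. open U \<and> E \<subseteq> U \<and> U \<subseteq> {A<..<B} \<and> measure lebesgue U < Inf MM + \<eta>" if "\<eta> > 0" for \<eta>
      using cInf_lessD[OF ne, of "Inf MM + \<eta>"] that unfolding MM_def by auto
    show False
    proof (rule \<mu>[OF pos _ up])
      fix V assume "open V" "E \<subseteq> V" "V \<subseteq> {A<..<B}"
      then show "Inf MM \<le> measure lebesgue V" using bdd by (intro cInf_lower) (auto simp: MM_def)
    qed
  qed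
  show ?thesis unfolding negligible_outer
  proof (intro allI impI)
    fix e :: real assume "e > 0"
    then obtain U where U: "open U" "E \<subseteq> U" "U \<subseteq> {A<..<B}" "measure lebesgue U < e"
      using cInf_lessD[OF ne, of e] \<open>Inf MM \<le> 0\<close> unfolding MM_def by auto
    have "U \<in> lmeasurable"
      using lmeasurable_open_interval_subset U by blast
    then show "\<exists>T. E \<subseteq> T \<and> T \<in> lmeasurable \<and> measure lebesgue T < e" using U by blast
  qed
qed

text \<open>Vitali gives two disjoint families inside an open \<open>U\<close> barely larger than
  \<open>E\<close>, one with slopes below \<open>p\<close>, the other with slopes above
  \<open>q\<close>. Both nearly exhaust the outer measure, hence they overlap up to small length,
  and \<open>inc_comparison\<close> makes their total increments nearly equal. One is at most about
  \<open>p * \<mu>\<close>, the other at least about \<open>q * \<mu>\<close>.\<close>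

lemma negligible_derivates_gap:
  assumes ac: "abs_cont_on A B g" and E: "E \<subseteq> {A<..<B}" and pq: "p < q"
    and p: "\<And>x d. x \<in> E \<Longrightarrow> d > 0 \<Longrightarrow> \<exists>s t. s < t \<and> t - s < d \<and> s \<le> x \<and> x \<le> t \<and> g t - g s < p * (t - s)"
    and q: "\<And>x d. x \<in> E \<Longrightarrow> d > 0 \<Longrightarrow> \<exists>s t. s < t \<and> t - s < d \<and> s \<le> x \<and> x \<le> t \<and> g t - g s > q * (t - s)"
  shows "negligible E"
proof (rule negligible_if_outer_measure_le_0[OF E])
  fix \<mu> :: real assume \<mu>: "\<mu> > 0"
    "\<And>V. open V \<Longrightarrow> E \<subseteq> V \<Longrightarrow> V \<subseteq> {A<..<B} \<Longrightarrow> \<mu> \<le> measure lebesgue V"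
    and up: "\<And>\<eta>. \<eta> > 0 \<Longrightarrow> \<exists>U. open U \<and> E \<subseteq> U \<and> U \<subseteq> {A<..<B} \<and> measure lebesgue U < \<mu> + \<eta>"
  \<comment> \<open>Three errors of size \<open>e\<close> add up below, two from
    \<open>inc_comparison\<close> and one from the measures of the families; dividing by 8 leaves
    room for them.\<close>
  define e where "e = (q - p) * \<mu> / 8"
  have e: "e > 0" using \<mu> pq by (simp add: e_def)
  obtain d where d: "d > 0"
    "\<And>D. D division_of \<Union>D \<Longrightarrow> \<Union>D \<subseteq> {A..B} \<Longrightarrow> (\<Sum>K\<in>D. inc (\<lambda>x. x) K) < d \<Longrightarrow>
        (\<Sum>K\<in>D. \<bar>inc g K\<bar>) < e"
    using abs_cont_on_division[OF ac e] by blast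
  define \<eta> where "\<eta> = min (d/3) (e / (\<bar>p\<bar> + \<bar>q\<bar> + 1))"
  have \<eta>: "\<eta> > 0" "2 * \<eta> < d" using d(1) e by (auto simp: \<eta>_def)
  have "\<eta> * (\<bar>p\<bar> + \<bar>q\<bar> + 1) \<le> e / (\<bar>p\<bar> + \<bar>q\<bar> + 1) * (\<bar>p\<bar> + \<bar>q\<bar> + 1)"
    by (intro mult_right_mono) (auto simp: \<eta>_def)
  then have \<eta>3: "\<eta> * (\<bar>p\<bar> + \<bar>q\<bar> + 1) \<le> e" by simp
  obtain U where U: "open U" "E \<subseteq> U" "U \<subseteq> {A<..<B}" "measure lebesgue U < \<mu> + \<eta>" using up[OF \<eta>(1)] by blast
  have Um: "U \<in> lmeasurable"
    using lmeasurable_open_interval_subset U by blast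
  obtain F1 where F1: "finite F1" "pairwise disjnt F1" "\<And>K. K \<in> F1 \<Longrightarrow> \<exists>s t. s < t \<and> K = {s..t} \<and> g t - g s < p * (t - s)"
    "\<Union>F1 \<subseteq> U" "\<mu> - \<eta> < measure lebesgue (\<Union>F1)"
    using finite_Vitali[OF U(2,1,3) p \<mu>(2) \<eta>(1)] by blast
  obtain F2 where F2: "finite F2" "pairwise disjnt F2" "\<And>K. K \<in> F2 \<Longrightarrow> \<exists>s t. s < t \<and> K = {s..t} \<and> g t - g s > q * (t - s)"
    "\<Union>F2 \<subseteq> U" "\<mu> - \<eta> < measure lebesgue (\<Union>F2)"
    using finite_Vitali[OF U(2,1,3) q \<mu>(2) \<eta>(1)] by blast
  have i1: "\<exists>a b. a < b \<and> K = {a..b}" if "K \<in> F1" for K using F1(3)[OF that] by blast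
  have i2: "\<exists>a b. a < b \<and> K = {a..b}" if "K \<in> F2" for K using F2(3)[OF that] by blast
  have m1: "\<Union>F1 \<in> lmeasurable" using F1(1) i1 by (intro fmeasurable.finite_Union) fastforce+
  have m2: "\<Union>F2 \<in> lmeasurable" using F2(1) i2 by (intro fmeasurable.finite_Union) fastforce+
  have le1: "measure lebesgue (\<Union>F1) \<le> measure lebesgue U"
    using m1 Um F1(4) by (intro measure_mono_fmeasurable) auto
  have le2: "measure lebesgue (\<Union>F2) \<le> measure lebesgue U"
    using m2 Um F2(4) by (intro measure_mono_fmeasurable) auto
  have "measure lebesgue (\<Union>F1 \<union> \<Union>F2) \<le> measure lebesgue U"
    using m1 m2 Um F1(4) F2(4) by (intro measure_mono_fmeasurable) auto
  then have un: "measure lebesgue (\<Union>F1) + measure lebesgue (\<Union>F2) - measure lebesgue (\<Union>F1 \<inter> \<Union>F2) \<le> measure lebesgue U"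
    using measure_Un3[OF m1 m2] by simp
  have sub: "\<Union>F1 \<subseteq> {A..B}" "\<Union>F2 \<subseteq> {A..B}" using F1(4) F2(4) U(3) by force+
  have c1: "\<bar>(\<Sum>I\<in>F1. inc g I) - (\<Sum>I\<in>F1. \<Sum>J\<in>F2. inc g (I \<inter> J))\<bar> < e"
    by (rule inc_comparison[OF d(2) F1(1,2) i1 sub(1) F2(1,2) i2]) (use un F2(5) U(4) \<eta> in auto)
  have "\<bar>(\<Sum>I\<in>F2. inc g I) - (\<Sum>I\<in>F2. \<Sum>J\<in>F1. inc g (I \<inter> J))\<bar> < e"
    by (rule inc_comparison[OF d(2) F2(1,2) i2 sub(2) F1(1,2) i1])
       (use un F1(5) U(4) \<eta> in \<open>auto simp: Int_commute\<close>)
  also have "(\<Sum>I\<in>F2. \<Sum>J\<in>F1. inc g (I \<inter> J)) = (\<Sum>I\<in>F1. \<Sum>J\<in>F2. inc g (I \<inter> J))"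
    by (subst sum.swap) (simp add: Int_commute)
  finally have c2: "(\<Sum>I\<in>F2. inc g I) - (\<Sum>I\<in>F1. inc g I) < 2 * e" using c1 by linarith
  have "(\<Sum>I\<in>F1. inc g I) \<le> (\<Sum>I\<in>F1. p * inc (\<lambda>x. x) I)"
    by (intro sum_mono) (auto dest!: F1(3))
  then have s1: "(\<Sum>I\<in>F1. inc g I) \<le> p * measure lebesgue (\<Union>F1)"
    using measure_disjoint_intervals[OF F1(1,2) i1] by (simp add: sum_distrib_left)
  have "(\<Sum>I\<in>F2. q * inc (\<lambda>x. x) I) \<le> (\<Sum>I\<in>F2. inc g I)"
    by (intro sum_mono) (auto dest!: F2(3))
  then have s2: "q * measure lebesgue (\<Union>F2) \<le> (\<Sum>I\<in>F2. inc g I)"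
    using measure_disjoint_intervals[OF F2(1,2) i2] by (simp add: sum_distrib_left)
  have "\<bar>p * (measure lebesgue (\<Union>F1) - \<mu>)\<bar> \<le> \<bar>p\<bar> * \<eta>"
    using le1 U(4) F1(5) by (auto simp: abs_mult intro!: mult_left_mono)
  moreover have "\<bar>q * (measure lebesgue (\<Union>F2) - \<mu>)\<bar> \<le> \<bar>q\<bar> * \<eta>"
    using le2 U(4) F2(5) by (auto simp: abs_mult intro!: mult_left_mono)
  ultimately have "(q - p) * \<mu> < 2 * e + (\<bar>p\<bar> + \<bar>q\<bar>) * \<eta>"
    using s1 s2 c2 by (simp add: algebra_simps)
  also have "(\<bar>p\<bar> + \<bar>q\<bar>) * \<eta> \<le> e" using \<eta>3 \<eta>(1) by (simp add: algebra_simps)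
  finally have "(q - p) * \<mu> < 3 * ((q - p) * \<mu> / 8)" by (simp add: e_def)
  moreover have "(q - p) * \<mu> > 0" using pq \<mu>(1) by simp
  ultimately show False by linarith
qed

text \<open>Inside an interval of length at most \<open>d/2\<close> increments over disjoint
  intervals sum to less than 1, whereas slopes above \<open>2 / \<mu>\<close> on a total length
  above \<open>\<mu>/2\<close> would give more than 1. Negligibility is a local property, so short
  intervals suffice.\<close>

lemma negligible_infinite_derivate:
  assumes ac: "abs_cont_on A B g" and E: "E \<subseteq> {A<..<B}"
    and Q: "\<And>x d Q. x \<in> E \<Longrightarrow> d > 0 \<Longrightarrow> \<exists>s t. s < t \<and> t - s < d \<and> s \<le> x \<and> x \<le> t \<and> \<bar>g t - g s\<bar> > Q * (t - s)"
  shows "negligible E"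
proof -
  obtain d where d: "d > 0"
    "\<And>D. D division_of \<Union>D \<Longrightarrow> \<Union>D \<subseteq> {A..B} \<Longrightarrow> (\<Sum>K\<in>D. inc (\<lambda>x. x) K) < d \<Longrightarrow>
        (\<Sum>K\<in>D. \<bar>inc g K\<bar>) < 1"
    using abs_cont_on_division[OF ac zero_less_one] by metis
  have loc: "negligible (E \<inter> {c<..<c'})" if "A \<le> c" "c' \<le> B" "c' - c \<le> d/2" for c c'
  proof (rule negligible_if_outer_measure_le_0[of _ c "c'"])
    fix \<mu> :: real assume \<mu>: "\<mu> > 0"
      "\<And>V. open V \<Longrightarrow> E \<inter> {c<..<c'} \<subseteq> V \<Longrightarrow> V \<subseteq> {c<..<c'} \<Longrightarrow> \<mu> \<le> measure lebesgue V"
    obtain F where F: "finite F" "pairwise disjnt F"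
      "\<And>K. K \<in> F \<Longrightarrow> \<exists>s t. s < t \<and> K = {s..t} \<and> \<bar>g t - g s\<bar> > 2 / \<mu> * (t - s)"
      "\<Union>F \<subseteq> {c<..<c'}" "\<mu> - \<mu>/2 < measure lebesgue (\<Union>F)"
    proof (rule finite_Vitali[of "E \<inter> {c<..<c'}" "{c<..<c'}" c "c'" "\<lambda>s t. \<bar>g t - g s\<bar> > 2 / \<mu> * (t - s)" \<mu> "\<mu>/2"])
      fix x e :: real assume "x \<in> E \<inter> {c<..<c'}" "0 < e"
      then show "\<exists>s t. s < t \<and> t - s < e \<and> s \<le> x \<and> x \<le> t \<and> 2 / \<mu> * (t - s) < \<bar>g t - g s\<bar>"
        using Q by blast
    qed (use \<mu> in auto)
    have i: "\<exists>a b. a < b \<and> K = {a..b}" if "K \<in> F" for K using F(3)[OF that] by blast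
    have div: "F division_of \<Union>F" using division_of_disjoint_intervals[OF F(1,2) i] .
    have len: "measure lebesgue (\<Union>F) = (\<Sum>K\<in>F. inc (\<lambda>x. x) K)"
      using measure_disjoint_intervals[OF F(1,2) i] .
    have "measure lebesgue (\<Union>F) \<le> measure lebesgue {c<..<c'}"
      using F i by (intro measure_mono_fmeasurable) (auto intro!: sets.finite_Union dest!: i)
    also have "\<dots> \<le> d/2" using d that(3) by (cases "c \<le> c'") auto
    finally have "(\<Sum>K\<in>F. inc (\<lambda>x. x) K) < d" using len d(1) by simp
    moreover have "\<Union>F \<subseteq> {A..B}" using F(4) that by force
    ultimately have "(\<Sum>K\<in>F. \<bar>inc g K\<bar>) < 1" using d(2) div by blast
    moreover have "(\<Sum>K\<in>F. 2 / \<mu> * inc (\<lambda>x. x) K) \<le> (\<Sum>K\<in>F. \<bar>inc g K\<bar>)"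
      by (intro sum_mono) (auto dest!: F(3))
    ultimately have "2 / \<mu> * measure lebesgue (\<Union>F) < 1" using len by (simp add: sum_distrib_left)
    moreover have "2 / \<mu> * (\<mu>/2) < 2 / \<mu> * measure lebesgue (\<Union>F)"
      using F(5) \<mu>(1) by (intro mult_strict_left_mono) auto
    ultimately show False using \<mu>(1) by simp
  qed auto
  show ?thesis unfolding locally_negligible_alt[of E]
  proof
    fix x assume x: "x \<in> E"
    define c c' where "c = max A (x - d/4)" and "c' = min B (x + d/4)"
    have "A \<le> c" "c' \<le> B" "c' - c \<le> d/2" "c < x" "x < c'"
      using x E d(1) by (auto simp: c_def c'_def max_def min_def)
    then show "\<exists>U. openin (top_of_set E) U \<and> x \<in> U \<and> negligible U"
      using loc[of c c'] x by (intro exI[of _ "E \<inter> {c<..<c'}"]) (auto simp: openin_open)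
  qed
qed

text \<open>The derivative is found as the supremum of the eventual lower bounds of the difference
  quotient, which is a slope over an interval ending in \<open>x\<close>. For rationals
  \<open>p < q\<close> just above this supremum the first alternative is impossible, so
  \<open>q\<close> is an eventual upper bound.\<close>

lemma differentiable_if_derivates_agree:
  fixes g :: "real \<Rightarrow> real"
  assumes bd: "d0 > 0" "\<And>s t. s < t \<Longrightarrow> t - s < d0 \<Longrightarrow> s \<le> x \<Longrightarrow> x \<le> t \<Longrightarrow> \<bar>g t - g s\<bar> \<le> Q * (t - s)"
    and pq: "\<And>p q. p \<in> \<rat> \<Longrightarrow> q \<in> \<rat> \<Longrightarrow> p < q \<Longrightarrow> \<exists>d>0.
      (\<forall>s t. s < t \<longrightarrow> t - s < d \<longrightarrow> s \<le> x \<longrightarrow> x \<le> t \<longrightarrow> g t - g s \<ge> p * (t - s)) \<or>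
      (\<forall>s t. s < t \<longrightarrow> t - s < d \<longrightarrow> s \<le> x \<longrightarrow> x \<le> t \<longrightarrow> g t - g s \<le> q * (t - s))"
  shows "g differentiable (at x)"
proof -
  define m where "m y = (g y - g x) / (y - x)" for y
  have m_cases: "(\<exists>s t. s < t \<and> t - s = \<bar>y - x\<bar> \<and> s \<le> x \<and> x \<le> t \<and> m y * (t - s) = g t - g s)" if "y \<noteq> x" for y
  proof (cases "x < y")
    case True
    then show ?thesis by (intro exI[of _ x] exI[of _ y]) (auto simp: m_def)
  next
    case False
    then show ?thesis using that
      by (intro exI[of _ y] exI[of _ x]) (auto simp: m_def field_simps)
  qed
  have ev: "eventually (\<lambda>y. P (m y)) (at x)"
    if "d > 0" "\<And>s t c. s < t \<Longrightarrow> t - s < d \<Longrightarrow> s \<le> x \<Longrightarrow> x \<le> t \<Longrightarrow> c * (t - s) = g t - g s \<Longrightarrow> P c" for d P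
    unfolding eventually_at
  proof (intro exI[of _ d] conjI ballI impI)
    fix y assume "y \<noteq> x \<and> dist y x < d"
    then obtain s t where "s < t" "t - s = \<bar>y - x\<bar>" "s \<le> x" "x \<le> t" "m y * (t - s) = g t - g s" "\<bar>y - x\<bar> < d"
      using m_cases[of y] by (auto simp: dist_real_def)
    then show "P (m y)" using that(2)[of s t "m y"] by simp
  qed fact
  define S where "S = {p. eventually (\<lambda>y. m y \<ge> p) (at x)}"
  have m_bd: "eventually (\<lambda>y. \<bar>m y\<bar> \<le> Q) (at x)"
  proof (rule ev[OF bd(1)])
    fix s t c :: real assume *: "s < t" "t - s < d0" "s \<le> x" "x \<le> t" "c * (t - s) = g t - g s"
    then have "\<bar>c\<bar> * (t - s) \<le> Q * (t - s)" using bd(2)[of s t] by (simp add: abs_mult flip: *(5))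
    then show "\<bar>c\<bar> \<le> Q" using *(1) by simp
  qed
  have S1: "-Q \<in> S" unfolding S_def using m_bd by (auto elim: eventually_mono)
  have S2: "p \<le> Q" if "p \<in> S" for p
  proof -
    have "eventually (\<lambda>y. p \<le> m y \<and> \<bar>m y\<bar> \<le> Q) (at x)"
      using that m_bd unfolding S_def by (auto intro: eventually_conj)
    then obtain y where "p \<le> m y \<and> \<bar>m y\<bar> \<le> Q" using eventually_happens'[OF at_neq_bot] by blast
    then show ?thesis by linarith
  qed
  have bdd: "bdd_above S" using S2 by (rule bdd_aboveI)
  have "(m \<longlongrightarrow> Sup S) (at x)"
  proof (rule order_tendstoI)
    fix a assume "a < Sup S"
    then obtain p where "p \<in> S" "a < p" using less_cSup_iff[of S a] S1 bdd by blast
    then show "eventually (\<lambda>y. a < m y) (at x)" unfolding S_def by (auto elim: eventually_mono)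
  next
    fix a assume "Sup S < a"
    then obtain q where q: "q \<in> \<rat>" "Sup S < q" "q < a" using Rats_dense_in_real by blast
    then obtain p where p: "p \<in> \<rat>" "Sup S < p" "p < q" using Rats_dense_in_real by blast
    obtain d where d: "d > 0" and alt: "(\<forall>s t. s < t \<longrightarrow> t - s < d \<longrightarrow> s \<le> x \<longrightarrow> x \<le> t \<longrightarrow> g t - g s \<ge> p * (t - s)) \<or>
      (\<forall>s t. s < t \<longrightarrow> t - s < d \<longrightarrow> s \<le> x \<longrightarrow> x \<le> t \<longrightarrow> g t - g s \<le> q * (t - s))"
      using pq[OF p(1) q(1) p(3)] by blast
    show "eventually (\<lambda>y. m y < a) (at x)"
      using alt
    proof
      assume *: "\<forall>s t. s < t \<longrightarrow> t - s < d \<longrightarrow> s \<le> x \<longrightarrow> x \<le> t \<longrightarrow> g t - g s \<ge> p * (t - s)"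
      have "eventually (\<lambda>y. p \<le> m y) (at x)"
      proof (rule ev[OF d])
        fix s t c :: real assume "s < t" "t - s < d" "s \<le> x" "x \<le> t" "c * (t - s) = g t - g s"
        then have "p * (t - s) \<le> c * (t - s)" "s < t" using * by auto
        then show "p \<le> c" by simp
      qed
      then have "p \<in> S" by (simp add: S_def)
      then show ?thesis using cSup_upper[OF _ bdd] p(2) by fastforce
    next
      assume *: "\<forall>s t. s < t \<longrightarrow> t - s < d \<longrightarrow> s \<le> x \<longrightarrow> x \<le> t \<longrightarrow> g t - g s \<le> q * (t - s)"
      show ?thesis
      proof (rule ev[OF d])
        fix s t c :: real assume "s < t" "t - s < d" "s \<le> x" "x \<le> t" "c * (t - s) = g t - g s"
        then have "c * (t - s) \<le> q * (t - s)" "s < t" using * by auto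
        then show "c < a" using q(3) by simp
      qed
    qed
  qed
  then have "(g has_field_derivative Sup S) (at x)"
    unfolding has_field_derivative_iff m_def .
  then show ?thesis using real_differentiable_def by blast
qed

text \<open>Where differentiability fails, either the slopes are unbounded (\<open>EI\<close>) or a
  pair of rationals separates slopes over arbitrarily short intervals (\<open>ED\<close>). Countably
  many sets of these kinds cover all failures.\<close>

lemma abs_cont_differentiable_AE:
  assumes ac: "\<And>u v. abs_cont_on u v g"
  shows "negligible {x. \<not> g differentiable (at x)}"
proof -
  define EI where "EI n = {x \<in> {- real n<..<real n}. \<forall>d>0. \<forall>Q. \<exists>s t. s < t \<and> t - s < d \<and> s \<le> x \<and> x \<le> t \<and> \<bar>g t - g s\<bar> > Q * (t - s)}" for n
  define ED where "ED n p q = {x \<in> {- real n<..<real n}.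
     (\<forall>d>0. \<exists>s t. s < t \<and> t - s < d \<and> s \<le> x \<and> x \<le> t \<and> g t - g s < p * (t - s)) \<and>
     (\<forall>d>0. \<exists>s t. s < t \<and> t - s < d \<and> s \<le> x \<and> x \<le> t \<and> g t - g s > q * (t - s))}" for n p q
  have "negligible (EI n)" for n
    by (rule negligible_infinite_derivate[OF ac[of "- real n" "real n"]]) (auto simp: EI_def)
  moreover have "negligible (ED n p q)" if "p < q" for n p q
    by (rule negligible_derivates_gap[OF ac[of "- real n" "real n"] _ that]) (auto simp: ED_def)
  ultimately have "negligible ((\<Union>n. EI n) \<union> (\<Union>(n, p, q) \<in> UNIV \<times> {(p, q). p \<in> \<rat> \<and> q \<in> \<rat> \<and> p < q}. ED n p q))"
  proof (intro negligible_Un negligible_countable_Union)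
    have "countable (\<rat> \<times> \<rat> :: (real \<times> real) set)" using countable_rat by (intro countable_SIGMA)
    then have "countable {(p, q). p \<in> \<rat> \<and> q \<in> \<rat> \<and> p < (q::real)}"
      by (rule countable_subset[rotated]) auto
    then show "countable ((\<lambda>(n, p, q). ED n p q) ` (UNIV \<times> {(p, q). p \<in> \<rat> \<and> q \<in> \<rat> \<and> p < q}))"
      by auto
  qed auto
  moreover have "{x. \<not> g differentiable (at x)} \<subseteq> (\<Union>n. EI n) \<union> (\<Union>(n, p, q) \<in> UNIV \<times> {(p, q). p \<in> \<rat> \<and> q \<in> \<rat> \<and> p < q}. ED n p q)"
  proof (intro subsetI, rule ccontr)
    fix x assume x: "x \<in> {x. \<not> g differentiable (at x)}"
      "x \<notin> (\<Union>n. EI n) \<union> (\<Union>(n, p, q) \<in> UNIV \<times> {(p, q). p \<in> \<rat> \<and> q \<in> \<rat> \<and> p < q}. ED n p q)"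
    obtain n where n: "\<bar>x\<bar> < real n" using reals_Archimedean2 by blast
    then have xn: "x \<in> {- real n<..<real n}" by auto
    have "x \<notin> EI n" using x(2) by blast
    then obtain d0 Q where 1: "d0 > 0" "\<And>s t. s < t \<Longrightarrow> t - s < d0 \<Longrightarrow> s \<le> x \<Longrightarrow> x \<le> t \<Longrightarrow> \<bar>g t - g s\<bar> \<le> Q * (t - s)"
      using xn unfolding EI_def mem_Collect_eq by (metis not_less)
    have "g differentiable (at x)"
    proof (rule differentiable_if_derivates_agree[OF 1])
      fix p q :: real assume "p \<in> \<rat>" "q \<in> \<rat>" "p < q"
      then have "x \<notin> ED n p q" using x(2) by blast
      then consider d where "d > 0" "\<And>s t. s < t \<Longrightarrow> t - s < d \<Longrightarrow> s \<le> x \<Longrightarrow> x \<le> t \<Longrightarrow> g t - g s \<ge> p * (t - s)"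
        | d where "d > 0" "\<And>s t. s < t \<Longrightarrow> t - s < d \<Longrightarrow> s \<le> x \<Longrightarrow> x \<le> t \<Longrightarrow> g t - g s \<le> q * (t - s)"
        using xn unfolding ED_def mem_Collect_eq by (metis not_less)
      then show "\<exists>d>0. (\<forall>s t. s < t \<longrightarrow> t - s < d \<longrightarrow> s \<le> x \<longrightarrow> x \<le> t \<longrightarrow> g t - g s \<ge> p * (t - s)) \<or>
        (\<forall>s t. s < t \<longrightarrow> t - s < d \<longrightarrow> s \<le> x \<longrightarrow> x \<le> t \<longrightarrow> g t - g s \<le> q * (t - s))"
      proof cases
        case (1 d)
        then show ?thesis by (intro exI[of _ d]) simp
      next
        case (2 d)
        then show ?thesis by (intro exI[of _ d]) simp
      qed
    qed
    then show False using x(1) by simp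
  qed
  ultimately show ?thesis by (rule negligible_subset)
qed

text \<open>At points where the derivative does not exist, \<open>deriv\<close> is an arbitrary number; almost
  everywhere differentiability of \<open>g\<close> is what rules out trouble there.\<close>

lemma abs_cont_Lipschitz:
  assumes ac: "\<And>u v. abs_cont_on u v g" and M: "AE x in lebesgue. \<bar>deriv g x\<bar> \<le> M" "M \<ge> 0"
  shows "\<bar>g y - g x\<bar> \<le> M * \<bar>y - x\<bar>"
proof -
  have neg: "negligible {x. \<not> (g differentiable (at x) \<and> \<bar>deriv g x\<bar> \<le> M)}"
  proof -
    have "negligible {x. \<not> \<bar>deriv g x\<bar> \<le> M}"
      using M(1) by (auto simp: AE_iff_null_sets negligible_iff_null_sets eventually_ae_filter
          intro: completion.complete2)
    then show ?thesis using abs_cont_differentiable_AE[OF ac]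
      by (rule negligible_subset[OF negligible_Un]) auto
  qed
  have main: "\<bar>g b - g a\<bar> \<le> M * (b - a)" if ab: "a < b" for a b
  proof (rule field_le_epsilon)
    fix e' :: real assume e': "e' > 0"
    \<comment> \<open>Chosen so that the error \<open>e * (b - a)\<close> from the slopes and the
      error \<open>e\<close> from the gaps add up to \<open>e'\<close>.\<close>
    define e where "e = e' / (b - a + 1)"
    have "e * (b - a + 1) = e'" using ab by (simp add: e_def)
    then have e: "e > 0" "e * (b - a) + e = e'" using e' ab by (simp_all add: e_def distrib_left)
    obtain d where d: "d > 0"
      "\<And>D. D division_of \<Union>D \<Longrightarrow> \<Union>D \<subseteq> {a..b} \<Longrightarrow> (\<Sum>K\<in>D. inc (\<lambda>x. x) K) < d \<Longrightarrow>
        (\<Sum>K\<in>D. \<bar>inc g K\<bar>) < e"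
      using abs_cont_on_division[OF ac[of a b] e(1)] by metis
    \<comment> \<open>\<open>E\<close> has full measure in \<open>{a<..<b}\<close>, so disjoint
      intervals of slope at most \<open>M + e\<close> fill all but length \<open>d\<close>, and the
      gaps contribute less than \<open>e\<close> by the choice of \<open>d\<close>.\<close>
    define E where "E = {x \<in> {a<..<b}. g differentiable (at x) \<and> \<bar>deriv g x\<bar> \<le> M}"
    obtain F where F: "finite F" "pairwise disjnt F"
      "\<And>K. K \<in> F \<Longrightarrow> \<exists>s t. s < t \<and> K = {s..t} \<and> \<bar>g t - g s\<bar> \<le> (M + e) * (t - s)"
      "\<Union>F \<subseteq> {a<..<b}" "(b - a) - d < measure lebesgue (\<Union>F)"
    proof (rule finite_Vitali[of E "{a<..<b}" a b "\<lambda>s t. \<bar>g t - g s\<bar> \<le> (M + e) * (t - s)" "b - a" d])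
      fix x \<delta> :: real assume x: "x \<in> E" "\<delta> > 0"
      have "(g has_field_derivative deriv g x) (at x)"
        using x unfolding E_def by (simp add: DERIV_deriv_iff_real_differentiable)
      then have "((\<lambda>h. (g (x + h) - g x) / h) \<longlongrightarrow> deriv g x) (at 0)"
        by (simp add: DERIV_def)
      then have "eventually (\<lambda>h. dist ((g (x + h) - g x) / h) (deriv g x) < e) (at 0)"
        using e(1) by (rule tendstoD)
      then obtain r where r: "r > 0" "\<And>h. h \<noteq> 0 \<Longrightarrow> \<bar>h\<bar> < r \<Longrightarrow> dist ((g (x + h) - g x) / h) (deriv g x) < e"
        unfolding eventually_at by (auto simp: dist_real_def)
      define h where "h = min r \<delta> / 2"
      have h: "h > 0" "h < r" "h < \<delta>" using r(1) x(2) by (auto simp: h_def)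
      have "\<bar>(g (x + h) - g x) / h\<bar> \<le> M + e"
        using r(2)[of h] h x(1) unfolding E_def dist_real_def by auto
      then have "\<bar>g (x + h) - g x\<bar> \<le> (M + e) * h" using h(1) by (simp add: abs_divide pos_divide_le_eq)
      then show "\<exists>s t. s < t \<and> t - s < \<delta> \<and> s \<le> x \<and> x \<le> t \<and> \<bar>g t - g s\<bar> \<le> (M + e) * (t - s)"
        using h by (intro exI[of _ x] exI[of _ "x + h"]) auto
    next
      fix V assume V: "open V" "E \<subseteq> V" "V \<subseteq> {a<..<b}"
      have Vm: "V \<in> lmeasurable" using lmeasurable_open_interval_subset V by blast
      have "negligible ({a<..<b} - V)"
        by (rule negligible_subset[OF neg]) (use V(2) in \<open>auto simp: E_def\<close>)
      then have "measure lebesgue ({a<..<b} - ({a<..<b} - V)) = measure lebesgue {a<..<b}"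
        by (intro measure_Diff_null_set) (auto simp: negligible_iff_null_sets)
      moreover have "{a<..<b} - ({a<..<b} - V) = V" using V(3) by blast
      ultimately show "b - a \<le> measure lebesgue V" using ab by simp
    qed (use d in \<open>auto simp: E_def\<close>)
    have i: "\<exists>a b. a < b \<and> K = {a..b}" if "K \<in> F" for K using F(3)[OF that] by blast
    have div: "F division_of \<Union>F" using division_of_disjoint_intervals[OF F(1,2) i] .
    have "\<Union>F \<subseteq> {a..b}" using F(4) by force
    then obtain D where D: "D division_of \<Union>D" "\<Union>D \<subseteq> {a..b}"
      "\<And>h. h b - h a = (\<Sum>K\<in>F. inc h K) + (\<Sum>K\<in>D. inc h K)"
      using division_gaps[OF div _ less_imp_le[OF ab]] by metis
    have len: "measure lebesgue (\<Union>F) = (\<Sum>K\<in>F. inc (\<lambda>x. x) K)"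
      using measure_disjoint_intervals[OF F(1,2) i] .
    have "(\<Sum>K\<in>D. inc (\<lambda>x. x) K) < d" using D(3)[of "\<lambda>x. x"] len F(5) by simp
    then have "(\<Sum>K\<in>D. \<bar>inc g K\<bar>) < e" using d(2) D by blast
    then have 1: "\<bar>\<Sum>K\<in>D. inc g K\<bar> < e" using sum_abs[of "inc g" D] by linarith
    have "0 \<le> inc (\<lambda>x. x) K" if "K \<in> D" for K using division_of_interval[OF D(1) that] by auto
    then have "0 \<le> (\<Sum>K\<in>D. inc (\<lambda>x. x) K)" by (rule sum_nonneg)
    then have lenF: "(\<Sum>K\<in>F. inc (\<lambda>x. x) K) \<le> b - a" using D(3)[of "\<lambda>x. x"] by simp
    have "\<bar>\<Sum>K\<in>F. inc g K\<bar> \<le> (\<Sum>K\<in>F. \<bar>inc g K\<bar>)" by (rule sum_abs)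
    also have "\<dots> \<le> (\<Sum>K\<in>F. (M + e) * inc (\<lambda>x. x) K)"
      by (intro sum_mono) (auto dest!: F(3))
    also have "\<dots> \<le> (M + e) * (b - a)"
      unfolding sum_distrib_left[symmetric] using lenF M(2) e by (intro mult_left_mono) auto
    finally show "\<bar>g b - g a\<bar> \<le> M * (b - a) + e'"
      using 1 D(3)[of g] e(2) by (simp add: algebra_simps)
  qed
  show ?thesis
    using main[of x y] main[of y x] by (cases x y rule: linorder_cases) (auto simp: abs_minus_commute)
qed

section \<open>Periodic functions and their smoothing\<close>

lemma has_integral_antiderivative:
  fixes F :: "real \<Rightarrow> real"
  assumes "\<And>x. (F has_real_derivative f x) (at x)" "a \<le> b"
  shows "(f has_integral (F b - F a)) {a..b}"
  using assms by (intro fundamental_theorem_of_calculus)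
    (auto simp: has_real_derivative_iff_has_vector_derivative[symmetric] intro: has_field_derivative_at_within)

lemma integral_antiderivative:
  fixes F :: "real \<Rightarrow> real"
  assumes "\<And>x. (F has_real_derivative f x) (at x)" "a \<le> b"
  shows "integral {a..b} f = F b - F a"
  using has_integral_antiderivative[OF assms] by (rule integral_unique)

lemma DERIV_imp_continuous_on:
  fixes F :: "real \<Rightarrow> real"
  assumes "\<And>x. (F has_real_derivative f x) (at x)"
  shows "continuous_on S F"
  using assms by (meson DERIV_continuous continuous_at_imp_continuous_on)

lemma DERIV_reflect:
  fixes F :: "real \<Rightarrow> real"
  assumes "\<And>x. (F has_real_derivative f x) (at x)"
  shows "((\<lambda>u. F (y - u)) has_real_derivative - f (y - u)) (at u)"
proof -
  have "((\<lambda>u. y - u) has_real_derivative -1) (at u)" by (auto intro!: derivative_eq_intros)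
  from DERIV_chain2[OF assms this] show ?thesis by simp
qed

lemma DERIV_translate:
  fixes F :: "real \<Rightarrow> real"
  assumes "\<And>x. (F has_real_derivative f x) (at x)"
  shows "((\<lambda>u. F (u + y)) has_real_derivative f (u + y)) (at u)"
  using assms DERIV_shift by blast

lemma continuous_antiderivative:
  fixes g :: "real \<Rightarrow> real"
  assumes g: "continuous_on UNIV g"
  obtains G where "\<And>x. (G has_real_derivative g x) (at x)"
proof
  define G where "G x = (if x \<ge> 0 then integral {0..x} g else - integral {x..0} g)" for x
  have int: "g integrable_on {a..b}" for a b
    using g continuous_on_subset integrable_continuous_real by blast
  fix x :: real
  \<comment> \<open>The base point \<open>a\<close> lies to the left of both 0 and \<open>x\<close>,
    so that near \<open>x\<close> the integral from \<open>a\<close> differs from \<open>G\<close>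
    by a constant, whatever the sign of \<open>x\<close>.\<close>
  define a b where "a = min x 0 - 1" and "b = max x 0 + 1"
  define H where "H y = integral {a..y} g" for y :: real
  have ab: "a < x" "x < b" "a < 0" "0 < b" by (auto simp: a_def b_def)
  have "(H has_vector_derivative g x) (at x within {a..b})"
    unfolding H_def using ab g by (intro integral_has_vector_derivative) (auto intro: continuous_on_subset)
  then have "(H has_real_derivative g x) (at x within {a<..<b})"
    by (auto simp: has_real_derivative_iff_has_vector_derivative intro: has_vector_derivative_within_subset)
  then have "(H has_real_derivative g x) (at x)"
    using ab by (subst (asm) at_within_open) auto
  then have "((\<lambda>y. H y - H 0) has_real_derivative g x) (at x)"
    by (auto intro!: derivative_eq_intros)
  then show "(G has_real_derivative g x) (at x)"
  proof (rule DERIV_cong_ev[THEN iffD1, rotated -1])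
    have "H y - H 0 = G y" if y: "y \<in> {a<..<b}" for y
    proof (cases "y \<ge> 0")
      case True
      then have "H 0 + integral {0..y} g = H y" unfolding H_def using ab int
        by (intro Henstock_Kurzweil_Integration.integral_combine) auto
      then show ?thesis using True by (simp add: G_def)
    next
      case False
      then have "H y + integral {y..0} g = H 0" unfolding H_def using ab int y
        by (intro Henstock_Kurzweil_Integration.integral_combine) auto
      then show ?thesis using False by (simp add: G_def)
    qed
    then show "eventually (\<lambda>y. H y - H 0 = G y) (nhds x)"
      using eventually_nhds_in_open[of "{a<..<b}" x] ab by (auto elim: eventually_mono)
  qed auto
qed

lemma constant_if_deriv_zero:
  fixes F :: "real \<Rightarrow> real"
  assumes "\<And>x. (F has_real_derivative 0) (at x)"
  shows "F x = F y"
  using DERIV_isconst_all assms by blast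

section \<open>Periodic functions and integrals over a period\<close>

lemma periodic2piD: "periodic2pi f \<Longrightarrow> f (x + 2 * pi) = f x"
  by (simp add: periodic2pi_def)

lemma periodic2pi_minus: "periodic2pi f \<Longrightarrow> f (x - 2 * pi) = f x"
  using periodic2piD[of f "x - 2 * pi"] by simp

lemma periodic2pi_of_nat:
  assumes "periodic2pi f" shows "f (x + 2 * pi * real n) = f x"
proof (induction n)
  case (Suc n)
  have "f (x + 2 * pi * real (Suc n)) = f ((x + 2 * pi * real n) + 2 * pi)" by (simp add: algebra_simps)
  then show ?case using Suc assms by (simp only: periodic2piD)
qed simp

lemma periodic2pi_of_int:
  assumes "periodic2pi f" shows "f (x + 2 * pi * of_int n) = f x"
proof (cases n)
  case (nonneg m)
  then show ?thesis using periodic2pi_of_nat[OF assms] by simp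
next
  case (neg m)
  have "x = (x + 2 * pi * of_int n) + 2 * pi * real (Suc m)" 
  proof -
    have "real_of_int n = - real (Suc m)" using neg by simp
    then show ?thesis by (simp only:)
  qed
  then show ?thesis using periodic2pi_of_nat[OF assms, of "x + 2 * pi * of_int n" "Suc m"] by metis
qed

lemma reduce_mod_2pi:
  obtains k :: int where "b \<le> x + 2 * pi * of_int k" "x + 2 * pi * of_int k < b + 2 * pi"
proof
  define k where "k = \<lfloor>(x - b) / (2 * pi)\<rfloor>"
  have "of_int k \<le> (x - b) / (2 * pi)" "(x - b) / (2 * pi) < of_int k + 1"
    unfolding k_def by linarith+
  then show "b \<le> x + 2 * pi * of_int (- k)" "x + 2 * pi * of_int (- k) < b + 2 * pi"
    using pi_gt_zero by (simp_all add: field_simps)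
qed

lemma periodic2pi_shift: "periodic2pi f \<Longrightarrow> periodic2pi (\<lambda>x. f (x + c))"
  unfolding periodic2pi_def by (metis add.assoc add.commute)

lemma periodic2pi_reflect: "periodic2pi f \<Longrightarrow> periodic2pi (\<lambda>x. f (c - x))"
  using periodic2pi_minus[of f "c - _"] by (simp add: periodic2pi_def algebra_simps)

text \<open>The increment of an antiderivative over one period does not depend on where the period
  starts.\<close>

lemma periodic2pi_integral_reflect:
  assumes g: "continuous_on UNIV g" "periodic2pi g"
  shows "integral {0..2*pi} (\<lambda>u. g (y - u)) = integral {0..2*pi} g"
proof -
  obtain G where G: "\<And>x. (G has_real_derivative g x) (at x)" using continuous_antiderivative[OF g(1)] by metis
  have "((\<lambda>x. G (x + 2 * pi) - G x) has_real_derivative 0) (at x)" for x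
    using DERIV_diff[OF DERIV_translate[OF G, where y="2*pi"] G[of x]] periodic2piD[OF g(2), of x] by simp
  from constant_if_deriv_zero[OF this, of 0 "y - 2 * pi"]
  have 1: "G (2 * pi) - G 0 = G y - G (y - 2 * pi)" by simp
  have "((\<lambda>u. - G (y - u)) has_real_derivative g (y - u)) (at u)" for u
    using DERIV_minus[OF DERIV_reflect[of G g, OF G]] by simp
  then have "integral {0..2*pi} (\<lambda>u. g (y - u)) = - G (y - 2*pi) - - G (y - 0)"
    by (intro integral_antiderivative) auto
  also have "\<dots> = integral {0..2*pi} g" using 1 integral_antiderivative[OF G, of 0 "2*pi"] by simp
  finally show ?thesis .
qed

lemma periodic2pi_integral_shift:
  assumes g: "continuous_on UNIV g" "periodic2pi g"
  shows "integral {0..2*pi} (\<lambda>u. g (u + y)) = integral {0..2*pi} g"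
proof -
  have "integral {0..2*pi} (\<lambda>u. g (y + u)) = integral {0..2*pi} (\<lambda>u. g (y - (0 - u)))" by simp
  also have "\<dots> = integral {0..2*pi} (\<lambda>u. g (y - u))"
    using g periodic2pi_reflect[OF g(2), of y]
    by (intro periodic2pi_integral_reflect[of "\<lambda>u. g (y - u)" 0]) (auto intro!: continuous_on_compose2[OF g(1)] continuous_intros)
  also have "\<dots> = integral {0..2*pi} g" by (rule periodic2pi_integral_reflect[OF g])
  finally show ?thesis by (simp add: add.commute)
qed

lemma periodic2pi_bounded:
  assumes g: "continuous_on UNIV g" "periodic2pi g"
  obtains C where "C > 0" "\<And>x. \<bar>g x\<bar> \<le> C"
proof -
  have "compact (g ` {0..2*pi})" using g(1) by (intro compact_continuous_image) (auto intro: continuous_on_subset)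
  then obtain C where C: "C > 0" "\<And>y. y \<in> g ` {0..2*pi} \<Longrightarrow> norm y \<le> C"
    using compact_imp_bounded bounded_pos by metis
  have "\<bar>g x\<bar> \<le> C" for x
  proof -
    obtain k :: int where "0 \<le> x + 2 * pi * of_int k" "x + 2 * pi * of_int k < 0 + 2 * pi" by (rule reduce_mod_2pi)
    then have "x + 2 * pi * of_int k \<in> {0..2*pi}" by auto
    from C(2)[OF imageI[OF this]] show ?thesis using periodic2pi_of_int[OF g(2)] by simp
  qed
  then show ?thesis using that C(1) by blast
qed

lemma periodic2pi_deriv:
  assumes "periodic2pi G" "\<And>x. (G has_real_derivative g x) (at x)"
  shows "periodic2pi g"
  unfolding periodic2pi_def
proof
  fix x
  have "((\<lambda>x. G (x + 2 * pi)) has_real_derivative g (x + 2 * pi)) (at x)"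
    by (rule DERIV_translate[OF assms(2)])
  moreover have "(\<lambda>x. G (x + 2 * pi)) = G" using periodic2piD[OF assms(1)] by auto
  ultimately show "g (x + 2 * pi) = g x" using assms(2) DERIV_unique by metis
qed

lemma periodic2pi_integral_deriv:
  assumes "periodic2pi G" "\<And>x. (G has_real_derivative g x) (at x)"
  shows "integral {0..2*pi} g = 0"
  using integral_antiderivative[OF assms(2), of 0 "2 * pi"] periodic2piD[OF assms(1), of 0] by simp

lemma periodic2pi_by_parts:
  assumes u: "periodic2pi u" "\<And>x. (u has_real_derivative u' x) (at x)" "continuous_on UNIV u'"
    and v: "periodic2pi v" "\<And>x. (v has_real_derivative v' x) (at x)" "continuous_on UNIV v'"
  shows "integral {0..2*pi} (\<lambda>t. u t * v' t) = - integral {0..2*pi} (\<lambda>t. u' t * v t)"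
proof -
  have c: "continuous_on S u" "continuous_on S v" "continuous_on S u'" "continuous_on S v'" for S
    using DERIV_imp_continuous_on[OF u(2)] DERIV_imp_continuous_on[OF v(2)] u(3) v(3) continuous_on_subset by blast+
  have "((\<lambda>t. u t * v t) has_real_derivative u t * v' t + u' t * v t) (at t)" for t
    by (rule derivative_eq_intros u v refl)+ simp
  then have "integral {0..2*pi} (\<lambda>t. u t * v' t + u' t * v t) = 0"
    using u(1) v(1) by (intro periodic2pi_integral_deriv[of "\<lambda>t. u t * v t"]) (auto simp: periodic2pi_def)
  also have "integral {0..2*pi} (\<lambda>t. u t * v' t + u' t * v t) =
     integral {0..2*pi} (\<lambda>t. u t * v' t) + integral {0..2*pi} (\<lambda>t. u' t * v t)"
    by (intro integral_add integrable_continuous_real continuous_intros c)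
  finally show ?thesis by simp
qed

definition mean_free :: "(real \<Rightarrow> real) \<Rightarrow> bool" where
  "mean_free g \<longleftrightarrow> continuous_on UNIV g \<and> periodic2pi g \<and> integral {0..2*pi} g = 0"

text \<open>For mean-free \<open>g\<close> the conditions single out one primitive; normalising it
  to mean zero again is what allows \<open>prim\<close> to be iterated.\<close>

definition prim :: "(real \<Rightarrow> real) \<Rightarrow> real \<Rightarrow> real" where
  "prim g = (SOME G. mean_free G \<and> (\<forall>x. (G has_real_derivative g x) (at x)))"

lemma mean_free_subtract_mean:
  assumes "continuous_on UNIV g" "periodic2pi g"
  shows "mean_free (\<lambda>x. g x - integral {0..2*pi} g / (2 * pi))"
proof -
  have "integral {0..2*pi} (\<lambda>x. g x - integral {0..2*pi} g / (2 * pi)) =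
    integral {0..2*pi} g - integral {0..2*pi} (\<lambda>x. integral {0..2*pi} g / (2 * pi))"
    using continuous_on_subset[OF assms(1)]
    by (intro integral_diff integrable_continuous_real continuous_intros) auto
  then show ?thesis using assms by (simp add: mean_free_def periodic2pi_def continuous_on_diff)
qed

lemma prim:
  assumes "mean_free g"
  shows mean_free_prim: "mean_free (prim g)"
    and prim_has_derivative: "(prim g has_real_derivative g x) (at x)"
proof -
  have g: "continuous_on UNIV g" "periodic2pi g" "integral {0..2*pi} g = 0"
    using assms by (auto simp: mean_free_def)
  obtain G where G: "\<And>x. (G has_real_derivative g x) (at x)" using continuous_antiderivative[OF g(1)] by metis
  have "((\<lambda>x. G (x + 2 * pi) - G x) has_real_derivative 0) (at x)" for x
    using DERIV_diff[OF DERIV_translate[OF G, where y="2*pi"] G[of x]] periodic2piD[OF g(2), of x] by simp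
  from constant_if_deriv_zero[OF this, of _ 0]
  have "periodic2pi G"
    using integral_antiderivative[OF G, of 0 "2*pi"] g(3) by (auto simp: periodic2pi_def)
  moreover have "continuous_on UNIV G"
    by (rule DERIV_imp_continuous_on[OF G])
  ultimately have "mean_free (\<lambda>x. G x - integral {0..2*pi} G / (2 * pi))"
    by (intro mean_free_subtract_mean)
  moreover have "((\<lambda>x. G x - integral {0..2*pi} G / (2 * pi)) has_real_derivative g x) (at x)" for x
    using G by (auto intro!: derivative_eq_intros)
  ultimately have "\<exists>G. mean_free G \<and> (\<forall>x. (G has_real_derivative g x) (at x))" by blast
  then have "mean_free (prim g) \<and> (\<forall>x. (prim g has_real_derivative g x) (at x))"
    unfolding prim_def by (rule someI_ex)
  then show "mean_free (prim g)" "(prim g has_real_derivative g x) (at x)" by auto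
qed

lemma mean_free_prim_funpow: "mean_free g \<Longrightarrow> mean_free ((prim ^^ j) g)"
  by (induction j) (auto intro: mean_free_prim)

lemma prim_funpow_has_derivative:
  "mean_free g \<Longrightarrow> ((prim ^^ Suc j) g has_real_derivative (prim ^^ j) g x) (at x)"
  using prim_has_derivative[OF mean_free_prim_funpow] by simp

text \<open>\<open>Qk\<close> is a parabola on each period, whose derivative jumps by \<open>1\<close> at the multiples of \<open>2\<pi>\<close>;
  \<open>arccos (cos t)\<close> is the distance from \<open>t\<close> to the nearest such multiple.\<close>

definition Qk :: "real \<Rightarrow> real" where
  "Qk t = arccos (cos t) * (2 * pi - arccos (cos t)) / (4 * pi)"

lemma Qk_eq:
  assumes "0 \<le> t" "t \<le> 2 * pi"
  shows "Qk t = t * (2 * pi - t) / (4 * pi)"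
proof (cases "t \<le> pi")
  case True
  then show ?thesis using assms by (simp add: Qk_def arccos_cos)
next
  case False
  then have "arccos (cos t) = 2 * pi - t"
    using assms arccos_cos[of "2 * pi - t"] by simp
  then show ?thesis by (simp add: Qk_def mult.commute)
qed

lemma periodic2pi_Qk: "periodic2pi Qk"
  by (simp add: periodic2pi_def Qk_def)

lemma continuous_Qk: "continuous_on UNIV Qk"
  unfolding Qk_def by (intro continuous_intros continuous_on_arccos) auto

text \<open>Up to the factor -pi this is the periodic Bernoulli polynomial of degree 2. Its second
  derivative is the Dirac comb on the multiples of 2 pi minus its mean, so it is the limit of the
  second primitives of \<open>beta0 n\<close>.\<close>

definition Q0 :: "real \<Rightarrow> real" where
  "Q0 t = Qk t - integral {0..2*pi} Qk / (2 * pi)"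

lemma mean_free_Q0: "mean_free Q0"
  unfolding Q0_def[abs_def] by (intro mean_free_subtract_mean continuous_Qk periodic2pi_Qk)

section \<open>The smoothing kernel\<close>

definition dlvp_norm :: "nat \<Rightarrow> real" where
  "dlvp_norm n = integral {0..2*pi} (\<lambda>t. cos (t/2) ^ (2*n))"

text \<open>The de la Vallee-Poussin kernel: an approximate identity whose translates have linear combinations with
  few cyclic sign changes.\<close>

definition dlvp :: "nat \<Rightarrow> real \<Rightarrow> real" where
  "dlvp n t = cos (t/2) ^ (2*n) / dlvp_norm n"

lemma cos_half_period: "cos ((t + 2 * pi) / 2) = - cos (t / 2)"
  by (simp add: add_divide_distrib)

lemma dlvp_norm_pos: "dlvp_norm n > 0"
proof -
  have "integral {0..2*pi} (\<lambda>t. cos (t/2) ^ (2*n)) \<noteq> 0"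
  proof
    assume "integral {0..2*pi} (\<lambda>t. cos (t/2) ^ (2*n)) = 0"
    then have "\<forall>t\<in>{0..2*pi}. cos (t/2) ^ (2*n) = 0"
      by (subst (asm) integral_eq_0_iff) (auto intro!: continuous_intros simp: power_mult)
    from bspec[OF this, of 0] show False by simp
  qed
  moreover have "integral {0..2*pi} (\<lambda>t. cos (t/2) ^ (2*n)) \<ge> 0"
    by (intro integral_nonneg integrable_continuous_real continuous_intros) (auto simp: power_mult)
  ultimately show ?thesis by (simp add: dlvp_norm_def)
qed

lemma dlvp_nonneg: "dlvp n t \<ge> 0"
  using dlvp_norm_pos[of n] by (simp add: dlvp_def power_mult)

lemma continuous_dlvp [continuous_intros]:
  fixes S :: "'a::t2_space set"
  shows "continuous_on S f \<Longrightarrow> continuous_on S (\<lambda>x. dlvp n (f x))"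
  unfolding dlvp_def using dlvp_norm_pos[of n] by (auto intro!: continuous_intros)

lemma periodic2pi_dlvp: "periodic2pi (dlvp n)"
  by (simp only: periodic2pi_def dlvp_def cos_half_period power_mult power2_minus) simp

lemma integral_dlvp: "integral {0..2*pi} (dlvp n) = 1"
  unfolding dlvp_def[abs_def] Henstock_Kurzweil_Integration.integral_divide dlvp_norm_def[symmetric]
  using dlvp_norm_pos[of n] by simp

text \<open>Integrating the derivative of \<open>sin (t/2) * cos (t/2) ^ (2*n + 1)\<close> over a
  period relates this moment to the next normalising constant, which is not larger. So the kernel
  concentrates at the multiples of 2 pi, with no need to evaluate any constant.\<close>

lemma integral_dlvp_sin: "integral {0..2*pi} (\<lambda>t. dlvp n t * sin (t/2) ^ 2) \<le> 1 / real (2*n + 1)"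
proof -
  define I where "I = integral {0..2*pi} (\<lambda>t. cos (t/2) ^ (2*n) * sin (t/2) ^ 2)"
  define f where "f t = cos (t/2) ^ (2*n + 2) / 2 - real (2*n + 1) / 2 * (cos (t/2) ^ (2*n) * sin (t/2) ^ 2)" for t :: real
  have int: "g integrable_on {0..2*pi}" if "continuous_on {0..2*pi} g" for g :: "real \<Rightarrow> real"
    using that by (rule integrable_continuous_real)
  have "((\<lambda>t. sin (t/2) * cos (t/2) ^ (2*n + 1)) has_real_derivative f t) (at t)" for t
  proof -
    have s: "((\<lambda>t. sin (t/2)) has_real_derivative cos (t/2) / 2) (at t)"
      and c: "((\<lambda>t. cos (t/2)) has_real_derivative - sin (t/2) / 2) (at t)"
      by (auto intro!: derivative_eq_intros)
    show ?thesis
      by (rule DERIV_cong[OF DERIV_mult[OF s DERIV_power[OF c, of "2*n+1"]]])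
        (simp add: f_def power2_eq_square algebra_simps)
  qed
  then have "integral {0..2*pi} f = 0"
    using integral_antiderivative[of "\<lambda>t. sin (t/2) * cos (t/2) ^ (2*n + 1)" f 0 "2*pi"] by simp
  also have "integral {0..2*pi} f = dlvp_norm (Suc n) / 2 - real (2*n + 1) / 2 * I"
    unfolding f_def I_def dlvp_norm_def
    by (subst integral_diff) (auto intro!: int continuous_intros)
  finally have 1: "real (2*n + 1) * I = dlvp_norm (Suc n)" by simp
  have "dlvp_norm (Suc n) \<le> dlvp_norm n" unfolding dlvp_norm_def
  proof (intro integral_le int continuous_intros)
    fix t :: real
    have "cos (t/2) ^ 2 \<le> 1" by (simp add: abs_square_le_1)
    then have "cos (t/2) ^ (2*n) * cos (t/2) ^ 2 \<le> cos (t/2) ^ (2*n) * 1"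
      by (intro mult_left_mono) (auto simp: power_mult)
    then show "cos (t/2) ^ (2 * Suc n) \<le> cos (t/2) ^ (2*n)" by (simp add: power_add power2_eq_square mult_ac)
  qed auto
  then have "real (2*n + 1) * (I / dlvp_norm n) \<le> 1" using 1 dlvp_norm_pos[of n] by simp
  moreover have "integral {0..2*pi} (\<lambda>t. dlvp n t * sin (t/2) ^ 2) = I / dlvp_norm n"
  proof -
    have "(\<lambda>t. dlvp n t * sin (t/2) ^ 2) = (\<lambda>t. cos (t/2) ^ (2*n) * sin (t/2) ^ 2 / dlvp_norm n)"
      by (simp add: dlvp_def)
    then show ?thesis unfolding I_def by (simp only: Henstock_Kurzweil_Integration.integral_divide)
  qed
  ultimately show ?thesis by (simp add: field_simps)
qed

definition smooth :: "nat \<Rightarrow> (real \<Rightarrow> real) \<Rightarrow> real \<Rightarrow> real" where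
  "smooth n f y = integral {0..2*pi} (\<lambda>u. dlvp n u * f (y - u))"

lemma smooth_alt:
  assumes "continuous_on UNIV f" "periodic2pi f"
  shows "smooth n f y = integral {0..2*pi} (\<lambda>t. dlvp n (y - t) * f t)"
proof -
  have "integral {0..2*pi} (\<lambda>u. (\<lambda>t. dlvp n (y - t) * f t) (y - u)) = integral {0..2*pi} (\<lambda>t. dlvp n (y - t) * f t)"
  proof (rule periodic2pi_integral_reflect)
    show "continuous_on UNIV (\<lambda>t. dlvp n (y - t) * f t)" using assms by (intro continuous_intros)
    show "periodic2pi (\<lambda>t. dlvp n (y - t) * f t)"
      using periodic2pi_reflect[OF periodic2pi_dlvp, of n y] assms by (auto simp: periodic2pi_def)
  qed
  then show ?thesis by (simp add: smooth_def)
qed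

lemma smooth_has_derivative:
  assumes f: "\<And>x. (f has_real_derivative f' x) (at x)" "continuous_on UNIV f'"
  shows "(smooth n f has_real_derivative smooth n f' y) (at y)"
proof -
  have cf: "continuous_on UNIV f"
    by (rule DERIV_imp_continuous_on[OF f(1)])
  have "((\<lambda>y. integral (cbox 0 (2*pi)) (\<lambda>u. dlvp n u * f (y - u))) has_field_derivative
      integral (cbox 0 (2*pi)) (\<lambda>u. dlvp n u * f' (y - u))) (at y within UNIV)"
  proof (rule leibniz_rule_field_derivative)
    show "((\<lambda>x. dlvp n t * f (x - t)) has_real_derivative dlvp n t * f' (x - t)) (at x)" for x t
      using DERIV_cmult[OF DERIV_translate[OF f(1), of "- t" x]] by simp
    show "(\<lambda>u. dlvp n u * f (x - u)) integrable_on cbox 0 (2 * pi)" for x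
      by (intro integrable_continuous continuous_intros continuous_on_compose2[OF cf]) auto
    show "continuous_on (UNIV \<times> cbox 0 (2 * pi)) (\<lambda>(x, t). dlvp n t * f' (x - t))"
      unfolding split_def by (intro continuous_intros continuous_on_compose2[OF f(2)]) auto
  qed auto
  then show ?thesis unfolding smooth_def[abs_def] by simp
qed

text \<open>Stated for moving points and moving degrees because the knots and the zeros supplied by
  Rolle depend on \<open>n\<close>. The estimate is of Chebyshev type: away from 0 and 2 pi the mass
  of the kernel is controlled by its integral against \<open>sin (u/2) ^ 2\<close>.\<close>

lemma smooth_LIMSEQ:
  assumes h: "continuous_on UNIV h" "periodic2pi h" and y: "y \<longlonglongrightarrow> L"
    and \<sigma>: "filterlim \<sigma> at_top sequentially"
  shows "(\<lambda>n. smooth (\<sigma> n) h (y n)) \<longlonglongrightarrow> h L"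
proof (rule LIMSEQ_I)
  fix e :: real assume e: "e > 0"
  obtain C where C: "C > 0" "\<And>x. \<bar>h x\<bar> \<le> C" using periodic2pi_bounded[OF h] by metis
  have "isCont h L" using h(1) by (simp add: continuous_on_eq_continuous_at)
  then obtain \<delta>0 where \<delta>0: "\<delta>0 > 0" "\<And>x. \<bar>x - L\<bar> < \<delta>0 \<Longrightarrow> \<bar>h x - h L\<bar> < e/2"
    using e unfolding continuous_at_eps_delta dist_real_def by (metis half_gt_zero)
  define \<delta> where "\<delta> = min \<delta>0 1"
  have \<delta>: "\<delta> > 0" "\<delta> \<le> 1" "\<And>x. \<bar>x - L\<bar> < \<delta> \<Longrightarrow> \<bar>h x - h L\<bar> < e/2" using \<delta>0 by (auto simp: \<delta>_def)
  \<comment> \<open>The least value of \<open>sin (u/2)\<close> for \<open>u\<close> at distance at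
    least \<open>\<delta>/2\<close> from both ends of the period.\<close>
  define s where "s = sin (\<delta>/4)"
  have s: "s > 0" unfolding s_def using \<delta> pi_gt3 by (intro sin_gt_zero) auto
  have pt: "\<bar>h (z - u) - h L\<bar> \<le> e/2 + 2 * C / s^2 * sin (u/2) ^ 2"
    if u: "u \<in> {0..2*pi}" and z: "\<bar>z - L\<bar> < \<delta>/2" for u z
  proof -
    consider "u < \<delta>/2" | "u > 2 * pi - \<delta>/2" | "\<delta>/2 \<le> u" "u \<le> 2 * pi - \<delta>/2" by linarith
    then show ?thesis
    proof cases
      case 1
      then have "\<bar>z - u - L\<bar> < \<delta>" using u z unfolding abs_less_iff by auto
      then show ?thesis using \<delta>(3)[of "z - u"] C by (simp add: add_increasing2)
    next
      case 2
      then have "\<bar>z - u + 2 * pi - L\<bar> < \<delta>" using u z unfolding abs_less_iff by auto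
      then show ?thesis using \<delta>(3)[of "z - u + 2 * pi"] periodic2piD[OF h(2)] C by (simp add: add_increasing2)
    next
      case 3
      have "sin (\<delta>/4) \<le> sin (u/2)"
      proof (cases "u/2 \<le> pi/2")
        case True
        then show ?thesis using 3 \<delta> pi_gt_zero by (intro sin_monotone_2pi_le) auto
      next
        case False
        have "sin (\<delta>/4) \<le> sin (pi - u/2)" using False 3 u \<delta> pi_gt_zero by (intro sin_monotone_2pi_le) auto
        then show ?thesis by simp
      qed
      then have "s^2 \<le> sin (u/2) ^ 2" using s by (intro power_mono) (auto simp: s_def)
      then have "2 * C * 1 \<le> 2 * C * (sin (u/2) ^ 2 / s^2)" using C(1) s by (intro mult_left_mono) auto
      moreover have "\<bar>h (z - u) - h L\<bar> \<le> 2 * C" using C(2)[of "z - u"] C(2)[of L] by linarith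
      ultimately show ?thesis using e by simp
    qed
  qed
  have bound: "\<bar>smooth n h z - h L\<bar> \<le> e/2 + 2 * C / s^2 * (1 / real (2*n + 1))" if z: "\<bar>z - L\<bar> < \<delta>/2" for n z
  proof -
    have ci: "continuous_on {0..2*pi} (\<lambda>u. h (z - u))" by (intro continuous_on_compose2[OF h(1)] continuous_intros) auto
    have "smooth n h z - h L = integral {0..2*pi} (\<lambda>u. dlvp n u * h (z - u)) - integral {0..2*pi} (\<lambda>u. dlvp n u * h L)"
      using integral_dlvp[of n] by (simp add: smooth_def)
    also have "\<dots> = integral {0..2*pi} (\<lambda>u. dlvp n u * h (z - u) - dlvp n u * h L)"
      using ci by (intro integral_diff[symmetric] integrable_continuous_real continuous_intros)
    also have "\<bar>\<dots>\<bar> \<le> integral {0..2*pi} (\<lambda>u. e/2 * dlvp n u + 2 * C / s^2 * (dlvp n u * sin (u/2) ^ 2))"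
      unfolding real_norm_def[symmetric]
    proof (rule integral_norm_bound_integral)
      fix u assume u: "u \<in> {0..2*pi}"
      have "dlvp n u * \<bar>h (z - u) - h L\<bar> \<le> dlvp n u * (e/2 + 2 * C / s^2 * sin (u/2) ^ 2)"
        using pt[OF u z] dlvp_nonneg by (intro mult_left_mono)
      moreover have "\<bar>dlvp n u * h (z - u) - dlvp n u * h L\<bar> = dlvp n u * \<bar>h (z - u) - h L\<bar>"
        using dlvp_nonneg[of n u] by (simp add: abs_mult flip: right_diff_distrib)
      ultimately show "norm (dlvp n u * h (z - u) - dlvp n u * h L) \<le> e/2 * dlvp n u + 2 * C / s^2 * (dlvp n u * sin (u/2) ^ 2)"
        using dlvp_nonneg[of n u] by (simp add: algebra_simps)
    qed (intro integrable_continuous_real continuous_intros ci, use s in auto)+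
    also have "\<dots> = e/2 * integral {0..2*pi} (dlvp n) + 2 * C / s^2 * integral {0..2*pi} (\<lambda>u. dlvp n u * sin (u/2) ^ 2)"
      using s by (subst integral_add) (auto intro!: integrable_continuous_real continuous_intros)
    also have "\<dots> \<le> e/2 + 2 * C / s^2 * (1 / real (2*n + 1))"
      using mult_left_mono[OF integral_dlvp_sin[of n], of "2 * C / s^2"] C(1) integral_dlvp[of n] by simp
    finally show ?thesis .
  qed
  have "(\<lambda>n. 2 * C / s^2 * (1 / real (2*n + 1))) \<longlonglongrightarrow> 0" by real_asymp
  from filterlim_compose[OF this \<sigma>]
  have "eventually (\<lambda>n. 2 * C / s^2 * (1 / real (2 * \<sigma> n + 1)) < e/2) sequentially"
    using e by (intro order_tendstoD(2)) auto
  moreover have "eventually (\<lambda>n. \<bar>y n - L\<bar> < \<delta>/2) sequentially"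
    using tendstoD[OF y, of "\<delta>/2"] \<delta>(1) by (simp add: dist_real_def)
  ultimately have "eventually (\<lambda>n. norm (smooth (\<sigma> n) h (y n) - h L) < e) sequentially"
  proof eventually_elim
    case (elim n)
    then show ?case using bound[of "y n" "\<sigma> n"] by simp
  qed
  then show "\<exists>no. \<forall>n\<ge>no. norm (smooth (\<sigma> n) h (y n) - h L) < e" by (simp add: eventually_sequentially)
qed

section \<open>Representing smoothed functions by primitives of the kernel\<close>

definition beta0 :: "nat \<Rightarrow> real \<Rightarrow> real" where
  "beta0 n t = dlvp n t - 1 / (2 * pi)"

lemma mean_free_beta0: "mean_free (beta0 n)"
  using mean_free_subtract_mean[of "dlvp n"] periodic2pi_dlvp[of n] integral_dlvp[of n]
  by (simp add: beta0_def[abs_def] continuous_intros)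

lemma smooth_mean_free:
  assumes "mean_free f"
  shows "smooth n f y = integral {0..2*pi} (\<lambda>t. beta0 n (y - t) * f t)"
proof -
  have f: "continuous_on UNIV f" "periodic2pi f" "integral {0..2*pi} f = 0" using assms by (auto simp: mean_free_def)
  have "continuous_on {0..2*pi} f" using f(1) continuous_on_subset by blast
  then have "integral {0..2*pi} (\<lambda>t. beta0 n (y - t) * f t) =
     integral {0..2*pi} (\<lambda>t. dlvp n (y - t) * f t) - integral {0..2*pi} (\<lambda>t. 1 / (2 * pi) * f t)"
    unfolding beta0_def left_diff_distrib
    by (intro integral_diff integrable_continuous_real continuous_intros) auto
  then show ?thesis using smooth_alt[OF f(1,2), of n y] f(3) by simp
qed

text \<open>Two integrations by parts over \<open>{0..2*pi}\<close> against the parabola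
  \<open>q\<close>: \<open>q\<close> vanishes at both ends, its slopes 1/2 and -1/2 there produce
  the value at \<open>y\<close>, and its constant second derivative meets a function of mean
  zero.\<close>

lemma smooth_Q0: "smooth n Q0 y = (prim ^^ 2) (beta0 n) y"
proof -
  let ?b = "\<lambda>j. (prim ^^ j) (beta0 n)"
  have mf: "mean_free (?b j)" for j using mean_free_prim_funpow mean_free_beta0 by blast
  have d1: "(?b 1 has_real_derivative beta0 n x) (at x)" for x
    using prim_funpow_has_derivative[OF mean_free_beta0, where j=0] by simp
  have d2: "(?b 2 has_real_derivative ?b 1 x) (at x)" for x
    using prim_funpow_has_derivative[OF mean_free_beta0, where j=1] by (simp add: numeral_2_eq_2)
  have cont: "continuous_on S (\<lambda>t. ?b j (y - t))" for S j
    using mf[of j] by (auto simp: mean_free_def intro!: continuous_intros elim!: continuous_on_compose2)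
  have cont0: "continuous_on S (\<lambda>t. beta0 n (y - t))" for S
    using cont[of S 0] by simp
  have zero: "integral {0..2*pi} (\<lambda>t. ?b j (y - t)) = 0" for j
    using mf[of j] periodic2pi_integral_reflect[of "?b j" y] by (simp add: mean_free_def)
  have zero0: "integral {0..2*pi} (\<lambda>t. beta0 n (y - t)) = 0" using zero[of 0] by simp
  define q where "q t = t * (2 * pi - t) / (4 * pi)" for t :: real
  define F where "F t = - ?b 1 (y - t) * q t - ?b 2 (y - t) * (1/2 - t / (2 * pi))" for t
  define f where "f t = beta0 n (y - t) * q t + 1 / (2*pi) * ?b 2 (y - t)" for t
  have "(F has_real_derivative f t) (at t)" for t
  proof -
    have q: "(q has_real_derivative 1/2 - t / (2*pi)) (at t)" 
      unfolding q_def by (auto intro!: derivative_eq_intros simp: field_simps)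
    have l: "((\<lambda>t. 1/2 - t / (2*pi)) has_real_derivative - (1 / (2*pi))) (at t)" 
      by (auto intro!: derivative_eq_intros)
    show ?thesis unfolding F_def
      by (rule DERIV_cong[OF DERIV_diff[OF DERIV_mult[OF DERIV_minus[OF DERIV_reflect[OF d1]] q]
            DERIV_mult[OF DERIV_reflect[OF d2] l]]])
        (simp add: f_def algebra_simps)
  qed
  then have "integral {0..2*pi} f = F (2*pi) - F 0" by (intro integral_antiderivative) auto
  also have "\<dots> = ?b 2 y"
    using mf[of 2] periodic2pi_minus[of "?b 2" y] by (simp add: F_def q_def mean_free_def)
  finally have 1: "integral {0..2*pi} f = ?b 2 y" .
  have "integral {0..2*pi} f = integral {0..2*pi} (\<lambda>t. beta0 n (y - t) * q t) + integral {0..2*pi} (\<lambda>t. 1 / (2*pi) * ?b 2 (y - t))"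
    unfolding f_def q_def by (intro integral_add integrable_continuous_real continuous_intros cont cont0) auto
  then have 2: "integral {0..2*pi} (\<lambda>t. beta0 n (y - t) * q t) = ?b 2 y" using 1 zero[of 2] by simp
  define c0 where "c0 = integral {0..2*pi} Qk / (2 * pi)"
  have "smooth n Q0 y = integral {0..2*pi} (\<lambda>t. beta0 n (y - t) * q t - beta0 n (y - t) * c0)"
    unfolding smooth_mean_free[OF mean_free_Q0]
    by (intro integral_cong) (auto simp: Q0_def Qk_eq q_def c0_def right_diff_distrib)
  also have "\<dots> = integral {0..2*pi} (\<lambda>t. beta0 n (y - t) * q t) - integral {0..2*pi} (\<lambda>t. beta0 n (y - t) * c0)"
    unfolding q_def by (intro integral_diff integrable_continuous_real continuous_intros cont0) auto
  finally show ?thesis using 2 zero0 by simp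
qed

text \<open>The two sides are actually equal, but a constant is harmless below.\<close>

lemma smooth_prim_Q0: "\<exists>c. \<forall>y. smooth n ((prim ^^ j) Q0) y = (prim ^^ (j + 2)) (beta0 n) y + c"
proof (induction j)
  case 0
  show ?case using smooth_Q0 by (intro exI[of _ 0]) (simp add: numeral_2_eq_2)
next
  case (Suc j)
  then obtain c where c: "\<And>y. smooth n ((prim ^^ j) Q0) y = (prim ^^ (j + 2)) (beta0 n) y + c" by blast
  let ?Q = "\<lambda>j. (prim ^^ j) Q0" and ?b = "\<lambda>j. (prim ^^ j) (beta0 n)"
  have mfQ: "mean_free (?Q j)" for j using mean_free_prim_funpow mean_free_Q0 by blast
  have mfb: "mean_free (?b j)" for j using mean_free_prim_funpow mean_free_beta0 by blast
  have cQ: "continuous_on UNIV (?Q j)" for j using mfQ by (auto simp: mean_free_def)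
  have ds: "(smooth n (?Q (Suc j)) has_real_derivative ?b (j + 2) x + c) (at x)" for x
    using smooth_has_derivative[OF prim_funpow_has_derivative[OF mean_free_Q0] cQ, of n j x] c by simp
  have db: "(?b (Suc j + 2) has_real_derivative ?b (j + 2) x) (at x)" for x
    using prim_funpow_has_derivative[where g="beta0 n" and j="j + 2" and x=x, OF mean_free_beta0] by simp
  have "periodic2pi (smooth n (?Q (Suc j)))"
    unfolding periodic2pi_def smooth_def
  proof
    fix x
    have "?Q (Suc j) (x + 2 * pi - u) = ?Q (Suc j) (x - u)" for u
      using mfQ[of "Suc j"] periodic2piD[of "?Q (Suc j)" "x - u"] by (simp add: mean_free_def algebra_simps)
    then show "integral {0..2*pi} (\<lambda>u. dlvp n u * ?Q (Suc j) (x + 2 * pi - u)) = integral {0..2*pi} (\<lambda>u. dlvp n u * ?Q (Suc j) (x - u))"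
      by simp
  qed
  then have "integral {0..2*pi} (\<lambda>x. ?b (j + 2) x + c) = 0" using ds by (rule periodic2pi_integral_deriv)
  moreover have "integral {0..2*pi} (\<lambda>x. ?b (j + 2) x + c) = integral {0..2*pi} (?b (j + 2)) + integral {0..2*pi} (\<lambda>x. c)"
    using mfb[of "j + 2"] unfolding mean_free_def
    by (intro integral_add integrable_continuous_real) (auto intro: continuous_on_subset)
  ultimately have "c = 0" using mfb[of "j + 2"] by (simp add: mean_free_def)
  then have "((\<lambda>y. smooth n (?Q (Suc j)) y - ?b (Suc j + 2) y) has_real_derivative 0) (at x)" for x
    using ds[of x] db[of x] by (auto intro!: derivative_eq_intros)
  from constant_if_deriv_zero[OF this, of _ 0]
  have "smooth n (?Q (Suc j)) y = ?b (Suc j + 2) y + (smooth n (?Q (Suc j)) 0 - ?b (Suc j + 2) 0)" for y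
    by (simp add: algebra_simps)
  then show ?case by blast
qed

text \<open>Each step differentiates the function and integrates the kernel, and periodicity leaves
  no boundary terms. The mean subtracted from the kernel reappears as the mean of
  \<open>fd 0\<close>.\<close>

lemma smooth_by_parts:
  assumes fd: "\<And>i x. i < j \<Longrightarrow> (fd i has_real_derivative fd (Suc i) x) (at x)"
    and c: "\<And>i. i \<le> j \<Longrightarrow> continuous_on UNIV (fd i)" and p: "periodic2pi (fd 0)"
  shows "smooth n (fd 0) y = integral {0..2*pi} (fd 0) / (2 * pi) + integral {0..2*pi} (\<lambda>t. fd j t * (prim ^^ j) (beta0 n) (y - t))"
proof -
  let ?b = "\<lambda>j. (prim ^^ j) (beta0 n)"
  have mfb: "mean_free (?b j)" for j using mean_free_prim_funpow mean_free_beta0 by blast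
  have db: "(?b (Suc i) has_real_derivative ?b i x) (at x)" for i x
    using prim_funpow_has_derivative[OF mean_free_beta0] .
  have per: "i \<le> j \<Longrightarrow> periodic2pi (fd i)" for i
  proof (induction i)
    case (Suc i)
    then show ?case using periodic2pi_deriv[of "fd i" "fd (Suc i)"] fd[of i] by simp
  qed (use p in simp)
  have "i \<le> j \<Longrightarrow> smooth n (fd 0) y = integral {0..2*pi} (fd 0) / (2 * pi) + integral {0..2*pi} (\<lambda>t. fd i t * ?b i (y - t))" for i
  proof (induction i)
    case 0
    have "continuous_on {0..2*pi} (fd 0)" using c[of 0] continuous_on_subset by blast
    then have "integral {0..2*pi} (\<lambda>t. fd 0 t * beta0 n (y - t)) =
       integral {0..2*pi} (\<lambda>t. dlvp n (y - t) * fd 0 t) - integral {0..2*pi} (\<lambda>t. 1 / (2*pi) * fd 0 t)"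
      unfolding beta0_def right_diff_distrib mult.commute[of "fd 0 _"]
      by (intro integral_diff integrable_continuous_real continuous_intros) auto
    then show ?case using smooth_alt[OF c[of 0] p, of n y] by simp
  next
    case (Suc i)
    have "integral {0..2*pi} (\<lambda>t. fd i t * ?b i (y - t)) = - integral {0..2*pi} (\<lambda>t. fd (Suc i) t * (- ?b (Suc i) (y - t)))"
    proof (rule periodic2pi_by_parts)
      show "periodic2pi (fd i)" using per[of i] Suc.prems by simp
      show "(fd i has_real_derivative fd (Suc i) x) (at x)" for x using fd[of i] Suc.prems by simp
      show "continuous_on UNIV (fd (Suc i))" using c Suc.prems by simp
      show "periodic2pi (\<lambda>t. - ?b (Suc i) (y - t))"
        using periodic2pi_reflect[of "?b (Suc i)" y] mfb[of "Suc i"] by (simp add: mean_free_def periodic2pi_def)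
      show "((\<lambda>t. - ?b (Suc i) (y - t)) has_real_derivative ?b i (y - x)) (at x)" for x
        using DERIV_minus[OF DERIV_reflect[of "?b (Suc i)" "?b i", OF db]] by simp
      show "continuous_on UNIV (\<lambda>t. ?b i (y - t))"
        using mfb[of i] by (auto simp: mean_free_def intro!: continuous_intros elim!: continuous_on_compose2)
    qed
    then show ?case using Suc by simp
  qed
  then show ?thesis by simp
qed

text \<open>This is the last integration by parts, for a \<open>g\<close> that is only Lipschitz:
  the difference quotient of \<open>w\<close> is shifted onto \<open>g\<close>, where it is bounded
  by \<open>M\<close>, and only then the limit is taken. No derivative of \<open>g\<close>
  appears.\<close>

lemma Lipschitz_integral_deriv_bound:
  assumes g: "continuous_on UNIV g" "periodic2pi g" "\<And>x y. \<bar>g y - g x\<bar> \<le> M * \<bar>y - x\<bar>"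
    and w: "periodic2pi w" "\<And>x. (w has_real_derivative w' x) (at x)" "continuous_on UNIV w'"
  shows "\<bar>integral {0..2*pi} (\<lambda>t. g t * w' t)\<bar> \<le> M * integral {0..2*pi} (\<lambda>t. \<bar>w t\<bar>)"
proof -
  have cw: "continuous_on UNIV w"
    by (rule DERIV_imp_continuous_on[OF w(2)])
  have cont: "continuous_on S g" "continuous_on S w" "continuous_on S (\<lambda>t. g (t + a))" "continuous_on S (\<lambda>t. w (t + a))" for S a
    by (auto intro!: continuous_on_compose2[OF g(1)] continuous_on_compose2[OF cw] continuous_intros
        intro: continuous_on_subset[OF g(1)] continuous_on_subset[OF cw])
  have "periodic2pi w'" using periodic2pi_deriv[OF w(1,2)] .
  then obtain D where D: "D > 0" "\<And>x. \<bar>w' x\<bar> \<le> D" using periodic2pi_bounded[OF w(3)] by blast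
  obtain C where C: "C > 0" "\<And>x. \<bar>g x\<bar> \<le> C" using periodic2pi_bounded[OF g(1,2)] by blast
  define h where "h k = 1 / (real k + 1)" for k :: nat
  have h: "h k > 0" for k by (simp add: h_def)
  define q where "q k t = g t * ((w (t + h k) - w t) / h k)" for k t
  have lim: "(\<lambda>k. integral {0..2*pi} (q k)) \<longlonglongrightarrow> integral {0..2*pi} (\<lambda>t. g t * w' t)"
  proof (rule dominated_convergence(2))
    show "q k integrable_on {0..2*pi}" for k
      unfolding q_def using h[of k] by (intro integrable_continuous_real continuous_intros cont) auto
    show "(\<lambda>_. C * D) integrable_on {0..2*pi}" by (rule integrable_const_ivl)
    show "norm (q k t) \<le> C * D" for k t
    proof -
      obtain z where "w (t + h k) - w t = (t + h k - t) * w' z"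
        using MVT2[of t "t + h k" w w'] w(2) h[of k] by auto
      then have "(w (t + h k) - w t) / h k = w' z" using h[of k] by simp
      then show ?thesis unfolding q_def using C D by (auto simp: abs_mult intro!: mult_mono)
    qed
    show "(\<lambda>k. q k t) \<longlonglongrightarrow> g t * w' t" for t
      unfolding q_def
    proof (intro tendsto_mult tendsto_const)
      have "((\<lambda>h. (w (t + h) - w t) / h) \<longlongrightarrow> w' t) (at 0)" using w(2)[of t] by (simp add: DERIV_def)
      moreover have "filterlim h (at 0) sequentially"
        unfolding filterlim_at using h unfolding h_def by (auto simp: less_imp_neq[symmetric]) real_asymp
      ultimately show "(\<lambda>k. (w (t + h k) - w t) / h k) \<longlonglongrightarrow> w' t"
        by (rule filterlim_compose)
    qed
  qed
  have bd: "\<bar>integral {0..2*pi} (q k)\<bar> \<le> M * integral {0..2*pi} (\<lambda>t. \<bar>w t\<bar>)" for k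
  proof -
    have "integral {0..2*pi} (\<lambda>t. (\<lambda>s. g (s - h k) * w s) (t + h k)) = integral {0..2*pi} (\<lambda>s. g (s - h k) * w s)"
    proof (rule periodic2pi_integral_shift)
      show "continuous_on UNIV (\<lambda>s. g (s - h k) * w s)" using cont(3)[of UNIV "- h k"] cw by (auto intro!: continuous_intros)
      show "periodic2pi (\<lambda>s. g (s - h k) * w s)"
        using periodic2pi_shift[OF g(2), of "- h k"] w(1) by (simp add: periodic2pi_def)
    qed
    then have sh: "integral {0..2*pi} (\<lambda>t. g t * w (t + h k)) = integral {0..2*pi} (\<lambda>s. g (s - h k) * w s)" by simp
    have "integral {0..2*pi} (q k) = integral {0..2*pi} (\<lambda>t. (g t * w (t + h k) - g t * w t) / h k)"
      unfolding q_def by (simp add: right_diff_distrib)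
    also have "\<dots> = (integral {0..2*pi} (\<lambda>t. g t * w (t + h k)) - integral {0..2*pi} (\<lambda>t. g t * w t)) / h k"
      unfolding divide_inverse integral_mult_left
      by (subst integral_diff) (auto intro!: integrable_continuous_real continuous_intros cont)
    also have "\<dots> = integral {0..2*pi} (\<lambda>t. (g (t - h k) * w t - g t * w t) / h k)"
      unfolding sh divide_inverse integral_mult_left
      by (subst integral_diff) (use cont(3)[of _ "- h k"] in \<open>auto intro!: integrable_continuous_real continuous_intros cont\<close>)
    finally have eq: "integral {0..2*pi} (q k) = integral {0..2*pi} (\<lambda>t. (g (t - h k) * w t - g t * w t) / h k)" .
    have "norm (integral {0..2*pi} (\<lambda>t. (g (t - h k) * w t - g t * w t) / h k)) \<le> integral {0..2*pi} (\<lambda>t. M * \<bar>w t\<bar>)"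
    proof (rule integral_norm_bound_integral)
      show "(\<lambda>t. (g (t - h k) * w t - g t * w t) / h k) integrable_on {0..2*pi}"
        using cont(3)[of _ "- h k"] h[of k] by (auto intro!: integrable_continuous_real continuous_intros cont)
      show "(\<lambda>t. M * \<bar>w t\<bar>) integrable_on {0..2*pi}"
        by (intro integrable_continuous_real continuous_intros cont)
      fix t
      have "\<bar>g (t - h k) - g t\<bar> \<le> M * h k" using g(3)[of "t - h k" t] h[of k] by simp
      then have "\<bar>g (t - h k) - g t\<bar> * \<bar>w t\<bar> \<le> M * h k * \<bar>w t\<bar>" by (rule mult_right_mono) simp
      moreover have "g (t - h k) * w t - g t * w t = (g (t - h k) - g t) * w t" by (simp add: algebra_simps)
      ultimately show "norm ((g (t - h k) * w t - g t * w t) / h k) \<le> M * \<bar>w t\<bar>"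
        using h[of k] by (simp add: abs_mult pos_divide_le_eq mult_ac)
    qed
    then show ?thesis using eq by simp
  qed
  show ?thesis
    using lim bd by (intro LIMSEQ_le_const2[OF tendsto_rabs]) auto
qed

section \<open>Cyclic sign changes\<close>

text \<open>Only the sign of \<open>e\<close> matters; leaving it free covers both starting signs.
  The points lie within less than one period, so for even \<open>N\<close> and periodic
  \<open>g\<close> the alternation closes up around the circle.\<close>

definition cyc_alt :: "nat \<Rightarrow> (real \<Rightarrow> real) \<Rightarrow> bool" where
  "cyc_alt N g \<longleftrightarrow> (\<exists>e::real. \<exists>s::nat \<Rightarrow> real. (\<forall>i<N. e * (-1) ^ i * g (s i) > 0) \<and>
     (\<forall>i. Suc i < N \<longrightarrow> s i < s (Suc i)) \<and> s (N - 1) < s 0 + 2 * pi)"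

lemma cyc_altI:
  assumes "\<And>i. i < N \<Longrightarrow> (e::real) * (-1) ^ i * g (s i) > 0" "\<And>i. Suc i < N \<Longrightarrow> s i < s (Suc i)" "s (N - 1) < s 0 + 2 * pi"
  shows "cyc_alt N g"
  using assms unfolding cyc_alt_def by blast

lemma cyc_altE:
  assumes "cyc_alt N g"
  obtains e :: real and s :: "nat \<Rightarrow> real" where
    "\<And>i. i < N \<Longrightarrow> e * (-1) ^ i * g (s i) > 0" "\<And>i. Suc i < N \<Longrightarrow> s i < s (Suc i)" "s (N - 1) < s 0 + 2 * pi"
  using assms unfolding cyc_alt_def by blast

lemma increment_sign:
  fixes e :: real
  assumes "e * (-1) ^ i * p > 0" "e * (-1) ^ Suc i * q > 0" "q - p = h * c" "h > 0"
  shows "- e * (-1) ^ i * c > 0"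
proof -
  have "- e * (-1) ^ i * (q - p) > 0" using assms(1,2) by (simp add: algebra_simps)
  then have "h * (- e * (-1) ^ i * c) > 0" by (simp add: assms(3) mult_ac)
  then show ?thesis using assms(4) zero_less_mult_pos by blast
qed

text \<open>Rolle on the circle: for even \<open>N\<close> the point \<open>s 0 + 2 * pi\<close>
  continues the alternation, so there are \<open>N\<close> gaps and nothing is lost.\<close>

lemma cyc_alt_deriv:
  assumes N: "even N" "N > 0" and g: "\<And>x. g (x + 2 * pi) = g x" "\<And>x. (g has_real_derivative g' x) (at x)"
    and ca: "cyc_alt N g"
  shows "cyc_alt N g'"
proof -
  obtain e s where s: "\<And>i. i < N \<Longrightarrow> e * (-1) ^ i * g (s i) > 0" "\<And>i. Suc i < N \<Longrightarrow> s i < s (Suc i)" "s (N - 1) < s 0 + 2 * pi"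
    using cyc_altE[OF ca] by metis
  define s' where "s' i = (if i < N then s i else s 0 + 2 * pi)" for i
  have inc: "s' i < s' (Suc i)" if "i < N" for i
  proof (cases "Suc i < N")
    case False
    then have "i = N - 1" using that by simp
    then show ?thesis using s(3) that by (simp add: s'_def)
  qed (use s(2) in \<open>auto simp: s'_def\<close>)
  have sg: "e * (-1) ^ i * g (s' i) > 0" if "i \<le> N" for i
  proof (cases "i < N")
    case False
    then have "i = N" using that by simp
    then show ?thesis using s(1)[of 0] N g(1) by (simp add: s'_def)
  qed (use s(1) in \<open>auto simp: s'_def\<close>)
  have "\<exists>z. s' i < z \<and> z < s' (Suc i) \<and> - e * (-1) ^ i * g' z > 0" if i: "i < N" for i
  proof -
    obtain z where z: "s' i < z" "z < s' (Suc i)" "g (s' (Suc i)) - g (s' i) = (s' (Suc i) - s' i) * g' z"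
      using MVT2[OF inc[OF i], of g g'] g(2) by auto
    have "- e * (-1) ^ i * g' z > 0"
      by (rule increment_sign[OF sg[of i] sg[of "Suc i"] z(3)]) (use i inc in auto)
    then show ?thesis using z by blast
  qed
  then obtain z where z: "\<And>i. i < N \<Longrightarrow> s' i < z i" "\<And>i. i < N \<Longrightarrow> z i < s' (Suc i)" "\<And>i. i < N \<Longrightarrow> - e * (-1) ^ i * g' (z i) > 0"
    by metis
  show ?thesis
  proof (rule cyc_altI)
    show "- e * (-1) ^ i * g' (z i) > 0" if "i < N" for i using z(3) that .
    show "z i < z (Suc i)" if "Suc i < N" for i using z(2)[of i] z(1)[of "Suc i"] that by simp
    have "z (N - 1) < s 0 + 2 * pi" using z(2)[of "N - 1"] N by (simp add: s'_def)
    also have "s 0 < z 0" using z(1)[of 0] N by (simp add: s'_def)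
    finally show "z (N - 1) < z 0 + 2 * pi" by simp
  qed
qed

lemma quasi_periodic_int:
  fixes g :: "real \<Rightarrow> real"
  assumes "\<And>x. g (x + 2 * pi) = c * g x" "c = 1 \<or> c = -1"
  obtains \<sigma> where "\<sigma> = 1 \<or> \<sigma> = (-1::real)" "\<And>x. g (x + 2 * pi * of_int k) = \<sigma> * g x"
proof -
  have nat: "\<exists>\<sigma>. (\<sigma> = 1 \<or> \<sigma> = (-1::real)) \<and> (\<forall>x. g (x + 2 * pi * real n) = \<sigma> * g x)" for n
  proof (induction n)
    case (Suc n)
    then obtain \<sigma> where \<sigma>: "\<sigma> = 1 \<or> \<sigma> = -1" "\<And>x. g (x + 2 * pi * real n) = \<sigma> * g x" by blast
    have "g (x + 2 * pi * real (Suc n)) = (c * \<sigma>) * g x" for x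
      using assms(1)[of "x + 2 * pi * real n"] \<sigma>(2)[of x] by (simp add: algebra_simps)
    then show ?case using \<sigma>(1) assms(2) by (intro exI[of _ "c * \<sigma>"]) auto
  qed (auto intro: exI[of _ 1])
  show thesis
  proof (cases "k \<ge> 0")
    case True
    then show thesis using nat[of "nat k"] that by auto
  next
    case False
    obtain \<sigma> where \<sigma>: "\<sigma> = 1 \<or> \<sigma> = -1" "\<And>x. g (x + 2 * pi * real (nat (- k))) = \<sigma> * g x" using nat by blast
    have "g (x + 2 * pi * of_int k) = \<sigma> * g x" for x
      using \<sigma>(2)[of "x + 2 * pi * of_int k"] \<sigma>(1) False by auto
    then show thesis using that \<sigma>(1) by blast
  qed
qed

text \<open>Points beyond the window move back by a period and come first; the factor
  \<open>(-1) ^ N\<close> is exactly what keeps the signs alternating. The left end must be strict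
  because the window will end at zeros of the cosine by which \<open>kill_deriv\<close>
  divides.\<close>

lemma cyc_alt_rotate:
  assumes g: "continuous_on UNIV g" "\<And>x. g (x + 2 * pi) = (-1) ^ N * g x" and N: "N \<ge> 2"
    and ca: "cyc_alt N g"
  obtains e :: real and s :: "nat \<Rightarrow> real" where
    "\<And>i. i < N \<Longrightarrow> e * (-1) ^ i * g (s i) > 0" "\<And>i. Suc i < N \<Longrightarrow> s i < s (Suc i)" "b < s 0" "s (N - 1) < b + 2 * pi"
proof -
  obtain e0 s0 where s0: "\<And>i. i < N \<Longrightarrow> e0 * (-1) ^ i * g (s0 i) > 0" "\<And>i. Suc i < N \<Longrightarrow> s0 i < s0 (Suc i)" "s0 (N - 1) < s0 0 + 2 * pi"
    using cyc_altE[OF ca] by metis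
  define k where "k = - \<lfloor>(s0 0 - b) / (2 * pi)\<rfloor>"
  have "of_int (- k) \<le> (s0 0 - b) / (2 * pi)" "(s0 0 - b) / (2 * pi) < of_int (- k) + 1"
    unfolding k_def by linarith+
  then have k: "b \<le> s0 0 + 2 * pi * of_int k" "s0 0 + 2 * pi * of_int k < b + 2 * pi"
    using pi_gt_zero by (simp_all add: field_simps)
  obtain \<sigma> where \<sigma>: "\<sigma> = 1 \<or> \<sigma> = (-1::real)" "\<And>x. g (x + 2 * pi * of_int k) = \<sigma> * g x"
    using quasi_periodic_int[of g "(-1) ^ N" k] g(2) by (metis (no_types) neg_one_even_power neg_one_odd_power)
  define e1 where "e1 = e0 * \<sigma>"
  define t where "t i = s0 i + 2 * pi * of_int k" for i
  have t: "i < N \<Longrightarrow> e1 * (-1) ^ i * g (t i) > 0" "Suc i < N \<Longrightarrow> t i < t (Suc i)" "t (N - 1) < t 0 + 2 * pi"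
    "b \<le> t 0" "t 0 < b + 2 * pi" for i
    using s0 \<sigma> k unfolding t_def e1_def by (auto simp: mult_ac)
  define j where "j = (LEAST j. j = N \<or> t j \<ge> b + 2 * pi)"
  have j: "j = N \<or> t j \<ge> b + 2 * pi" "\<And>i. i < j \<Longrightarrow> i \<noteq> N \<and> t i < b + 2 * pi" "j \<le> N"
    unfolding j_def by (rule LeastI[of _ N], simp) (auto dest!: not_less_Least simp: not_le intro: Least_le)
  have j1: "j \<ge> 1" using j(1) t(5) N by (cases j) auto
  \<comment> \<open>The first \<open>j\<close> points already lie in the window; the other
    \<open>N - j\<close> are moved back by a period and placed before them.\<close>
  define p where "p i = (if i < N - j then t (i + j) - 2 * pi else t (i - (N - j)))" for i
  define e where "e = e1 * (-1) ^ (N + j)"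
  have shift_back: "g (x - 2 * pi) = (-1) ^ N * g x" for x
    using g(2)[of "x - 2 * pi"] by (cases "even N") auto
  have p1: "e * (-1) ^ i * g (p i) > 0" if i: "i < N" for i
  proof (cases "i < N - j")
    case True
    have "e * (-1) ^ i * g (p i) = e1 * ((-1) ^ (i + j) * ((-1) ^ N * (-1) ^ N)) * g (t (i + j))"
    proof -
      have "g (p i) = (-1) ^ N * g (t (i + j))" using True shift_back by (simp add: p_def)
      then show ?thesis by (simp add: e_def power_add mult_ac)
    qed
    also have "(-1) ^ N * (-1) ^ N = (1::real)" by (simp flip: power_add)
    finally show ?thesis using t(1)[of "i + j"] True by simp
  next
    case False
    have "e * (-1) ^ i = e1 * (-1) ^ (N + j + i)" by (simp add: e_def power_add)
    also have "N + j + i = (i - (N - j)) + 2 * N" using False j(3) by simp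
    also have "(-1::real) ^ (i - (N - j) + 2 * N) = (-1) ^ (i - (N - j))" by (simp only: power_add power_mult) simp
    finally have "e * (-1) ^ i = e1 * (-1) ^ (i - (N - j))" .
    moreover have "p i = t (i - (N - j))" using False by (simp add: p_def)
    ultimately show ?thesis using t(1)[of "i - (N - j)"] i by simp
  qed
  have p2: "p i < p (Suc i)" if i: "Suc i < N" for i
  proof -
    consider "Suc i < N - j" | "Suc i = N - j" | "i \<ge> N - j" by linarith
    then show ?thesis
    proof cases
      case 1
      then show ?thesis using t(2)[of "i + j"] by (simp add: p_def)
    next
      case 2
      then have "i + j = N - 1" using i by simp
      then show ?thesis using t(3) 2 by (simp add: p_def)
    next
      case 3
      then show ?thesis using t(2)[of "i - (N - j)"] i by (simp add: p_def Suc_diff_le)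
    qed
  qed
  have p3: "b \<le> p 0" using j(1,3) t(4) by (cases "j = N") (auto simp: p_def)
  have p4: "p (N - 1) < b + 2 * pi" using j(2)[of "j - 1"] j1 j(3) N by (auto simp: p_def)
  \<comment> \<open>The first point may still be equal to \<open>b\<close>; by continuity it can be
    moved slightly to the right without changing the sign there.\<close>
  have "isCont (\<lambda>x. e * g x) (p 0)" using g(1) by (auto simp: continuous_on_eq_continuous_at intro!: continuous_intros)
  moreover have "e * g (p 0) > 0" using p1[of 0] N by simp
  ultimately have "eventually (\<lambda>x. e * g x > 0) (at (p 0))"
    unfolding isCont_def by (rule order_tendstoD(1))
  then obtain d where d: "d > 0" "\<And>x. x \<noteq> p 0 \<Longrightarrow> \<bar>x - p 0\<bar> < d \<Longrightarrow> e * g x > 0"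
    unfolding eventually_at dist_real_def by blast
  have p01: "p 0 < p (Suc 0)" using p2[of 0] N by simp
  define q where "q = p 0 + min d (p (Suc 0) - p 0) / 2"
  have q: "p 0 < q" "q < p (Suc 0)" "\<bar>q - p 0\<bar> < d" using d(1) p01 by (auto simp: q_def min_def field_simps)
  show thesis
  proof (rule that[of e "p(0 := q)"])
    show "e * (-1) ^ i * g ((p(0 := q)) i) > 0" if "i < N" for i
      using p1[OF that] d(2)[of q] q by (cases i) auto
    show "(p(0 := q)) i < (p(0 := q)) (Suc i)" if "Suc i < N" for i
      using p2[OF that] q by (cases i) auto
    show "b < (p(0 := q)) 0" using p3 q by simp
    show "(p(0 := q)) (N - 1) < b + 2 * pi" using p4 N by simp
  qed
qed

section \<open>Removing nodes from cosine sums\<close>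

definition kill :: "nat \<Rightarrow> real \<Rightarrow> (real \<Rightarrow> real) \<Rightarrow> (real \<Rightarrow> real) \<Rightarrow> real \<Rightarrow> real" where
  "kill d v g g' t = 2 * cos ((t - v) / 2) * g' t + real d * sin ((t - v) / 2) * g t"

text \<open>\<open>kill\<close> is, up to a factor, the derivative of \<open>g\<close> divided by the \<open>d\<close>-th power of \<open>cos ((t - v) / 2)\<close>.\<close>

lemma kill_deriv:
  assumes g: "(g has_real_derivative g' t) (at t)" and c: "cos ((t - v) / 2) \<noteq> 0"
  shows "((\<lambda>t. g t / cos ((t - v) / 2) ^ d) has_real_derivative kill d v g g' t / (2 * cos ((t - v) / 2) ^ Suc d)) (at t)"
proof -
  let ?c = "cos ((t - v) / 2)" and ?s = "sin ((t - v) / 2)"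
  have "((\<lambda>t. cos ((t - v) / 2)) has_real_derivative - ?s / 2) (at t)" by (auto intro!: derivative_eq_intros)
  from DERIV_divide[OF g DERIV_power[OF this, of d]] c
  have "((\<lambda>t. g t / cos ((t - v) / 2) ^ d) has_real_derivative
    (g' t * ?c ^ d - g t * (real d * (- ?s / 2 * ?c ^ (d - Suc 0)))) / (?c ^ d * ?c ^ d)) (at t)" by simp
  moreover have "(g' t * ?c ^ d - g t * (real d * (- ?s / 2 * ?c ^ (d - Suc 0)))) / (?c ^ d * ?c ^ d)
     = kill d v g g' t / (2 * ?c ^ Suc d)"
    using c by (cases d) (simp_all add: kill_def field_simps)
  ultimately show ?thesis by simp
qed

text \<open>Between \<open>v - pi\<close> and \<open>v + pi\<close> the cosine is positive, so
  dividing by its power keeps the signs, and the mean value theorem gives a point in each of the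
  \<open>N - 1\<close> gaps. The gap across the zero of the cosine is unusable, which costs one
  sign.\<close>

lemma cyc_alt_kill:
  assumes g: "\<And>x. (g has_real_derivative g' x) (at x)" "\<And>x. g (x + 2 * pi) = (-1) ^ N * g x" and N: "N \<ge> 2"
    and ca: "cyc_alt N g"
  shows "cyc_alt (N - 1) (kill d v g g')"
proof -
  have cg: "continuous_on UNIV g"
    using g(1) by (meson DERIV_continuous continuous_at_imp_continuous_on)
  obtain e s where s: "\<And>i. i < N \<Longrightarrow> e * (-1) ^ i * g (s i) > 0" "\<And>i. Suc i < N \<Longrightarrow> s i < s (Suc i)"
    "v - pi < s 0" "s (N - 1) < v - pi + 2 * pi"
    using cyc_alt_rotate[OF cg g(2) N ca] by blast
  have mono: "s i \<le> s j" if "i \<le> j" "j < N" for i j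
    using that by (induction j rule: dec_induct) (use s(2) in \<open>force intro: order_trans less_imp_le\<close>)+
  have rng: "v - pi < s i" "s i < v + pi" if "i < N" for i
    using mono[of 0 i] mono[of i "N - 1"] s(3,4) that by force+
  have cpos: "cos ((x - v) / 2) > 0" if "v - pi < x" "x < v + pi" for x
    using that by (intro cos_gt_zero_pi) auto
  define G where "G t = g t / cos ((t - v) / 2) ^ d" for t
  have sg: "e * (-1) ^ i * G (s i) > 0" if "i < N" for i
    using divide_pos_pos[OF s(1)[OF that] zero_less_power[OF cpos[OF rng[OF that]], of d]] by (simp add: G_def)
  have "\<exists>z. s i < z \<and> z < s (Suc i) \<and> - e * (-1) ^ i * kill d v g g' z > 0" if i: "Suc i < N" for i
  proof -
    have c: "cos ((x - v) / 2) > 0" if "s i \<le> x" "x \<le> s (Suc i)" for x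
      using cpos rng[of i] rng[of "Suc i"] i that by force
    have dG: "(G has_real_derivative kill d v g g' x / (2 * cos ((x - v) / 2) ^ Suc d)) (at x)"
      if "s i \<le> x" "x \<le> s (Suc i)" for x
      unfolding G_def[abs_def] using c[OF that] by (intro kill_deriv g(1)) simp
    obtain z where z: "s i < z" "z < s (Suc i)" "G (s (Suc i)) - G (s i) = (s (Suc i) - s i) * (kill d v g g' z / (2 * cos ((z - v) / 2) ^ Suc d))"
      using MVT2[OF s(2)[OF i], of G "\<lambda>z. kill d v g g' z / (2 * cos ((z - v) / 2) ^ Suc d)"] dG by blast
    have "- e * (-1) ^ i * (kill d v g g' z / (2 * cos ((z - v) / 2) ^ Suc d)) > 0"
      by (rule increment_sign[OF sg[of i] sg[of "Suc i"] z(3)]) (use i s(2) in auto)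
    moreover have "2 * cos ((z - v) / 2) ^ Suc d > 0" using c[of z] z by simp
    ultimately have "- e * (-1) ^ i * kill d v g g' z > 0"
      by (metis times_divide_eq_right zero_less_divide_iff less_asym)
    then show ?thesis using z by blast
  qed
  then obtain z where z: "\<And>i. Suc i < N \<Longrightarrow> s i < z i" "\<And>i. Suc i < N \<Longrightarrow> z i < s (Suc i)"
    "\<And>i. Suc i < N \<Longrightarrow> - e * (-1) ^ i * kill d v g g' (z i) > 0"
    by metis
  show ?thesis
  proof (rule cyc_altI)
    show "- e * (-1) ^ i * kill d v g g' (z i) > 0" if "i < N - 1" for i using z(3)[of i] that by simp
    show "z i < z (Suc i)" if "Suc i < N - 1" for i
    proof -
      have "Suc (Suc i) < N" using that by linarith
      then show ?thesis using z(2)[of i] z(1)[of "Suc i"] by simp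
    qed
    have "N - 1 - 1 < N" "Suc (N - 1 - 1) = N - 1" using N by auto
    then have "z (N - 1 - 1) < s (N - 1)" using z(2)[of "N - 1 - 1"] N by simp
    also have "\<dots> < v - pi + 2 * pi" using s(4) .
    also have "v - pi < z 0" using s(3) z(1)[of 0] N by simp
    finally show "z (N - 1 - 1) < z 0 + 2 * pi" by simp
  qed
qed

definition cos_sum :: "nat \<Rightarrow> real set \<Rightarrow> (real \<Rightarrow> real) \<Rightarrow> real \<Rightarrow> real" where
  "cos_sum d Y a t = (\<Sum>y\<in>Y. a y * cos ((t - y) / 2) ^ d)"

definition cos_sum' :: "nat \<Rightarrow> real set \<Rightarrow> (real \<Rightarrow> real) \<Rightarrow> real \<Rightarrow> real" where
  "cos_sum' d Y a t = (\<Sum>y\<in>Y. a y * (real d * (- sin ((t - y) / 2) / 2 * cos ((t - y) / 2) ^ (d - Suc 0))))"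

lemma cos_sum_deriv: "(cos_sum d Y a has_real_derivative cos_sum' d Y a t) (at t)"
proof -
  have "((\<lambda>t. cos ((t - y) / 2)) has_real_derivative - sin ((t - y) / 2) / 2) (at t)" for y
    by (auto intro!: derivative_eq_intros)
  from DERIV_cmult[OF DERIV_power[OF this]] show ?thesis
    unfolding cos_sum_def[abs_def] cos_sum'_def by (intro DERIV_sum) blast
qed

lemma cos_sum_quasi_periodic: "cos_sum d Y a (t + 2 * pi) = (-1) ^ d * cos_sum d Y a t"
proof -
  have "cos ((t + 2 * pi - y) / 2) ^ d = (-1) ^ d * cos ((t - y) / 2) ^ d" for y
  proof -
    have "cos ((t + 2 * pi - y) / 2) = cos ((t - y) / 2 + pi)" by (rule arg_cong[of _ _ cos]) (simp add: field_simps)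
    then show ?thesis by (simp add: power_minus[of "cos ((t - y) / 2)"])
  qed
  then show ?thesis by (simp add: cos_sum_def sum_distrib_left mult_ac)
qed

text \<open>The addition theorem for \<open>(t - v) / 2 - (t - y) / 2\<close> turns the two terms of
  a node \<open>y\<close> into a lower cosine power times \<open>sin ((y - v) / 2)\<close>, a factor
  that vanishes for \<open>y = v\<close>.\<close>

lemma kill_cos_sum:
  assumes "finite Y" "v \<in> Y"
  shows "kill (Suc d) v (cos_sum (Suc d) Y a) (cos_sum' (Suc d) Y a) =
    cos_sum d (Y - {v}) (\<lambda>y. real (Suc d) * sin ((y - v) / 2) * a y)"
proof
  fix t
  have summand: "2 * cos ((t - v) / 2) * (a y * (real (Suc d) * (- sin ((t - y) / 2) / 2 * cos ((t - y) / 2) ^ (Suc d - Suc 0))))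
     + real (Suc d) * sin ((t - v) / 2) * (a y * cos ((t - y) / 2) ^ Suc d)
     = real (Suc d) * sin ((y - v) / 2) * a y * cos ((t - y) / 2) ^ d" for y
  proof -
    have "sin ((y - v) / 2) = sin ((t - v) / 2 - (t - y) / 2)" by (rule arg_cong[of _ _ sin]) (simp add: field_simps)
    also have "\<dots> = sin ((t - v) / 2) * cos ((t - y) / 2) - cos ((t - v) / 2) * sin ((t - y) / 2)"
      by (rule sin_diff)
    finally have sd: "sin ((y - v) / 2) = sin ((t - v) / 2) * cos ((t - y) / 2) - cos ((t - v) / 2) * sin ((t - y) / 2)" .
    show ?thesis unfolding sd by (simp add: field_simps)
  qed
  have "kill (Suc d) v (cos_sum (Suc d) Y a) (cos_sum' (Suc d) Y a) t =
     (\<Sum>y\<in>Y. real (Suc d) * sin ((y - v) / 2) * a y * cos ((t - y) / 2) ^ d)"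
    unfolding kill_def cos_sum_def cos_sum'_def sum_distrib_left sum.distrib[symmetric] summand ..
  also have "\<dots> = cos_sum d (Y - {v}) (\<lambda>y. real (Suc d) * sin ((y - v) / 2) * a y) t"
    unfolding cos_sum_def using assms by (subst sum.remove[of Y v]) auto
  finally show "kill (Suc d) v (cos_sum (Suc d) Y a) (cos_sum' (Suc d) Y a) t =
    cos_sum d (Y - {v}) (\<lambda>y. real (Suc d) * sin ((y - v) / 2) * a y) t" .
qed

text \<open>Nodes are removed down to a single one, whose cosine power is even and hence has one
  sign. \<open>d\<close> and \<open>K\<close> drop together, so the parity hypothesis survives; it
  makes the quasi-periodicity factor \<open>(-1) ^ d\<close> agree with the number
  \<open>K + 2\<close> of signs, as \<open>cyc_alt_kill\<close> demands.\<close>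

lemma cos_sum_not_cyc_alt:
  assumes "finite Y" "card Y = Suc K" "d \<ge> K" "even (d + K)"
  shows "\<not> cyc_alt (K + 2) (cos_sum d Y a)"
  using assms
proof (induction K arbitrary: d Y a)
  case 0
  then obtain y where y: "Y = {y}" by (auto simp: card_1_singleton_iff)
  show ?case
  proof
    assume "cyc_alt (0 + 2) (cos_sum d Y a)"
    then obtain e s where s: "\<forall>i<0 + 2. (e::real) * (-1) ^ i * cos_sum d Y a (s i) > 0"
      unfolding cyc_alt_def by blast
    define c where "c i = cos ((s i - y) / 2) ^ d" for i
    have c: "c i \<ge> 0" for i using 0 by (simp add: c_def zero_le_even_power)
    have "e * a y * c 0 > 0" "- (e * a y) * c 1 > 0" using s[rule_format, of 0] s[rule_format, of 1] by (simp_all add: cos_sum_def y c_def mult_ac)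
    moreover from this have "c 0 > 0" using c[of 0] by (cases "c 0 = 0") auto
    ultimately have "e * a y > 0" using zero_less_mult_pos2 by blast
    then have "e * a y * c 1 \<ge> 0" using c[of 1] by simp
    then show False using \<open>- (e * a y) * c 1 > 0\<close> by simp
  qed
next
  case (Suc K)
  obtain v where v: "v \<in> Y" using Suc.prems by fastforce
  obtain d' where d: "d = Suc d'" using Suc.prems by (cases d) auto
  show ?case
  proof
    assume "cyc_alt (Suc K + 2) (cos_sum d Y a)"
    moreover have "cos_sum d Y a (x + 2 * pi) = (-1) ^ (Suc K + 2) * cos_sum d Y a x" for x
      using cos_sum_quasi_periodic[of d Y a x] Suc.prems(4) by (cases "even d") auto
    ultimately have "cyc_alt (Suc K + 2 - 1) (kill d v (cos_sum d Y a) (cos_sum' d Y a))"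
      by (intro cyc_alt_kill[OF cos_sum_deriv]) auto
    then have "cyc_alt (K + 2) (cos_sum d' (Y - {v}) (\<lambda>y. real (Suc d') * sin ((y - v) / 2) * a y))"
      using kill_cos_sum[OF Suc.prems(1) v] by (simp add: d)
    moreover have "\<not> cyc_alt (K + 2) (cos_sum d' (Y - {v}) (\<lambda>y. real (Suc d') * sin ((y - v) / 2) * a y))"
      using Suc.prems v d by (intro Suc.IH) auto
    ultimately show False by simp
  qed
qed

section \<open>Isolated zeros\<close>

definition loc_fin_zeros :: "(real \<Rightarrow> real) \<Rightarrow> bool" where
  "loc_fin_zeros g \<longleftrightarrow> (\<forall>A B. finite {t \<in> {A..B}. g t = 0})"

text \<open>A point of \<open>Z\<close> is determined by the subset of \<open>C\<close> to its
  left.\<close>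

lemma finite_if_separated:
  fixes Z C :: "real set"
  assumes "finite C" "\<And>x y. x \<in> Z \<Longrightarrow> y \<in> Z \<Longrightarrow> x < y \<Longrightarrow> \<exists>c\<in>C. x < c \<and> c < y"
  shows "finite Z"
proof (rule inj_on_finite)
  show "inj_on (\<lambda>x. {c \<in> C. c < x}) Z"
  proof (rule linorder_inj_onI)
    fix x y assume "x < y" "x \<in> Z" "y \<in> Z"
    then obtain c where "c \<in> C" "x < c" "c < y" using assms(2) by blast
    then have "c \<in> {c \<in> C. c < y}" "c \<notin> {c \<in> C. c < x}" by auto
    then show "{c \<in> C. c < x} \<noteq> {c \<in> C. c < y}" by blast
  qed auto
  show "(\<lambda>x. {c \<in> C. c < x}) ` Z \<subseteq> Pow C" by auto
qed (use assms in simp)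

lemma loc_fin_zeros_antideriv:
  assumes g: "\<And>x. (g has_real_derivative g' x) (at x)" and "loc_fin_zeros g'"
  shows "loc_fin_zeros g"
  unfolding loc_fin_zeros_def
proof (intro allI)
  fix A B :: real
  show "finite {t \<in> {A..B}. g t = 0}"
  proof (rule finite_if_separated[of "{t \<in> {A..B}. g' t = 0}"])
    show "finite {t \<in> {A..B}. g' t = 0}" using assms(2) by (simp add: loc_fin_zeros_def)
    fix x y assume xy: "x \<in> {t \<in> {A..B}. g t = 0}" "y \<in> {t \<in> {A..B}. g t = 0}" "x < y"
    obtain z where "x < z" "z < y" "g y - g x = (y - x) * g' z" using MVT2[OF xy(3), of g g'] g by auto
    then show "\<exists>c\<in>{t \<in> {A..B}. g' t = 0}. x < c \<and> c < y" using xy by (intro bexI[of _ z]) auto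
  qed
qed

lemma loc_fin_zeros_cos: "loc_fin_zeros (\<lambda>t. cos ((t - v) / 2))"
  unfolding loc_fin_zeros_def
proof (intro allI)
  fix A B :: real
  have "{t \<in> {A..B}. cos ((t - v) / 2) = 0} \<subseteq> (\<lambda>i::int. v + of_int i * pi) ` {\<lfloor>(A - v) / pi\<rfloor>..\<lceil>(B - v) / pi\<rceil>}"
  proof
    fix t assume t: "t \<in> {t \<in> {A..B}. cos ((t - v) / 2) = 0}"
    then obtain i :: int where "(t - v) / 2 = of_int i * (pi / 2)" unfolding mem_Collect_eq cos_zero_iff_int by blast
    then have ti: "t = v + of_int i * pi" by (simp add: field_simps)
    then have "(A - v) / pi \<le> of_int i" "of_int i \<le> (B - v) / pi" using t by (auto simp: field_simps)
    then have "\<lfloor>(A - v) / pi\<rfloor> \<le> i" "i \<le> \<lceil>(B - v) / pi\<rceil>" by linarith+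
    then show "t \<in> (\<lambda>i::int. v + of_int i * pi) ` {\<lfloor>(A - v) / pi\<rfloor>..\<lceil>(B - v) / pi\<rceil>}" using ti by auto
  qed
  then show "finite {t \<in> {A..B}. cos ((t - v) / 2) = 0}" by (rule finite_subset) simp
qed

text \<open>Two zeros of \<open>g\<close> where the cosine does not vanish are separated by a zero
  of the cosine or, by Rolle for the quotient, by a zero of \<open>kill\<close>. The remaining zeros
  of \<open>g\<close> are zeros of the cosine.\<close>

lemma loc_fin_zeros_kill:
  assumes g: "\<And>x. (g has_real_derivative g' x) (at x)" and k: "loc_fin_zeros (kill d v g g')"
  shows "loc_fin_zeros g"
  unfolding loc_fin_zeros_def
proof (intro allI)
  fix A B :: real
  let ?C = "{t \<in> {A..B}. cos ((t - v) / 2) = 0}" and ?K = "{t \<in> {A..B}. kill d v g g' t = 0}"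
  have fin: "finite ?C" "finite ?K" using loc_fin_zeros_cos[of v] k by (auto simp: loc_fin_zeros_def)
  have "finite {t \<in> {A..B}. g t = 0 \<and> cos ((t - v) / 2) \<noteq> 0}"
  proof (rule finite_if_separated[of "?C \<union> ?K"])
    show "finite (?C \<union> ?K)" using fin by simp
    fix x y assume xy: "x \<in> {t \<in> {A..B}. g t = 0 \<and> cos ((t - v) / 2) \<noteq> 0}" "y \<in> {t \<in> {A..B}. g t = 0 \<and> cos ((t - v) / 2) \<noteq> 0}" "x < y"
    show "\<exists>c\<in>?C \<union> ?K. x < c \<and> c < y"
    proof (cases "\<exists>c. x < c \<and> c < y \<and> cos ((c - v) / 2) = 0")
      case True
      then show ?thesis using xy by auto
    next
      case False
      then have c: "cos ((t - v) / 2) \<noteq> 0" if "x \<le> t" "t \<le> y" for t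
        using xy that by (cases "t = x \<or> t = y") auto
      have dG: "((\<lambda>t. g t / cos ((t - v) / 2) ^ d) has_real_derivative kill d v g g' t / (2 * cos ((t - v) / 2) ^ Suc d)) (at t)"
        if "x \<le> t" "t \<le> y" for t
        using c[OF that] by (intro kill_deriv g)
      obtain z where z: "x < z" "z < y" "g y / cos ((y - v) / 2) ^ d - g x / cos ((x - v) / 2) ^ d = (y - x) * (kill d v g g' z / (2 * cos ((z - v) / 2) ^ Suc d))"
        using MVT2[OF xy(3), of "\<lambda>t. g t / cos ((t - v) / 2) ^ d" "\<lambda>z. kill d v g g' z / (2 * cos ((z - v) / 2) ^ Suc d)"]
          dG by blast
      then have "kill d v g g' z = 0" using xy c[of z] by simp
      then show ?thesis using z xy by (intro bexI[of _ z]) auto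
    qed
  qed
  then have "finite ({t \<in> {A..B}. g t = 0 \<and> cos ((t - v) / 2) \<noteq> 0} \<union> ?C)" using fin by simp
  then show "finite {t \<in> {A..B}. g t = 0}" by (rule finite_subset[rotated]) auto
qed

lemma sin_half_diff_nonzero:
  assumes "x \<in> {0..<2*pi}" "y \<in> {0..<2*pi}" "x \<noteq> y"
  shows "sin ((x - y) / 2) \<noteq> 0"
proof -
  have *: "sin ((x - y) / 2) > 0" if "x \<in> {0..<2*pi}" "y \<in> {0..<2*pi}" "x > y" for x y :: real
    using that by (intro sin_gt_zero) auto
  have "sin ((x - y) / 2) = - sin ((y - x) / 2)"
    unfolding sin_minus[symmetric] by (rule arg_cong[of _ _ sin]) (simp add: field_simps)
  then show ?thesis using *[of x y] *[of y x] assms by (cases "x < y") auto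
qed

text \<open>Every removed node differs from \<open>y0\<close>, so the coefficient at
  \<open>y0\<close> is only multiplied by nonzero numbers: distinct nodes in one period have
  \<open>sin ((y0 - v) / 2) \<noteq> 0\<close>. A single cosine power is left.\<close>

lemma loc_fin_zeros_cos_sum:
  assumes "finite Y" "card Y = Suc K" "d \<ge> K" "Y \<subseteq> {0..<2*pi}" "y0 \<in> Y" "a y0 \<noteq> 0"
  shows "loc_fin_zeros (cos_sum d Y a)"
  using assms
proof (induction K arbitrary: d Y a)
  case 0
  then have y: "Y = {y0}" by (auto simp: card_1_singleton_iff)
  have "finite {t \<in> {A..B}. cos_sum d Y a t = 0}" for A B
  proof (rule finite_subset)
    show "{t \<in> {A..B}. cos_sum d Y a t = 0} \<subseteq> {t \<in> {A..B}. cos ((t - y0) / 2) = 0}"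
      using 0 by (auto simp: cos_sum_def y)
  qed (use loc_fin_zeros_cos in \<open>simp add: loc_fin_zeros_def\<close>)
  then show ?case by (simp add: loc_fin_zeros_def)
next
  case (Suc K)
  obtain v where v: "v \<in> Y" "v \<noteq> y0" 
  proof -
    have "card (Y - {y0}) = Suc K" using Suc.prems by simp
    then have "Y - {y0} \<noteq> {}" by fastforce
    then show ?thesis using that by blast
  qed
  obtain d' where d: "d = Suc d'" using Suc.prems by (cases d) auto
  have "loc_fin_zeros (cos_sum d' (Y - {v}) (\<lambda>y. real (Suc d') * sin ((y - v) / 2) * a y))"
  proof (rule Suc.IH)
    have "y0 \<in> {0..<2*pi}" "v \<in> {0..<2*pi}" using Suc.prems(4,5) v(1) by blast+
    then have "sin ((y0 - v) / 2) \<noteq> 0" using sin_half_diff_nonzero v(2) by metis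
    then show "real (Suc d') * sin ((y0 - v) / 2) * a y0 \<noteq> 0" using Suc.prems by simp
  qed (use Suc.prems v d in auto)
  then show ?case
    using kill_cos_sum[OF Suc.prems(1) v(1)] 
    by (intro loc_fin_zeros_kill[where d=d and v=v, OF cos_sum_deriv]) (simp add: d)
qed

definition lin_alt :: "nat \<Rightarrow> real \<Rightarrow> real \<Rightarrow> real \<Rightarrow> (real \<Rightarrow> real) \<Rightarrow> bool" where
  "lin_alt k e a b g \<longleftrightarrow> (\<exists>s::nat \<Rightarrow> real. (\<forall>i<k. a < s i \<and> s i < b \<and> e * (-1) ^ i * g (s i) > 0) \<and>
     (\<forall>i. Suc i < k \<longrightarrow> s i < s (Suc i)))"

lemma lin_alt_Cons:
  assumes "\<forall>i<k. c < s i \<and> s i < b \<and> e * (-1) ^ i * g (s i) > 0" "\<forall>i. Suc i < k \<longrightarrow> s i < s (Suc i)"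
    "a < t" "t < b" "- e * g t > 0" "t < s 0" "c \<ge> a"
  shows "lin_alt (Suc k) (- e) a b g"
  unfolding lin_alt_def
proof (intro exI[of _ "case_nat t s"] conjI allI impI)
  fix i assume "i < Suc k"
  then show "a < case_nat t s i" "case_nat t s i < b" "- e * (-1) ^ i * g (case_nat t s i) > 0"
    using assms by (cases i; force)+
next
  fix i assume "Suc i < Suc k"
  then show "case_nat t s i < case_nat t s (Suc i)" using assms by (cases i) auto
qed

text \<open>Greedy cutting: the first interval ends at the infimum of the points of wrong sign. An
  alternation to the right of this cut could be prolonged by a wrong point in front of it, so the
  bound there is smaller by one. Intervals may be empty, which keeps their number at exactly
  \<open>k + 1\<close>.\<close>

lemma sign_intervals:
  assumes "a \<le> b" "\<not> lin_alt (Suc k) (- e) a b g"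
  shows "\<exists>z. z 0 = a \<and> z (Suc k) = b \<and> (\<forall>i\<le>k. z i \<le> z (Suc i)) \<and>
    (\<forall>i\<le>k. \<forall>t\<in>{z i<..<z (Suc i)}. e * (-1) ^ i * g t \<ge> 0)"
  using assms
proof (induction k arbitrary: a e)
  case 0
  have "e * g t \<ge> 0" if "t \<in> {a<..<b}" for t
  proof (rule ccontr)
    assume "\<not> e * g t \<ge> 0"
    then have "lin_alt (Suc 0) (- e) a b g" unfolding lin_alt_def using that by (intro exI[of _ "\<lambda>_. t"]) auto
    then show False using 0 by simp
  qed
  then show ?case using 0 by (intro exI[of _ "\<lambda>i. if i = 0 then a else b"]) auto
next
  case (Suc k)
  define S where "S = {t \<in> {a<..<b}. e * g t < 0}"
  show ?case
  proof (cases "S = {}")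
    case True
    then have "e * g t \<ge> 0" if "t \<in> {a<..<b}" for t using that unfolding S_def by (force simp: not_less)
    \<comment> \<open>Without a wrong point all later intervals degenerate to
      \<open>b\<close>.\<close>
    then show ?thesis using Suc.prems by (intro exI[of _ "\<lambda>i. if i = 0 then a else b"]) auto
  next
    case False
    have bdd: "bdd_below S" by (rule bdd_belowI[of _ a]) (auto simp: S_def)
    define c where "c = Inf S"
    obtain t where t: "t \<in> S" using False by blast
    have c: "a \<le> c" "c \<le> b"
      using cInf_greatest[OF False, of a] cInf_lower[OF t bdd] t by (auto simp: c_def S_def)
    have "\<not> lin_alt (Suc k) (- (- e)) c b g"
    proof
      assume "lin_alt (Suc k) (- (- e)) c b g"
      then obtain s where s: "\<forall>i<Suc k. c < s i \<and> s i < b \<and> e * (-1) ^ i * g (s i) > 0" "\<forall>i. Suc i < Suc k \<longrightarrow> s i < s (Suc i)"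
        unfolding lin_alt_def by auto
      then have "Inf S < s 0" by (auto simp: c_def)
      then obtain t where "t \<in> S" "t < s 0" using cInf_lessD[OF False] by blast
      then have "lin_alt (Suc (Suc k)) (- e) a b g"
        using lin_alt_Cons[OF s, of a t] c by (auto simp: S_def)
      then show False using Suc.prems by simp
    qed
    from Suc.IH[OF c(2) this] obtain z where z: "z 0 = c" "z (Suc k) = b" "\<forall>i\<le>k. z i \<le> z (Suc i)"
      "\<forall>i\<le>k. \<forall>t\<in>{z i<..<z (Suc i)}. - e * (-1) ^ i * g t \<ge> 0" by blast
    have first: "e * g t \<ge> 0" if "t \<in> {a<..<c}" for t
    proof (rule ccontr)
      assume "\<not> e * g t \<ge> 0"
      then have "t \<in> S" using that c by (auto simp: S_def)
      then show False using cInf_lower[OF _ bdd, of t] that by (simp add: c_def)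
    qed
    show ?thesis
    proof (intro exI[of _ "case_nat a z"] conjI allI impI ballI)
      fix i assume i: "i \<le> Suc k"
      show "case_nat a z i \<le> case_nat a z (Suc i)" using i z c by (cases i) auto
      fix t assume t: "t \<in> {case_nat a z i<..<case_nat a z (Suc i)}"
      show "e * (-1) ^ i * g t \<ge> 0"
      proof (cases i)
        case 0
        then show ?thesis using t z(1) first by auto
      next
        case (Suc j)
        then show ?thesis using t z(4) i by auto
      qed
    qed (use z in auto)
  qed
qed

text \<open>Two alternations of length \<open>k + 1\<close> with opposite starting signs combine:
  the smaller of their first points, put in front of the other alternation, gives length
  \<open>k + 2\<close>.\<close>

lemma not_cyc_alt_imp_not_lin_alt:
  assumes "\<not> cyc_alt (k + 2) g"
  obtains e :: real where "e = 1 \<or> e = -1" "\<not> lin_alt (Suc k) (- e) 0 (2 * pi) g"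
proof (rule ccontr)
  assume "\<not> thesis"
  then have "lin_alt (Suc k) 1 0 (2 * pi) g" "lin_alt (Suc k) (- 1) 0 (2 * pi) g"
    using that[of 1] that[of "-1"] by auto
  then obtain s t where s: "\<forall>i<Suc k. 0 < s i \<and> s i < 2 * pi \<and> 1 * (-1) ^ i * g (s i) > 0" "\<forall>i. Suc i < Suc k \<longrightarrow> s i < s (Suc i)"
    and t: "\<forall>i<Suc k. 0 < t i \<and> t i < 2 * pi \<and> (- 1) * (-1) ^ i * g (t i) > 0" "\<forall>i. Suc i < Suc k \<longrightarrow> t i < t (Suc i)"
    unfolding lin_alt_def by metis
  have "s 0 \<noteq> t 0" using s(1)[rule_format, of 0] t(1)[rule_format, of 0] by auto
  then have "\<exists>e. lin_alt (Suc (Suc k)) e 0 (2 * pi) g"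
    using lin_alt_Cons[OF s, of 0 "t 0"] lin_alt_Cons[OF t, of 0 "s 0"] s(1)[rule_format, of 0] t(1)[rule_format, of 0]
    by (cases "s 0 < t 0") auto
  then obtain e s where s: "\<forall>i<Suc (Suc k). 0 < s i \<and> s i < 2 * pi \<and> e * (-1) ^ i * g (s i) > 0" "\<forall>i. Suc i < Suc (Suc k) \<longrightarrow> s i < s (Suc i)"
    unfolding lin_alt_def by blast
  have "cyc_alt (k + 2) g"
  proof (rule cyc_altI[of _ e _ s])
    have "s (Suc k) < 2 * pi" "0 < s 0" using s(1) by auto
    then show "s (k + 2 - 1) < s 0 + 2 * pi" by simp
  qed (use s in auto)
  then show False using assms by simp
qed

section \<open>Interpolation by smoothed perfect splines\<close>

lemma compact_real_box: "compact {a :: 'i \<Rightarrow> real. \<forall>i. a i \<in> {A..B}}"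
proof -
  have "compactin (product_topology (\<lambda>i::'i. euclidean) UNIV) (PiE UNIV (\<lambda>_. {A..B}))"
    unfolding compactin_PiE compactin_euclidean_iff using compact_Icc by blast
  then have "compact (PiE UNIV (\<lambda>_::'i. {A..B}))"
    unfolding euclidean_product_topology compactin_euclidean_iff .
  moreover have "PiE UNIV (\<lambda>_::'i. {A..B}) = {a. \<forall>i. a i \<in> {A..B}}"
    unfolding PiE_UNIV_domain Pi_def by simp
  ultimately show ?thesis by metis
qed

definition dual_spline :: "nat \<Rightarrow> nat \<Rightarrow> real set \<Rightarrow> real \<times> (real \<Rightarrow> real) \<Rightarrow> real \<Rightarrow> real" where
  "dual_spline n r X p t = fst p + (\<Sum>y\<in>X. snd p y * (prim ^^ r) (beta0 n) (y - t))"

text \<open>Coefficients off \<open>X\<close> must vanish so that a pair is given by finitely many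
  numbers; this makes the unit sphere below compact in the product topology.\<close>

definition balanced :: "real set \<Rightarrow> (real \<times> (real \<Rightarrow> real)) set" where
  "balanced X = {p. (\<Sum>y\<in>X. snd p y) = 0 \<and> (\<forall>y. y \<notin> X \<longrightarrow> snd p y = 0)}"

lemma continuous_prim_beta0: "continuous_on S ((prim ^^ j) (beta0 n))"
  using mean_free_prim_funpow[OF mean_free_beta0, of j n] continuous_on_subset
  unfolding mean_free_def by blast

lemma periodic2pi_prim_beta0: "periodic2pi ((prim ^^ j) (beta0 n))"
  using mean_free_prim_funpow[OF mean_free_beta0, of j n] unfolding mean_free_def by blast

lemma prim_beta0_deriv: "((prim ^^ Suc j) (beta0 n) has_real_derivative (prim ^^ j) (beta0 n) x) (at x)"
  by (rule prim_funpow_has_derivative[OF mean_free_beta0])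

lemma continuous_dual_spline: "continuous_on S (dual_spline n r X p)"
  unfolding dual_spline_def by (intro continuous_intros continuous_on_compose2[OF continuous_prim_beta0[of UNIV]]) auto

lemma periodic2pi_dual_spline: "periodic2pi (dual_spline n r X p)"
  using periodic2pi_reflect[OF periodic2pi_prim_beta0] by (simp add: dual_spline_def periodic2pi_def)

lemma dual_spline_deriv: "(dual_spline n (Suc r) X p has_real_derivative - dual_spline n r X (0, snd p) t) (at t)"
proof -
  have "((\<lambda>t. fst p + (\<Sum>y\<in>X. snd p y * (prim ^^ Suc r) (beta0 n) (y - t))) has_real_derivative
    0 + (\<Sum>y\<in>X. snd p y * - (prim ^^ r) (beta0 n) (y - t))) (at t)"
    by (intro DERIV_add DERIV_const DERIV_sum DERIV_cmult DERIV_reflect prim_beta0_deriv)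
  then show ?thesis by (simp add: dual_spline_def[abs_def] sum_negf)
qed

text \<open>The coefficients sum to 0, so the mean subtracted in \<open>beta0\<close> drops
  out.\<close>

lemma dual_spline_0:
  assumes "p \<in> balanced X"
  shows "dual_spline n 0 X (0, snd p) t = cos_sum (2*n) X (snd p) t / dlvp_norm n"
proof -
  have "cos ((y - t) / 2) = cos ((t - y) / 2)" for y
    using cos_minus[of "(t - y) / 2"] by (simp add: minus_divide_left)
  then have "dlvp n (y - t) = cos ((t - y) / 2) ^ (2*n) / dlvp_norm n" for y by (simp add: dlvp_def)
  then have "dual_spline n 0 X (0, snd p) t = (\<Sum>y\<in>X. snd p y * cos ((t - y) / 2) ^ (2*n) / dlvp_norm n - snd p y * (1 / (2*pi)))"
    by (simp add: dual_spline_def beta0_def right_diff_distrib)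
  also have "\<dots> = cos_sum (2*n) X (snd p) t / dlvp_norm n - (\<Sum>y\<in>X. snd p y) * (1 / (2 * pi))"
    by (simp add: sum_subtractf cos_sum_def sum_divide_distrib sum_distrib_right)
  finally show ?thesis using assms by (simp add: balanced_def)
qed

lemma cyc_alt_scale:
  assumes "cyc_alt N (\<lambda>t. c * g t)" shows "cyc_alt N g"
proof -
  obtain e s where s: "\<And>i. i < N \<Longrightarrow> e * (-1) ^ i * (c * g (s i)) > 0" "\<And>i. Suc i < N \<Longrightarrow> s i < s (Suc i)" "s (N - 1) < s 0 + 2 * pi"
    using cyc_altE[OF assms] by metis
  show ?thesis by (rule cyc_altI[of _ "e * c" _ s]) (use s in \<open>auto simp: mult_ac\<close>)
qed

text \<open>An alternation of even length survives \<open>r\<close> differentiations, which also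
  remove the constant and leave a cosine sum with \<open>2*m + 1\<close> nodes. For
  \<open>r = 0\<close> no differentiation removes the constant, so it has to be 0 from the
  start.\<close>

lemma dual_spline_not_cyc_alt:
  assumes X: "finite X" "card X = 2*m + 1" and nm: "m \<le> n" and p: "p \<in> balanced X" "r = 0 \<longrightarrow> fst p = 0"
  shows "\<not> cyc_alt (2*m + 2) (dual_spline n r X p)"
  using p
proof (induction r arbitrary: p)
  case 0
  then have f0: "fst p = 0" by simp
  have w: "dual_spline n 0 X p = (\<lambda>t. (1 / dlvp_norm n) * cos_sum (2*n) X (snd p) t)"
  proof
    fix t
    have "dual_spline n 0 X p t = dual_spline n 0 X (0, snd p) t" by (simp add: dual_spline_def f0)
    then show "dual_spline n 0 X p t = (1 / dlvp_norm n) * cos_sum (2*n) X (snd p) t"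
      using dual_spline_0[OF 0(1), of n t] by simp
  qed
  show ?case
  proof
    assume "cyc_alt (2*m + 2) (dual_spline n 0 X p)"
    then have "cyc_alt (2*m + 2) (cos_sum (2*n) X (snd p))" unfolding w by (rule cyc_alt_scale[of _ "1 / dlvp_norm n"])
    moreover have "\<not> cyc_alt (2*m + 2) (cos_sum (2*n) X (snd p))" using X nm by (intro cos_sum_not_cyc_alt) auto
    ultimately show False by simp
  qed
next
  case (Suc r)
  show ?case
  proof
    assume "cyc_alt (2*m + 2) (dual_spline n (Suc r) X p)"
    then have "cyc_alt (2*m + 2) (\<lambda>t. - dual_spline n r X (0, snd p) t)"
      by (rule cyc_alt_deriv[OF _ _ periodic2piD[OF periodic2pi_dual_spline] dual_spline_deriv, rotated 2]) simp_all
    then have "cyc_alt (2*m + 2) (dual_spline n r X (0, snd p))"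
      using cyc_alt_scale[of "2*m + 2" "-1" "dual_spline n r X (0, snd p)"] by simp
    moreover have "(0, snd p) \<in> balanced X" using Suc.prems by (simp add: balanced_def)
    ultimately show False using Suc.IH[of "(0, snd p)"] by simp
  qed
qed

lemma loc_fin_zeros_uminus: "loc_fin_zeros (\<lambda>t. - g t) = loc_fin_zeros g"
  by (simp add: loc_fin_zeros_def)

lemma loc_fin_zeros_dual_spline:
  assumes X: "finite X" "card X = 2*m + 1" "X \<subseteq> {0..<2*pi}" and nm: "m \<le> n"
    and p: "p \<in> balanced X" "p \<noteq> (0, \<lambda>_. 0)" "r = 0 \<longrightarrow> fst p = 0"
  shows "loc_fin_zeros (dual_spline n r X p)"
proof (cases "\<exists>y\<in>X. snd p y \<noteq> 0")
  case False
  then have "snd p = (\<lambda>_. 0)" using p(1) by (auto simp: balanced_def)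
  then have "fst p \<noteq> 0" "dual_spline n r X p = (\<lambda>_. fst p)" using p(2) by (auto simp: dual_spline_def prod_eq_iff)
  then show ?thesis by (simp add: loc_fin_zeros_def)
next
  case True
  then obtain y0 where y0: "y0 \<in> X" "snd p y0 \<noteq> 0" by blast
  show ?thesis using p(1) y0(2) p(3)
  proof (induction r arbitrary: p)
    case 0
    have "{t \<in> {A..B}. dual_spline n 0 X p t = 0} = {t \<in> {A..B}. cos_sum (2*n) X (snd p) t = 0}" for A B
      using dual_spline_0[OF 0(1), of n] dlvp_norm_pos[of n] 0(3) by (cases p) auto
    moreover have "loc_fin_zeros (cos_sum (2*n) X (snd p))"
      using X nm y0(1) 0 by (intro loc_fin_zeros_cos_sum[of X "2*m" "2*n" y0]) auto
    ultimately show ?case by (simp add: loc_fin_zeros_def)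
  next
    case (Suc r)
    have "loc_fin_zeros (\<lambda>t. - dual_spline n r X (0, snd p) t)"
      unfolding loc_fin_zeros_uminus using Suc.prems by (intro Suc.IH) (auto simp: balanced_def)
    then show ?case by (rule loc_fin_zeros_antideriv[OF dual_spline_deriv])
  qed
qed

text \<open>Abel summation: in a sum over \<open>2*m + 1\<close> intervals of alternating sign each
  of the \<open>2*m\<close> interior cut points occurs twice with the same sign.\<close>

lemma alternating_telescope:
  fixes F :: "nat \<Rightarrow> real"
  shows "(\<Sum>i\<le>2*m. (-1) ^ i * (F i - F (Suc i))) = F 0 - F (2*m + 1) + 2 * (\<Sum>i=1..2*m. (-1) ^ i * F i)"
proof (induction m)
  case (Suc m)
  have 1: "{..2 * Suc m} = insert (2*m+2) (insert (2*m+1) {..2*m})" by auto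
  have 2: "{1..2 * Suc m} = insert (2*m+2) (insert (2*m+1) {1..2*m})" by auto
  show ?case unfolding 1 2 using Suc by (simp add: algebra_simps)
qed simp

lemma integral_split_intervals:
  fixes g :: "real \<Rightarrow> real"
  assumes "\<forall>i<k. z i \<le> z (Suc i)" "g integrable_on {z 0..z k}"
  shows "z 0 \<le> z k \<and> integral {z 0..z k} g = (\<Sum>i<k. integral {z i..z (Suc i)} g)"
  using assms
proof (induction k)
  case (Suc k)
  have le: "z k \<le> z (Suc k)" using Suc.prems by simp
  have z0: "z 0 \<le> z k" using Suc.prems(1) by (induction k) (auto intro: order_trans)
  have "g integrable_on {z 0..z k}" by (rule integrable_on_subinterval[OF Suc.prems(2)]) (use le in auto)
  then have "integral {z 0..z k} g = (\<Sum>i<k. integral {z i..z (Suc i)} g)" using Suc by simp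
  moreover have "integral {z 0..z k} g + integral {z k..z (Suc k)} g = integral {z 0..z (Suc k)} g"
    by (rule Henstock_Kurzweil_Integration.integral_combine) (use z0 le Suc.prems in auto)
  ultimately show ?case using z0 le by simp
qed simp

lemma integral_sgn_split:
  fixes w v :: "real \<Rightarrow> real"
  assumes z: "z 0 = 0" "z (Suc k) = 2 * pi" "\<forall>i\<le>k. z i \<le> z (Suc i)"
    and e: "e = 1 \<or> e = -1" and sg: "\<forall>i\<le>k. \<forall>t\<in>{z i<..<z (Suc i)}. e * (-1) ^ i * w t \<ge> 0"
    and zeros: "loc_fin_zeros w" and v: "continuous_on UNIV v"
  shows "(\<lambda>t. sgn (w t) * v t) integrable_on {0..2*pi}"
    "integral {0..2*pi} (\<lambda>t. sgn (w t) * v t) = e * (\<Sum>i\<le>k. (-1) ^ i * integral {z i..z (Suc i)} v)"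
proof -
  have fin: "finite ({t \<in> {z i..z (Suc i)}. w t = 0} \<union> {z i, z (Suc i)})" for i
    using zeros by (simp add: loc_fin_zeros_def)
  have eq: "sgn (w t) * v t = e * (-1) ^ i * v t" if "i \<le> k" "t \<in> {z i..z (Suc i)} - ({t \<in> {z i..z (Suc i)}. w t = 0} \<union> {z i, z (Suc i)})" for i t
  proof -
    have t: "t \<in> {z i<..<z (Suc i)}" "w t \<noteq> 0" using that(2) by auto
    then have pos: "e * (-1) ^ i * w t \<ge> 0" using sg that(1) by blast
    have "e * (-1) ^ i = 1 \<or> e * (-1) ^ i = -1" using e by (cases "even i") auto
    then have "sgn (w t) = e * (-1) ^ i" using pos t(2) by (auto simp: sgn_if)
    then show ?thesis by simp
  qed
  have iv: "v integrable_on {a..b}" for a b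
    using v continuous_on_subset integrable_continuous_real by blast
  have ii: "((\<lambda>t. sgn (w t) * v t) has_integral e * (-1) ^ i * integral {z i..z (Suc i)} v) {z i..z (Suc i)}" if "i \<le> k" for i
  proof (rule has_integral_spike_finite[OF fin[of i] eq[OF that]])
    show "((\<lambda>t. e * (-1) ^ i * v t) has_integral e * (-1) ^ i * integral {z i..z (Suc i)} v) {z i..z (Suc i)}"
      using iv by (intro has_integral_mult_right integrable_integral)
  qed
  have "j \<le> Suc k \<Longrightarrow> z 0 \<le> z j \<and> (\<lambda>t. sgn (w t) * v t) integrable_on {z 0..z j}" for j
  proof (induction j)
    case (Suc j)
    have le: "z j \<le> z (Suc j)" using z(3) Suc.prems by simp
    moreover have "(\<lambda>t. sgn (w t) * v t) integrable_on {z 0..z (Suc j)}"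
      by (rule Henstock_Kurzweil_Integration.integrable_combine[of _ "z j"]) (use Suc le ii[of j] in auto)
    ultimately show ?case using Suc by auto
  qed (use integrable_on_refl[of _ "z 0"] in simp)
  then show int: "(\<lambda>t. sgn (w t) * v t) integrable_on {0..2*pi}" using z by (metis order_refl)
  have "integral {0..2*pi} (\<lambda>t. sgn (w t) * v t) = (\<Sum>i<Suc k. integral {z i..z (Suc i)} (\<lambda>t. sgn (w t) * v t))"
    using integral_split_intervals[of "Suc k" z "\<lambda>t. sgn (w t) * v t"] int z by (auto simp: less_Suc_eq_le)
  also have "\<dots> = (\<Sum>i\<le>k. e * ((-1) ^ i * integral {z i..z (Suc i)} v))"
    using ii by (intro sum.cong) (auto simp: less_Suc_eq_le integral_unique mult.assoc)
  finally show "integral {0..2*pi} (\<lambda>t. sgn (w t) * v t) = e * (\<Sum>i\<le>k. (-1) ^ i * integral {z i..z (Suc i)} v)"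
    by (simp add: sum_distrib_left)
qed

section \<open>The dual extremal problem\<close>

text \<open>The zeros of \<open>w\<close> carry no mass, so the one-sided derivative of the L1-norm
  at \<open>w\<close> in direction \<open>v\<close> is the integral of
  \<open>sgn (w t) * v t\<close>. The difference quotients are dominated by
  \<open>\<bar>v t\<bar>\<close>, and \<open>min\<close> passes to the limit.\<close>

lemma L1_norm_first_order:
  fixes w v :: "real \<Rightarrow> real"
  assumes w: "continuous_on UNIV w" "loc_fin_zeros w" and v: "continuous_on UNIV v"
    and min: "\<And>h. h > 0 \<Longrightarrow> h * l \<le> \<rho> * (integral {0..2*pi} (\<lambda>t. \<bar>w t + h * v t\<bar>) - integral {0..2*pi} (\<lambda>t. \<bar>w t\<bar>))"
  shows "l \<le> \<rho> * integral {0..2*pi} (\<lambda>t. sgn (w t) * v t)"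
proof -
  have cw: "continuous_on S w" and cv: "continuous_on S v" for S
    using w v continuous_on_subset by blast+
  define h where "h k = 1 / (real k + 1)" for k :: nat
  have h: "h k > 0" for k by (simp add: h_def)
  have h0: "h \<longlonglongrightarrow> 0" unfolding h_def by real_asymp
  define q where "q k t = (\<bar>w t + h k * v t\<bar> - \<bar>w t\<bar>) / h k" for k t
  define g where "g t = (if w t = 0 then \<bar>v t\<bar> else sgn (w t) * v t)" for t
  have lim: "(\<lambda>k. integral {0..2*pi} (q k)) \<longlonglongrightarrow> integral {0..2*pi} g"
  proof (rule dominated_convergence(2))
    show "q k integrable_on {0..2*pi}" for k
      unfolding q_def using h[of k] by (intro integrable_continuous_real continuous_intros cw cv) auto
    show "(\<lambda>t. \<bar>v t\<bar>) integrable_on {0..2*pi}"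
      by (intro integrable_continuous_real continuous_intros cv)
    show "norm (q k t) \<le> \<bar>v t\<bar>" for k t
    proof -
      have "\<bar>\<bar>w t + h k * v t\<bar> - \<bar>w t\<bar>\<bar> \<le> h k * \<bar>v t\<bar>"
        using abs_triangle_ineq3[of "w t + h k * v t" "w t"] h[of k] by (simp add: abs_mult)
      then show ?thesis using h[of k] by (simp add: q_def pos_divide_le_eq mult.commute)
    qed
    show "(\<lambda>k. q k t) \<longlonglongrightarrow> g t" for t
    proof (cases "w t = 0")
      case True
      then have "q k t = g t" for k using h[of k] by (simp add: q_def g_def abs_mult)
      then show ?thesis by simp
    next
      case False
      have "(\<lambda>k. h k * v t) \<longlonglongrightarrow> 0 * v t" using h0 by (intro tendsto_intros)
      then have "eventually (\<lambda>k. \<bar>h k * v t\<bar> < \<bar>w t\<bar>) sequentially"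
        using False tendstoD[of "\<lambda>k. h k * v t" 0 sequentially "\<bar>w t\<bar>"] by (simp add: dist_real_def)
      then have "eventually (\<lambda>k. q k t = g t) sequentially"
      proof eventually_elim
        case (elim k)
        have "\<bar>w t + h k * v t\<bar> = sgn (w t) * (w t + h k * v t)" using elim by (auto simp: sgn_if abs_if split: if_splits)
        moreover have "\<bar>w t\<bar> = sgn (w t) * w t" by (simp add: abs_sgn mult.commute)
        ultimately show ?case using False h[of k] by (simp add: q_def g_def algebra_simps)
      qed
      then show ?thesis by (rule tendsto_eventually)
    qed
  qed
  have "integral {0..2*pi} g = integral {0..2*pi} (\<lambda>t. sgn (w t) * v t)"
    by (rule integral_spike[OF negligible_finite, of "{t \<in> {0..2*pi}. w t = 0}"])
      (use w(2) in \<open>auto simp: loc_fin_zeros_def g_def\<close>)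
  moreover have "l \<le> \<rho> * integral {0..2*pi} (q k)" for k
  proof -
    have "integral {0..2*pi} (q k) = (integral {0..2*pi} (\<lambda>t. \<bar>w t + h k * v t\<bar>) - integral {0..2*pi} (\<lambda>t. \<bar>w t\<bar>)) / h k"
      unfolding q_def Henstock_Kurzweil_Integration.integral_divide
      by (subst integral_diff) (auto intro!: integrable_continuous_real continuous_intros cw cv)
    then show ?thesis using min[OF h[of k]] h[of k] by (simp add: pos_le_divide_eq mult.commute)
  qed
  moreover have "(\<lambda>k. \<rho> * integral {0..2*pi} (q k)) \<longlonglongrightarrow> \<rho> * integral {0..2*pi} g"
    using lim by (intro tendsto_intros)
  ultimately show ?thesis by (intro LIMSEQ_le_const[of "\<lambda>k. \<rho> * integral {0..2*pi} (q k)"]) auto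
qed

lemma dual_spline_add_scale:
  "dual_spline n r X (fst p + h * fst q, \<lambda>y. snd p y + h * snd q y) t = dual_spline n r X p t + h * dual_spline n r X q t"
  by (simp add: dual_spline_def sum.distrib sum_distrib_left distrib_left distrib_right mult_ac)

text \<open>The Lipschitz constant of f^(r-1) enters here. The first \<open>r - 1\<close>
  integrations by parts are exact, the last one is replaced by
  \<open>Lipschitz_integral_deriv_bound\<close>, and the vanishing sum of the coefficients removes
  the mean of \<open>fd 0\<close>.\<close>

lemma smooth_sum_le:
  assumes r: "r \<ge> 1" and X: "finite X"
    and fd: "\<And>i x. i < r - 1 \<Longrightarrow> (fd i has_real_derivative fd (Suc i) x) (at x)"
    and c: "\<And>i. i \<le> r - 1 \<Longrightarrow> continuous_on UNIV (fd i)" and per: "\<And>i. i \<le> r - 1 \<Longrightarrow> periodic2pi (fd i)"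
    and lip: "\<And>x y. \<bar>fd (r - 1) y - fd (r - 1) x\<bar> \<le> M * \<bar>y - x\<bar>"
    and p: "p \<in> balanced X"
  shows "(\<Sum>y\<in>X. snd p y * smooth n (fd 0) y) \<le> M * integral {0..2*pi} (\<lambda>t. \<bar>dual_spline n r X p t\<bar>)"
proof -
  let ?b = "\<lambda>j. (prim ^^ j) (beta0 n)"
  obtain r' where r': "r = Suc r'" using r by (cases r) auto
  have cf: "continuous_on S (fd r')" for S using c[of r'] r' continuous_on_subset by fastforce
  have cb: "continuous_on S (\<lambda>t. ?b j (y - t))" for S j y
    by (intro continuous_on_compose2[OF continuous_prim_beta0[of UNIV]] continuous_intros) auto
  have "(\<Sum>y\<in>X. snd p y * smooth n (fd 0) y) =
    (\<Sum>y\<in>X. snd p y * (integral {0..2*pi} (fd 0) / (2 * pi)) + snd p y * integral {0..2*pi} (\<lambda>t. fd r' t * ?b r' (y - t)))"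
    using smooth_by_parts[of r' fd n] fd c per[of 0] r' by (simp add: distrib_left)
  also have "\<dots> = (\<Sum>y\<in>X. integral {0..2*pi} (\<lambda>t. snd p y * (fd r' t * ?b r' (y - t))))"
  proof -
    have "(\<Sum>y\<in>X. snd p y * (integral {0..2*pi} (fd 0) / (2 * pi))) = 0"
      unfolding sum_distrib_right[symmetric] using p by (simp add: balanced_def)
    then show ?thesis unfolding sum.distrib by simp
  qed
  also have "\<dots> = integral {0..2*pi} (\<lambda>t. \<Sum>y\<in>X. snd p y * (fd r' t * ?b r' (y - t)))"
    by (rule integral_sum[symmetric]) (auto intro!: X integrable_continuous_real continuous_intros cf cb)
  also have "\<dots> = integral {0..2*pi} (\<lambda>t. - (fd r' t * - dual_spline n r' X (0, snd p) t))"
    by (simp add: dual_spline_def sum_distrib_left mult_ac)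
  also have "\<dots> = - integral {0..2*pi} (\<lambda>t. fd r' t * - dual_spline n r' X (0, snd p) t)"
    by (rule Henstock_Kurzweil_Integration.integral_neg)
  also have "\<dots> \<le> \<bar>integral {0..2*pi} (\<lambda>t. fd r' t * - dual_spline n r' X (0, snd p) t)\<bar>" by simp
  also have "\<dots> \<le> M * integral {0..2*pi} (\<lambda>t. \<bar>dual_spline n r X p t\<bar>)"
    unfolding r'
    by (rule Lipschitz_integral_deriv_bound[OF _ _ _ periodic2pi_dual_spline dual_spline_deriv])
      (use c per lip r' in \<open>auto intro!: continuous_intros continuous_dual_spline\<close>)
  finally show ?thesis .
qed

text \<open>The numbers \<open>z\<close> cut the period into the sign intervals of the extremal w.
  Stationarity tested with the constant function says that the sign pattern has mean zero unless
  \<open>\<xi> = 0\<close>; tested with the difference of two nodes it says that f_n minus the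
  smoothed spline takes one value \<open>\<kappa>\<close> on \<open>X\<close>.\<close>

lemma smoothed_interpolation:
  assumes r: "r \<ge> 1" and X: "finite X" "card X = 2*m + 1" "X \<subseteq> {0..<2*pi}" and nm: "m \<le> n"
    and fd: "\<And>i x. i < r - 1 \<Longrightarrow> (fd i has_real_derivative fd (Suc i) x) (at x)"
    and c: "\<And>i. i \<le> r - 1 \<Longrightarrow> continuous_on UNIV (fd i)" and per: "\<And>i. i \<le> r - 1 \<Longrightarrow> periodic2pi (fd i)"
    and lip: "\<And>x y. \<bar>fd (r - 1) y - fd (r - 1) x\<bar> \<le> M * \<bar>y - x\<bar>"
  shows "\<exists>\<xi> z \<kappa>. \<bar>\<xi>\<bar> \<le> M \<and> z 0 = 0 \<and> z (2*m + 1) = 2 * pi \<and> (\<forall>i\<le>2*m. z i \<le> z (Suc i)) \<and>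
     \<xi> * (pi - (\<Sum>i=1..2*m. (-1) ^ i * z i)) = 0 \<and>
     (\<forall>y\<in>X. smooth n (fd 0) y = \<kappa> + 2 * \<xi> * (\<Sum>i=1..2*m. (-1) ^ i * (prim ^^ Suc r) (beta0 n) (y - z i)))"
proof -
  let ?b = "\<lambda>j. (prim ^^ j) (beta0 n)"
  define N where "N p = integral {0..2*pi} (\<lambda>t. \<bar>dual_spline n r X p t\<bar>)" for p
  define L where "L p = (\<Sum>y\<in>X. snd p y * smooth n (fd 0) y)" for p :: "real \<times> (real \<Rightarrow> real)"
  have LN: "L p \<le> M * N p" if "p \<in> balanced X" for p
    unfolding L_def N_def by (rule smooth_sum_le[OF r X(1) fd c per lip that])
  \<comment> \<open>The quotient of \<open>L\<close> by \<open>N\<close> is invariant under positive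
    scaling, so maximising it on this compact sphere is maximising it over all nonzero balanced
    pairs.\<close>
  define S where "S = {p \<in> balanced X. \<bar>fst p\<bar> + (\<Sum>y\<in>X. \<bar>snd p y\<bar>) = 1}"
  have cont_snd: "continuous_on A (\<lambda>p :: real \<times> (real \<Rightarrow> real). snd p y)" for A y
    by (rule continuous_on_product_then_coordinatewise) (rule continuous_on_snd[OF continuous_on_id])
  have closed_b: "closed (balanced X)"
  proof -
    have "balanced X = {p. (\<Sum>y\<in>X. snd p y) = 0} \<inter> (\<Inter>y\<in>-X. {p. snd p y = 0})" by (auto simp: balanced_def)
    moreover have "closed {p :: real \<times> (real \<Rightarrow> real). (\<Sum>y\<in>X. snd p y) = 0}"
      by (intro closed_Collect_eq continuous_on_sum cont_snd continuous_on_const)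
    moreover have "closed {p :: real \<times> (real \<Rightarrow> real). snd p y = 0}" for y
      by (intro closed_Collect_eq cont_snd continuous_on_const)
    ultimately show ?thesis by (metis closed_INT closed_Int)
  qed
  have "closed S"
  proof -
    have "S = balanced X \<inter> {p. \<bar>fst p\<bar> + (\<Sum>y\<in>X. \<bar>snd p y\<bar>) = 1}" by (auto simp: S_def)
    moreover have "closed {p :: real \<times> (real \<Rightarrow> real). \<bar>fst p\<bar> + (\<Sum>y\<in>X. \<bar>snd p y\<bar>) = 1}"
      by (intro closed_Collect_eq continuous_intros cont_snd)
    ultimately show ?thesis using closed_b by auto
  qed
  moreover have "S \<subseteq> {-1..1} \<times> {a. \<forall>y. a y \<in> {-1..1}}"
  proof
    fix p assume p: "p \<in> S"
    have mem: "\<bar>snd p y\<bar> \<le> (\<Sum>y\<in>X. \<bar>snd p y\<bar>)" if "y \<in> X" for y using that X(1) by (intro member_le_sum) auto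
    have nn: "(\<Sum>y\<in>X. \<bar>snd p y\<bar>) \<ge> 0" by (intro sum_nonneg) auto
    have off: "snd p y = 0" if "y \<notin> X" for y using p that by (simp add: S_def balanced_def)
    have tot: "\<bar>fst p\<bar> + (\<Sum>y\<in>X. \<bar>snd p y\<bar>) = 1" using p by (simp add: S_def)
    have "\<bar>fst p\<bar> \<le> 1" using nn tot by linarith
    moreover have "\<bar>snd p y\<bar> \<le> 1" for y
    proof (cases "y \<in> X")
      case True
      then show ?thesis using mem[OF True] tot abs_ge_zero[of "fst p"] by linarith
    qed (simp add: off)
    ultimately have "fst p \<in> {-1..1}" "\<And>y. snd p y \<in> {-1..1}" by (simp_all add: abs_le_iff minus_le_iff)
    then show "p \<in> {-1..1} \<times> {a. \<forall>y. a y \<in> {-1..1}}" unfolding mem_Times_iff by blast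
  qed
  ultimately have compS: "compact S"
    using compact_Times[OF compact_Icc compact_real_box] compact_Int_closed by (metis inf.absorb_iff2 inf_commute)
  have S_ne: "(1, \<lambda>_. 0) \<in> S" by (simp add: S_def balanced_def)
  have zeros: "loc_fin_zeros (dual_spline n r X p)" if "p \<in> balanced X" "p \<noteq> (0, \<lambda>_. 0)" for p
    using loc_fin_zeros_dual_spline[OF X nm that] r by simp
  have cw: "continuous_on A (dual_spline n r X p)" for A p by (rule continuous_dual_spline)
  \<comment> \<open>The function of a nonzero balanced pair has finitely many zeros in a period, so
    its L1-norm cannot vanish.\<close>
  have Npos: "N p > 0" if "p \<in> balanced X" "p \<noteq> (0, \<lambda>_. 0)" for p
  proof -
    have ge: "N p \<ge> 0" unfolding N_def by (intro integral_nonneg integrable_continuous_real continuous_intros cw) auto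
    have "N p \<noteq> 0"
    proof
      assume "N p = 0"
      then have "\<forall>t\<in>{0..2*pi}. \<bar>dual_spline n r X p t\<bar> = 0"
        unfolding N_def by (subst (asm) integral_eq_0_iff) (auto intro!: continuous_intros cw)
      then have "{t \<in> {0..2*pi}. dual_spline n r X p t = 0} = {0..2*pi}" by auto
      then have "finite {0..2*pi}" using zeros[OF that] unfolding loc_fin_zeros_def by metis
      then show False using infinite_Icc[of 0 "2*pi"] by simp
    qed
    then show ?thesis using ge by simp
  qed
  have S_nz: "p \<in> balanced X \<and> p \<noteq> (0, \<lambda>_. 0)" if "p \<in> S" for p using that by (auto simp: S_def)
  have contN: "continuous_on S N"
  proof -
    have "continuous_on S (\<lambda>p. integral (cbox 0 (2*pi)) (\<lambda>t. \<bar>dual_spline n r X p t\<bar>))"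
    proof (rule integral_continuous_on_param)
      have "continuous_on (S \<times> cbox 0 (2 * pi)) (\<lambda>x. snd (fst x) y)" for y
        by (rule continuous_on_compose2[OF cont_snd[of UNIV]]) (auto intro: continuous_intros)
      then show "continuous_on (S \<times> cbox 0 (2 * pi)) (\<lambda>(p, t). \<bar>dual_spline n r X p t\<bar>)"
        unfolding dual_spline_def split_def
        by (intro continuous_intros continuous_on_compose2[OF continuous_prim_beta0[of UNIV]]) auto
    qed
    then show ?thesis by (simp add: N_def[abs_def])
  qed
  have contL: "continuous_on S L" unfolding L_def[abs_def] by (intro continuous_intros cont_snd)
  have contR: "continuous_on S (\<lambda>p. L p / N p)"
  proof (intro continuous_on_divide contN contL ballI)
    show "N p \<noteq> 0" if "p \<in> S" for p using Npos[of p] S_nz[OF that] by auto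
  qed
  obtain p0 where p0: "p0 \<in> S" "\<And>p. p \<in> S \<Longrightarrow> L p / N p \<le> L p0 / N p0"
    using continuous_attains_sup[OF compS _ contR] S_ne by blast
  define \<rho> where "\<rho> = L p0 / N p0"
  have p0b: "p0 \<in> balanced X" "p0 \<noteq> (0, \<lambda>_. 0)" using S_nz[OF p0(1)] by auto
  \<comment> \<open>\<open>L\<close> vanishes on the constant pair in \<open>S\<close>, so the
    maximal ratio is not negative.\<close>
  have \<rho>0: "\<rho> \<ge> 0" using p0(2)[OF S_ne] by (simp add: \<rho>_def L_def)
  have \<rho>M: "\<rho> \<le> M" using LN[OF p0b(1)] Npos[OF p0b] by (simp add: \<rho>_def pos_divide_le_eq)
  have L\<rho>: "L p \<le> \<rho> * N p" if p: "p \<in> balanced X" for p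
  proof (cases "p = (0, \<lambda>_. 0)")
    case True
    then show ?thesis using \<rho>0 by (simp add: L_def N_def dual_spline_def)
  next
    case False
    define s where "s = \<bar>fst p\<bar> + (\<Sum>y\<in>X. \<bar>snd p y\<bar>)"
    have sumge: "(\<Sum>y\<in>X. \<bar>snd p y\<bar>) \<ge> 0" by (intro sum_nonneg) auto
    have s: "s > 0"
    proof (rule ccontr)
      assume "\<not> s > 0"
      then have "\<bar>fst p\<bar> = 0" "(\<Sum>y\<in>X. \<bar>snd p y\<bar>) = 0"
        using sumge abs_ge_zero[of "fst p"] unfolding s_def by linarith+
      then have "fst p = 0" "(\<Sum>y\<in>X. \<bar>snd p y\<bar>) = 0" by auto
      then have "snd p y = 0" for y using X(1) p by (cases "y \<in> X") (auto simp: sum_nonneg_eq_0_iff balanced_def)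
      then show False using False \<open>fst p = 0\<close> by (cases p) auto
    qed
    define p' where "p' = (fst p / s, \<lambda>y. snd p y / s)"
    have "p' \<in> S" using p s unfolding S_def balanced_def p'_def
      by (auto simp: s_def simp flip: sum_divide_distrib add_divide_distrib)
    then have "L p' / N p' \<le> \<rho>" using p0(2) by (simp add: \<rho>_def)
    moreover have "L p' = L p / s" by (simp add: L_def p'_def sum_divide_distrib)
    moreover have "N p' = N p / s"
    proof -
      have "dual_spline n r X p' t = dual_spline n r X p t / s" for t
        by (simp add: dual_spline_def p'_def add_divide_distrib sum_divide_distrib)
      then show ?thesis using s by (simp add: N_def)
    qed
    ultimately have "L p / N p \<le> \<rho>" using s by simp
    then show ?thesis using Npos[OF p False] by (simp add: pos_divide_le_eq)
  qed
  define w where "w = dual_spline n r X p0"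
  have wz: "loc_fin_zeros w" unfolding w_def by (rule zeros[OF p0b])
  have var: "L q \<le> \<rho> * integral {0..2*pi} (\<lambda>t. sgn (w t) * dual_spline n r X q t)" if q: "q \<in> balanced X" for q
  proof (rule L1_norm_first_order[OF _ wz])
    fix h :: real assume h: "h > 0"
    define p where "p = (fst p0 + h * fst q, \<lambda>y. snd p0 y + h * snd q y)"
    have p: "p \<in> balanced X" using q p0b(1) by (simp add: balanced_def p_def sum.distrib flip: sum_distrib_left)
    have Np: "N p = integral {0..2*pi} (\<lambda>t. \<bar>w t + h * dual_spline n r X q t\<bar>)"
      unfolding N_def p_def dual_spline_add_scale w_def ..
    have "L p = L p0 + h * L q" 
      by (simp add: L_def p_def distrib_right sum.distrib sum_distrib_left mult.assoc)
    moreover have "L p0 = \<rho> * N p0" using Npos[OF p0b] by (simp add: \<rho>_def)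
    ultimately have "h * L q \<le> \<rho> * (N p - N p0)" using L\<rho>[OF p] by (simp add: algebra_simps)
    then show "h * L q \<le> \<rho> * (integral {0..2*pi} (\<lambda>t. \<bar>w t + h * dual_spline n r X q t\<bar>) - integral {0..2*pi} (\<lambda>t. \<bar>w t\<bar>))"
      unfolding Np by (simp add: N_def w_def)
  qed (auto simp: w_def continuous_dual_spline)
  \<comment> \<open>The first-order inequality holds for \<open>q\<close> and for its negative,
    hence it is an equality.\<close>
  have var_eq: "L q = \<rho> * integral {0..2*pi} (\<lambda>t. sgn (w t) * dual_spline n r X q t)" if q: "q \<in> balanced X" for q
  proof -
    define q' where "q' = (- fst q, \<lambda>y. - snd q y)"
    have q': "q' \<in> balanced X" using q by (simp add: balanced_def q'_def sum_negf)
    have "L q' = - L q" "dual_spline n r X q' t = - dual_spline n r X q t" for t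
      by (simp_all add: L_def q'_def dual_spline_def sum_negf)
    then have "- L q \<le> - (\<rho> * integral {0..2*pi} (\<lambda>t. sgn (w t) * dual_spline n r X q t))"
      using var[OF q'] by simp
    then show ?thesis using var[OF q] by simp
  qed
  obtain e :: real where e: "e = 1 \<or> e = -1" "\<not> lin_alt (Suc (2*m)) (- e) 0 (2 * pi) w"
    using not_cyc_alt_imp_not_lin_alt[of "2*m" w] dual_spline_not_cyc_alt[OF X(1,2) nm p0b(1)] r unfolding w_def by auto
  obtain z where z: "z 0 = 0" "z (Suc (2*m)) = 2 * pi" "\<forall>i\<le>2*m. z i \<le> z (Suc i)"
    "\<forall>i\<le>2*m. \<forall>t\<in>{z i<..<z (Suc i)}. e * (-1) ^ i * w t \<ge> 0"
    using sign_intervals[OF _ e(2)] by auto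
  have key: "L q = \<rho> * e * (\<Sum>i\<le>2*m. (-1) ^ i * integral {z i..z (Suc i)} (dual_spline n r X q))" if "q \<in> balanced X" for q
    using var_eq[OF that] integral_sgn_split(2)[OF z(1-3) e(1) z(4) wz continuous_dual_spline, of n r X q] by simp
  define \<xi> where "\<xi> = \<rho> * e"
  \<comment> \<open>\<open>\<xi> * H y\<close> is the integral of \<open>\<rho> * sgn (w t)\<close>
    against the r-th kernel primitive at \<open>y - t\<close>. The cut points 0 and 2 pi cancel by
    periodicity and the interior ones are doubled.\<close>
  define H where "H y = (\<Sum>i\<le>2*m. (-1) ^ i * (?b (Suc r) (y - z i) - ?b (Suc r) (y - z (Suc i))))" for y
  have H: "H y = 2 * (\<Sum>i=1..2*m. (-1) ^ i * ?b (Suc r) (y - z i))" for y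
    unfolding H_def using alternating_telescope[where m=m and F="\<lambda>i. ?b (Suc r) (y - z i)"]
      periodic2pi_minus[OF periodic2pi_prim_beta0[of "Suc r" n], of y] z(1,2) by simp
  have intb: "integral {z i..z (Suc i)} (\<lambda>t. ?b r (y - t)) = ?b (Suc r) (y - z i) - ?b (Suc r) (y - z (Suc i))" if "i \<le> 2*m" for i y
  proof -
    have "((\<lambda>t. - ?b (Suc r) (y - t)) has_real_derivative ?b r (y - t)) (at t)" for t
      using DERIV_minus[OF DERIV_reflect[OF prim_beta0_deriv[of r n]]] by simp
    from integral_antiderivative[OF this, of "z i" "z (Suc i)"] show ?thesis using z(3) that by simp
  qed
  have "0 = \<xi> * (\<Sum>i\<le>2*m. (-1) ^ i * integral {z i..z (Suc i)} (dual_spline n r X (1, \<lambda>_. 0)))"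
    using key[of "(1, \<lambda>_. 0)"] by (simp add: L_def \<xi>_def balanced_def)
  also have "(\<Sum>i\<le>2*m. (-1) ^ i * integral {z i..z (Suc i)} (dual_spline n r X (1, \<lambda>_. 0))) = (\<Sum>i\<le>2*m. (-1) ^ i * (- z i - - z (Suc i)))"
    using z(3) by (intro sum.cong) (auto simp: dual_spline_def[abs_def])
  also have "\<dots> = 2 * (pi - (\<Sum>i=1..2*m. (-1) ^ i * z i))"
    using alternating_telescope[where m=m and F="\<lambda>i. - z i"] z(1,2) by (simp add: sum_negf)
  finally have mean: "\<xi> * (pi - (\<Sum>i=1..2*m. (-1) ^ i * z i)) = 0" by simp
  have LH: "L (0, a) = \<xi> * (\<Sum>y\<in>X. a y * H y)" if "(0, a) \<in> balanced X" for a
  proof -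
    have "integral {z i..z (Suc i)} (dual_spline n r X (0, a)) = (\<Sum>y\<in>X. a y * (?b (Suc r) (y - z i) - ?b (Suc r) (y - z (Suc i))))" if "i \<le> 2*m" for i
    proof -
      have "integral {z i..z (Suc i)} (dual_spline n r X (0, a)) = integral {z i..z (Suc i)} (\<lambda>t. \<Sum>y\<in>X. a y * ?b r (y - t))"
        by (simp add: dual_spline_def[abs_def])
      also have "\<dots> = (\<Sum>y\<in>X. integral {z i..z (Suc i)} (\<lambda>t. a y * ?b r (y - t)))"
        by (intro integral_sum X(1) integrable_continuous_real continuous_intros
            continuous_on_compose2[OF continuous_prim_beta0[of UNIV]]) auto
      finally show ?thesis using intb[OF that] by simp
    qed
    then have "L (0, a) = \<xi> * (\<Sum>i\<le>2*m. \<Sum>y\<in>X. (-1) ^ i * (a y * (?b (Suc r) (y - z i) - ?b (Suc r) (y - z (Suc i)))))"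
      using key[OF that] by (simp add: \<xi>_def sum_distrib_left)
    also have "(\<Sum>i\<le>2*m. \<Sum>y\<in>X. (-1) ^ i * (a y * (?b (Suc r) (y - z i) - ?b (Suc r) (y - z (Suc i))))) = (\<Sum>y\<in>X. a y * H y)"
      unfolding H_def sum_distrib_left by (subst sum.swap) (simp add: mult_ac)
    finally show ?thesis .
  qed
  obtain y0 where y0: "y0 \<in> X" using X(1,2) by fastforce
  have "smooth n (fd 0) y - \<xi> * H y = smooth n (fd 0) y0 - \<xi> * H y0" if y: "y \<in> X" for y
  proof (cases "y = y0")
    case False
    \<comment> \<open>Unit mass at \<open>y\<close> minus unit mass at \<open>y0\<close>, the
      simplest coefficients of sum 0.\<close>
    define a where "a u = (if u = y then 1 else 0) - (if u = y0 then 1 else (0::real))" for u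
    have suma: "(\<Sum>u\<in>X. a u * g u) = g y - g y0" for g :: "real \<Rightarrow> real"
      using X(1) y y0 by (simp add: a_def left_diff_distrib sum_subtractf if_distrib[of "\<lambda>c. c * _"] sum.delta cong: if_cong)
    have "(0, a) \<in> balanced X" using suma[of "\<lambda>_. 1"] y y0 by (auto simp: balanced_def a_def)
    from LH[OF this] have "smooth n (fd 0) y - smooth n (fd 0) y0 = \<xi> * (H y - H y0)"
      by (simp add: L_def suma)
    then show ?thesis by (simp add: algebra_simps)
  qed simp
  then have "\<forall>y\<in>X. smooth n (fd 0) y = (smooth n (fd 0) y0 - \<xi> * H y0) + 2 * \<xi> * (\<Sum>i=1..2*m. (-1) ^ i * ?b (Suc r) (y - z i))"
    using H by (auto simp: algebra_simps)
  moreover have "\<bar>\<xi>\<bar> \<le> M" using \<rho>0 \<rho>M e(1) by (auto simp: \<xi>_def)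
  ultimately show ?thesis using z(1-3) mean
    by (intro exI[of _ \<xi>] exI[of _ z] exI[of _ "smooth n (fd 0) y0 - \<xi> * H y0"]) auto
qed

section \<open>Perfect splines with prescribed knots\<close>

fun alt_sum :: "('a \<Rightarrow> real) \<Rightarrow> 'a list \<Rightarrow> real" where
  "alt_sum h [] = 0"
| "alt_sum h (x # xs) = h x - alt_sum h xs"

lemma alt_sum_append: "alt_sum h (xs @ ys) = alt_sum h xs + (-1) ^ length xs * alt_sum h ys"
  by (induction xs) auto

lemma alt_sum_conv_sum: "alt_sum h xs = (\<Sum>q<length xs. (-1) ^ q * h (xs ! q))"
proof (induction xs)
  case (Cons x xs)
  then show ?case by (simp add: sum.lessThan_Suc_shift sum_negf del: sum.lessThan_Suc)
qed simp

lemma sorted_not_distinct_adjacent: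
  assumes "sorted zs" "\<not> distinct zs"
  obtains xs x ys where "zs = xs @ x # x # ys"
proof -
  have "\<exists>xs x ys. zs = xs @ x # x # ys"
    using assms
  proof (induction zs)
    case (Cons a as)
    show ?case
    proof (cases "a \<in> set as")
      case True
      then obtain b bs where b: "as = b # bs" by (cases as) auto
      then have "b = a" using Cons.prems(1) True by (auto intro: antisym)
      then show ?thesis using b by (intro exI[of _ "[]"]) auto
    next
      case False
      then obtain xs x ys where "as = xs @ x # x # ys" using Cons by auto
      then show ?thesis by (intro exI[of _ "a # xs"]) auto
    qed
  qed simp
  then show ?thesis using that by blast
qed

text \<open>Equal neighbours cancel. If the last knot is the first plus a period, the two cancel for
  periodic \<open>h\<close> and the remaining signs flip, hence \<open>e\<close>; for the identity
  they contribute \<open>- 2 * pi\<close>, and after the flip the rest again has alternating sum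
  \<open>- pi\<close>. The same condition keeps the list from becoming empty.\<close>

lemma reduce_knots:
  fixes zs :: "real list"
  assumes "sorted zs" "even (length zs)" "zs \<noteq> [] \<Longrightarrow> last zs \<le> hd zs + 2 * pi" "alt_sum (\<lambda>z. z) zs = - pi"
  shows "\<exists>ts e. (e = 1 \<or> e = (-1::real)) \<and> sorted_wrt (<) ts \<and> even (length ts) \<and> length ts \<le> length zs \<and>
    ts \<noteq> [] \<and> last ts < hd ts + 2 * pi \<and> alt_sum (\<lambda>z. z) ts = - pi \<and>
    (\<forall>h. periodic2pi h \<longrightarrow> alt_sum h zs = e * alt_sum h ts)"
  using assms
proof (induction zs rule: length_induct)
  case (1 zs)
  have ne: "zs \<noteq> []" using 1(5) by auto
  show ?case
  proof (cases "distinct zs")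
    case False
    then obtain xs x ys where zs: "zs = xs @ x # x # ys" using sorted_not_distinct_adjacent 1(2) by blast
    have alt_eq: "alt_sum h zs = alt_sum h (xs @ ys)" for h by (simp add: zs alt_sum_append)
    have sub: "sorted (xs @ ys)" using 1(2) by (auto simp: zs sorted_append)
    have "xs @ ys \<noteq> []" using alt_eq[of "\<lambda>z. z"] 1(5) by auto
    moreover have "last (xs @ ys) \<le> last zs" if "xs @ ys \<noteq> []"
      using 1(2) that by (cases ys rule: rev_cases; cases xs rule: rev_cases) (auto simp: zs sorted_append)
    moreover have "hd zs \<le> hd (xs @ ys)" if "xs @ ys \<noteq> []"
      using 1(2) that by (cases ys; cases xs) (auto simp: zs sorted_append)
    ultimately have "last (xs @ ys) \<le> hd (xs @ ys) + 2 * pi" using 1(4)[OF ne] by linarith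
    moreover have "length (xs @ ys) < length zs" "even (length (xs @ ys))" using 1(3) by (auto simp: zs)
    ultimately obtain ts e where ts: "(e = 1 \<or> e = (-1::real))" "sorted_wrt (<) ts" "even (length ts)" "length ts \<le> length (xs @ ys)"
      "ts \<noteq> []" "last ts < hd ts + 2 * pi" "alt_sum (\<lambda>z. z) ts = - pi"
      "\<And>h. periodic2pi h \<Longrightarrow> alt_sum h (xs @ ys) = e * alt_sum h ts"
      using 1(1)[rule_format, of "xs @ ys"] sub 1(5) alt_eq[of "\<lambda>z. z"] by auto
    then show ?thesis using alt_eq by (intro exI[of _ ts] exI[of _ e]) (auto simp: zs)
  next
    case True
    then have strict: "sorted_wrt (<) zs" using 1(2) strict_sorted_iff by blast
    show ?thesis
    proof (cases "last zs < hd zs + 2 * pi")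
      case True
      then show ?thesis using strict ne 1 by (intro exI[of _ zs] exI[of _ 1]) auto
    next
      case False
      then have last: "last zs = hd zs + 2 * pi" using 1(4)[OF ne] by simp
      obtain x zs' where x: "zs = x # zs'" using ne by (cases zs) auto
      moreover have "zs' \<noteq> []" using 1(3) x by auto
      ultimately obtain ys y where zs: "zs = x # ys @ [y]" by (metis rev_exhaust)
      have y: "y = x + 2 * pi" using last by (simp add: zs)
      have ev: "even (length ys)" using 1(3) by (simp add: zs)
      have alt_eq: "alt_sum h zs = h x - h y - alt_sum h ys" for h using ev by (simp add: zs alt_sum_append)
      have ay: "alt_sum (\<lambda>z. z) ys = - pi" using alt_eq[of "\<lambda>z. z"] 1(5) y by simp
      have sy: "sorted ys" using 1(2) by (simp add: zs sorted_append)
      have "last ys \<le> hd ys + 2 * pi" if "ys \<noteq> []"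
      proof -
        have "last ys \<le> y" "x \<le> hd ys" using 1(2) that by (auto simp: zs sorted_append)
        then show ?thesis using y by simp
      qed
      then obtain ts e where ts: "(e = 1 \<or> e = (-1::real))" "sorted_wrt (<) ts" "even (length ts)" "length ts \<le> length ys"
        "ts \<noteq> []" "last ts < hd ts + 2 * pi" "alt_sum (\<lambda>z. z) ts = - pi"
        "\<And>h. periodic2pi h \<Longrightarrow> alt_sum h ys = e * alt_sum h ts"
        using 1(1)[rule_format, of ys] sy ay ev by (auto simp: zs)
      have "alt_sum h zs = - e * alt_sum h ts" if "periodic2pi h" for h
        using alt_eq[of h] ts(8)[OF that] periodic2piD[OF that, of x] by (simp add: y)
      then show ?thesis using ts by (intro exI[of _ ts] exI[of _ "- e"]) (auto simp: zs)
    qed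
  qed
qed

section \<open>Slopes of alternating sums of shifts of Q0\<close>

lemma Q0_deriv:
  assumes "0 < t" "t < 2 * pi"
  shows "(Q0 has_real_derivative 1/2 - t / (2*pi)) (at t)"
proof -
  have "((\<lambda>t. t * (2 * pi - t) / (4 * pi) - integral {0..2*pi} Qk / (2 * pi)) has_real_derivative 1/2 - t / (2*pi)) (at t)"
    by (auto intro!: derivative_eq_intros simp: field_simps)
  moreover have "eventually (\<lambda>t. t * (2 * pi - t) / (4 * pi) - integral {0..2*pi} Qk / (2 * pi) = Q0 t) (nhds t)"
    using eventually_nhds_in_open[of "{0<..<2*pi}" t] assms
    by (auto elim!: eventually_mono simp: Q0_def Qk_eq)
  ultimately show ?thesis by (rule DERIV_cong_ev[OF refl _ refl, THEN iffD1, rotated])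
qed

lemma Q0_deriv_neg:
  assumes "- (2 * pi) < t" "t < 0"
  shows "(Q0 has_real_derivative 1/2 - t / (2*pi) - 1) (at t)"
proof -
  have "(Q0 has_real_derivative 1/2 - (t + 2 * pi) / (2*pi)) (at (t + 2 * pi))"
    using assms by (intro Q0_deriv) auto
  then have "((\<lambda>t. Q0 (t + 2 * pi)) has_real_derivative 1/2 - (t + 2 * pi) / (2*pi)) (at t)"
    by (simp add: DERIV_shift)
  moreover have "(\<lambda>t. Q0 (t + 2 * pi)) = Q0" using mean_free_Q0 by (auto simp: mean_free_def periodic2pi_def)
  moreover have "1/2 - (t + 2 * pi) / (2*pi) = 1/2 - t / (2*pi) - 1" by (simp add: field_simps)
  ultimately show ?thesis by simp
qed

lemma alternating_tail:
  assumes "even L" "i < L"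
  shows "(\<Sum>q<L. (-1) ^ q * (if q \<le> i then 0 else 1)) = (if even i then -1 else 0 :: real)"
proof -
  have all: "(\<Sum>q<k. (-1) ^ q) = (if even k then 0 else 1 :: real)" for k by (induction k) auto
  have "(\<Sum>q<L. (-1) ^ q * (if q \<le> i then 0 else 1)) = (\<Sum>q\<in>{..<L} - {..<Suc i}. (-1::real) ^ q)"
    by (intro sum.mono_neutral_cong_right) auto
  also have "\<dots> = (\<Sum>q<L. (-1) ^ q) - (\<Sum>q<Suc i. (-1) ^ q)"
    using assms by (intro sum_diff) auto
  also have "\<dots> = (if even i then -1 else 0)" unfolding all using assms by auto
  finally show ?thesis .
qed

text \<open>With an even number of knots the part of the slopes common to all of them cancels. The
  condition \<open>- pi\<close> contributes -1/2, and the unit jumps belonging to knots beyond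
  \<open>t\<close> contribute 1 or 0 according to the parity of \<open>i\<close>; doubling gives 1
  or -1.\<close>

lemma alt_sum_Q0_deriv:
  assumes ts: "sorted_wrt (<) ts" "even (length ts)" "ts \<noteq> []" "last ts < hd ts + 2 * pi" "alt_sum (\<lambda>z. z) ts = - pi"
    and i: "i < length ts" "knot ts i < t" "t < knot ts (Suc i)"
  shows "((\<lambda>t. 2 * alt_sum (\<lambda>z. Q0 (t - z)) ts) has_real_derivative (-1) ^ i) (at t)"
proof -
  let ?L = "length ts"
  have mono: "ts ! p \<le> ts ! q" if "p \<le> q" "q < ?L" for p q
    using sorted_wrt_nth_less[OF ts(1), of p q] that by (cases "p = q") auto
  have hd: "hd ts = ts ! 0" "last ts = ts ! (?L - 1)" using ts(3) by (auto simp: hd_conv_nth last_conv_nth)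
  have t1: "ts ! i < t" using i by (simp add: knot_def)
  have t2: "t < hd ts + 2 * pi"
  proof (cases "Suc i < ?L")
    case True
    then have "t < ts ! Suc i" using i by (simp add: knot_def)
    also have "ts ! Suc i \<le> last ts" unfolding hd using mono True by simp
    finally show ?thesis using ts(4) by simp
  qed (use i in \<open>simp add: knot_def\<close>)
  define S where "S q = 1/2 - (t - ts ! q) / (2*pi) - (if q \<le> i then 0 else 1)" for q
  have S: "((\<lambda>t. Q0 (t - ts ! q)) has_real_derivative S q) (at t)" if q: "q < ?L" for q
  proof -
    have "(Q0 has_real_derivative S q) (at (t + - ts ! q))"
    proof (cases "q \<le> i")
      case True
      have "0 < t - ts ! q" "t - ts ! q < 2 * pi" using mono[OF True i(1)] t1 t2 mono[of 0 q] q hd by auto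
      from Q0_deriv[OF this] show ?thesis using True by (simp add: S_def)
    next
      case False
      then have "Suc i \<le> q" by simp
      then have "t < ts ! q" using i mono[of "Suc i" q] q by (auto simp: knot_def split: if_splits)
      moreover have "- (2 * pi) < t - ts ! q" 
      proof -
        have "ts ! q \<le> ts ! (?L - 1)" using mono[of q "?L - 1"] q by linarith
        then show ?thesis using mono[of 0 i] t1 i(1) ts(4) hd by linarith
      qed
      ultimately show ?thesis using Q0_deriv_neg[of "t - ts ! q"] False by (simp add: S_def)
    qed
    then show ?thesis unfolding DERIV_shift by simp
  qed
  have "((\<lambda>t. 2 * (\<Sum>q<?L. (-1) ^ q * Q0 (t - ts ! q))) has_real_derivative 2 * (\<Sum>q<?L. (-1) ^ q * S q)) (at t)"
    using S by (intro DERIV_cmult DERIV_sum) auto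
  moreover have "2 * (\<Sum>q<?L. (-1) ^ q * S q) = (-1) ^ i"
  proof -
    have "(\<Sum>q<?L. (-1) ^ q * S q) = (\<Sum>q<?L. (-1) ^ q * (1/2 - t / (2*pi))) + (\<Sum>q<?L. (-1) ^ q * ts ! q) / (2 * pi)
       - (\<Sum>q<?L. (-1) ^ q * (if q \<le> i then 0 else 1))"
      by (simp add: S_def sum.distrib sum_subtractf sum_divide_distrib diff_divide_distrib right_diff_distrib distrib_left)
    also have "(\<Sum>q<?L. (-1) ^ q * (1/2 - t / (2*pi))) = 0"
    proof -
      have "(\<Sum>q<k. (-1) ^ q) = (if even k then 0 else 1 :: real)" for k by (induction k) auto
      then show ?thesis using ts(2) by (simp flip: sum_distrib_right)
    qed
    also have "(\<Sum>q<?L. (-1) ^ q * ts ! q) = - pi" using ts(5) alt_sum_conv_sum[of "\<lambda>z. z" ts] by simp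
    also have "(\<Sum>q<?L. (-1) ^ q * (if q \<le> i then 0 else 1)) = (if even i then -1 else 0 :: real)"
      by (rule alternating_tail[OF ts(2) i(1)])
    finally show ?thesis by auto
  qed
  ultimately show ?thesis unfolding alt_sum_conv_sum by simp
qed

section \<open>Polynomial pieces of a spline\<close>

lemma pderiv_sum: "pderiv (\<Sum>i\<in>A. f i) = (\<Sum>i\<in>A. pderiv (f i))"
  by (induction A rule: infinite_finite_induct) (auto simp: pderiv_add)

lemma poly_antiderivative:
  fixes p :: "real poly"
  obtains P where "pderiv P = p" "degree P \<le> Suc (degree p)"
proof
  define P where "P = (\<Sum>i\<le>degree p. monom (coeff p i / real (Suc i)) (Suc i))"
  show "degree P \<le> Suc (degree p)" unfolding P_def
    by (intro degree_sum_le) (auto intro: order_trans[OF degree_monom_le])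
  have "pderiv P = (\<Sum>i\<le>degree p. monom (coeff p i) i)"
    unfolding P_def pderiv_sum by (intro sum.cong) (auto simp: pderiv_monom)
  then show "pderiv P = p" by (simp add: poly_as_sum_of_monoms)
qed

lemma poly_on_interval_antideriv:
  fixes F :: "real \<Rightarrow> real"
  assumes F: "\<And>x. (F has_real_derivative G x) (at x)" and p: "\<And>t. t \<in> {a..b} \<Longrightarrow> G t = poly p t"
  obtains P where "degree P \<le> Suc (degree p)" "\<And>t. t \<in> {a..b} \<Longrightarrow> F t = poly P t"
proof -
  obtain P0 where P0: "pderiv P0 = p" "degree P0 \<le> Suc (degree p)" by (rule poly_antiderivative)
  define P where "P = P0 + [:F a - poly P0 a:]"
  have "F t = poly P t" if t: "t \<in> {a..b}" for t
  proof -
    have "integral {a..t} G = F t - F a" using t by (intro integral_antiderivative F) auto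
    moreover have "integral {a..t} (poly p) = poly P0 t - poly P0 a"
      using t poly_DERIV[of P0] P0(1) by (intro integral_antiderivative) auto
    moreover have "integral {a..t} G = integral {a..t} (poly p)" using p t by (intro integral_cong) auto
    ultimately show ?thesis by (simp add: P_def)
  qed
  moreover have "degree P \<le> Suc (degree p)" unfolding P_def using P0(2) by (intro degree_add_le) auto
  ultimately show ?thesis using that by blast
qed

lemma linear_on_interval:
  fixes g :: "real \<Rightarrow> real"
  assumes g: "continuous_on UNIV g" "\<And>t. t \<in> {a<..<b} \<Longrightarrow> (g has_real_derivative c) (at t)" and t: "t \<in> {a..b}"
  shows "g t = poly [:g a - c * a, c:] t"
proof (cases "a < t")
  case True
  have d: "(g has_real_derivative c) (at x)" if "a < x" "x < t" for x using g(2) that t by auto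
  obtain l z where z: "a < z" "z < t" "(g has_real_derivative l) (at z)" "g t - g a = (t - a) * l"
    using MVT[OF True continuous_on_subset[OF g(1)]] d real_differentiable_def by (metis subset_UNIV)
  then have "l = c" using d DERIV_unique by blast
  then show ?thesis using z(4) by (simp add: algebra_simps)
next
  case False
  then have "t = a" using t by simp
  then show ?thesis by (simp add: algebra_simps)
qed

text \<open>A closed form of the j-th derivative of the spline \<open>spl r \<kappa> c ts 0\<close>,
  meant for \<open>j \<le> r - 1\<close>. The factor 2 arises because the slope of \<open>Q0\<close>
  jumps by 1 while the r-th derivative must jump between \<open>c\<close> and
  \<open>- c\<close>.\<close>

definition spl :: "nat \<Rightarrow> real \<Rightarrow> real \<Rightarrow> real list \<Rightarrow> nat \<Rightarrow> real \<Rightarrow> real" where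
  "spl r \<kappa> c ts j t = (if j = 0 then \<kappa> else 0) + 2 * c * alt_sum (\<lambda>z. (prim ^^ (r - 1 - j)) Q0 (t - z)) ts"

lemma
  shows continuous_prim_Q0: "continuous_on UNIV ((prim ^^ j) Q0)"
    and periodic2pi_prim_Q0: "periodic2pi ((prim ^^ j) Q0)"
  using mean_free_prim_funpow[OF mean_free_Q0, of j] unfolding mean_free_def by blast+

lemma spl_deriv:
  assumes "j < r - 1"
  shows "(spl r \<kappa> c ts j has_real_derivative spl r \<kappa> c ts (Suc j) t) (at t)"
proof -
  have eq: "r - 1 - j = Suc (r - 1 - Suc j)" using assms by simp
  have "((\<lambda>t. (prim ^^ (r - 1 - j)) Q0 (t - z)) has_real_derivative (prim ^^ (r - 1 - Suc j)) Q0 (t - z)) (at t)" for z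
    using DERIV_translate[OF prim_funpow_has_derivative[OF mean_free_Q0], of "r - 1 - Suc j" "- z" t] unfolding eq by simp
  then have "((\<lambda>t. (if j = 0 then \<kappa> else 0) + 2 * c * (\<Sum>q<length ts. (-1) ^ q * (prim ^^ (r - 1 - j)) Q0 (t - ts ! q))) has_real_derivative
     0 + 2 * c * (\<Sum>q<length ts. (-1) ^ q * (prim ^^ (r - 1 - Suc j)) Q0 (t - ts ! q))) (at t)"
    by (intro DERIV_add DERIV_const DERIV_cmult DERIV_sum) auto
  then show ?thesis unfolding spl_def[abs_def] alt_sum_conv_sum by simp
qed

lemma continuous_spl: "continuous_on UNIV (spl r \<kappa> c ts j)"
  unfolding spl_def[abs_def] alt_sum_conv_sum
  by (intro continuous_intros continuous_on_compose2[OF continuous_prim_Q0]) auto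

lemma periodic2pi_spl: "periodic2pi (spl r \<kappa> c ts j)"
proof -
  have "(prim ^^ i) Q0 (t + 2 * pi - z) = (prim ^^ i) Q0 (t - z)" for i t z
    using periodic2piD[OF periodic2pi_prim_Q0, of i "t - z"] by (simp add: algebra_simps)
  then show ?thesis by (simp add: periodic2pi_def spl_def)
qed

lemma deriv_funpow_spl:
  assumes "j \<le> r - 1"
  shows "(deriv ^^ j) (spl r \<kappa> c ts 0) = spl r \<kappa> c ts j"
  using assms
proof (induction j)
  case (Suc j)
  then have "deriv (spl r \<kappa> c ts j) = spl r \<kappa> c ts (Suc j)"
    using spl_deriv[of j r \<kappa> c ts] by (intro ext DERIV_imp_deriv) auto
  then show ?case using Suc by simp
qed simp

text \<open>No differentiability is assumed: \<open>deriv\<close> is chosen from the set of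
  derivatives at a point, and that set is the same at \<open>x\<close> and at
  \<open>x + 2 * pi\<close>.\<close>

lemma periodic2pi_deriv_any: 
  assumes "periodic2pi g"
  shows "periodic2pi (deriv g)"
proof -
  have g: "(\<lambda>x. g (x + 2 * pi)) = g" using assms by (auto simp: periodic2pi_def)
  have "(g has_field_derivative D) (at (x + 2 * pi)) = (g has_field_derivative D) (at x)" for D x
    unfolding DERIV_shift g ..
  then show ?thesis unfolding periodic2pi_def deriv_def by simp
qed

lemma Linf_norm_AE_const:
  assumes "countable T" "\<And>t. t \<notin> T \<Longrightarrow> \<bar>g t\<bar> = C"
  shows "Linf_norm g = ereal C"
proof -
  have m: "(\<lambda>x. ereal \<bar>g x\<bar>) \<in> borel_measurable lebesgue"
    by (rule measurable_discrete_difference[of "\<lambda>_. ereal C" _ _ T]) (use assms in auto)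
  have "T \<in> null_sets lebesgue" using assms(1) by (simp add: countable_imp_null_set_lborel null_sets_completionI)
  then have "AE x in lebesgue. x \<notin> T" by (rule AE_not_in)
  then have ae: "AE x in lebesgue. ereal \<bar>g x\<bar> = ereal C" by eventually_elim (use assms in auto)
  have "esssup lebesgue (\<lambda>x. ereal \<bar>g x\<bar>) = esssup lebesgue (\<lambda>x::real. ereal C)"
    by (rule esssup_AE_cong[OF m _ ae]) simp
  also have "\<dots> = ereal C" by (rule esssup_const) simp
  finally show ?thesis by (simp add: Linf_norm_def)
qed

text \<open>The pieces are found from the top down: the (r-1)-st derivative is linear between knots,
  and each integration raises the degree by one. The r-th derivative is \<open>\<xi>\<close> up to
  sign off the translates of the knots, which are countably many.\<close>

lemma perfect_spline_from_knots:
  assumes r: "r \<ge> 1"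
    and ts: "sorted_wrt (<) ts" "even (length ts)" "ts \<noteq> []" "last ts < hd ts + 2 * pi" "alt_sum (\<lambda>z. z) ts = - pi"
    and len: "length ts \<le> N" and e: "e = 1 \<or> e = -1"
  shows "scaled_perfect_spline r N \<xi> (spl r \<kappa> (e * \<xi>) ts 0)"
    "Linf_norm ((deriv ^^ r) (spl r \<kappa> (e * \<xi>) ts 0)) = ereal \<bar>\<xi>\<bar>"
proof -
  let ?s = "spl r \<kappa> (e * \<xi>) ts"
  have r1: "Suc (r - 1) = r" using r by simp
  have top: "(?s (r - 1) has_real_derivative (-1) ^ i * e * \<xi>) (at t)"
    if "i < length ts" "knot ts i < t" "t < knot ts (Suc i)" for i t
  proof -
    have "((\<lambda>t. (if r - 1 = 0 then \<kappa> else 0) + e * \<xi> * (2 * alt_sum (\<lambda>z. Q0 (t - z)) ts)) has_real_derivative 0 + e * \<xi> * (-1) ^ i) (at t)"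
      by (intro DERIV_add DERIV_const DERIV_cmult alt_sum_Q0_deriv ts that)
    then show ?thesis by (simp add: spl_def[abs_def] mult_ac)
  qed
  have dr: "(deriv ^^ r) (?s 0) t = (-1) ^ i * e * \<xi>"
    if "i < length ts" "knot ts i < t" "t < knot ts (Suc i)" for i t
  proof -
    have "(deriv ^^ r) (?s 0) t = deriv (?s (r - 1)) t" using deriv_funpow_spl[of "r - 1" r \<kappa> "e * \<xi>" ts] by (subst r1[symmetric]) simp
    then show ?thesis using DERIV_imp_deriv[OF top[OF that]] by simp
  qed
  have piece: "\<exists>p. degree p \<le> r \<and> (\<forall>t\<in>{knot ts i..knot ts (Suc i)}. ?s 0 t = poly p t)" if i: "i < length ts" for i
  proof -
    have "j \<le> r - 1 \<Longrightarrow> \<exists>p. degree p \<le> Suc j \<and> (\<forall>t\<in>{knot ts i..knot ts (Suc i)}. ?s (r - 1 - j) t = poly p t)" for j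
    proof (induction j)
      case 0
      have "\<forall>t\<in>{knot ts i..knot ts (Suc i)}. ?s (r - 1) t = poly [:?s (r - 1) (knot ts i) - (-1) ^ i * e * \<xi> * knot ts i, (-1) ^ i * e * \<xi>:] t"
      proof
        fix t assume t: "t \<in> {knot ts i..knot ts (Suc i)}"
        show "?s (r - 1) t = poly [:?s (r - 1) (knot ts i) - (-1) ^ i * e * \<xi> * knot ts i, (-1) ^ i * e * \<xi>:] t"
          by (rule linear_on_interval[OF continuous_spl _ t]) (use top[OF i] in auto)
      qed
      moreover have "degree [:?s (r - 1) (knot ts i) - (-1) ^ i * e * \<xi> * knot ts i, (-1) ^ i * e * \<xi>:] \<le> Suc 0"
        by (simp add: degree_pCons_le order_trans[OF degree_pCons_le])
      ultimately show ?case unfolding diff_zero by blast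
    next
      case (Suc j)
      then obtain p where p: "degree p \<le> Suc j" "\<And>t. t \<in> {knot ts i..knot ts (Suc i)} \<Longrightarrow> ?s (r - 1 - j) t = poly p t" by auto
      have "Suc (r - 1 - Suc j) = r - 1 - j" using Suc.prems by simp
      then have "(?s (r - 1 - Suc j) has_real_derivative ?s (r - 1 - j) x) (at x)" for x
        using spl_deriv[of "r - 1 - Suc j" r \<kappa> "e * \<xi>" ts x] Suc.prems by simp
      from poly_on_interval_antideriv[OF this p(2)] obtain P where
        "degree P \<le> Suc (degree p)" "\<And>t. t \<in> {knot ts i..knot ts (Suc i)} \<Longrightarrow> ?s (r - 1 - Suc j) t = poly P t" by blast
      then show ?case using p(1) by (intro exI[of _ P]) auto
    qed
    from this[of "r - 1"] show ?thesis using r by simp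
  qed
  have Ck: "Ck (r - 1) (?s 0)"
    unfolding Ck_def
  proof (intro conjI allI impI)
    fix j x assume j: "j < r - 1"
    then have "(deriv ^^ j) (?s 0) = ?s j" by (intro deriv_funpow_spl) simp
    then show "(deriv ^^ j) (?s 0) differentiable at x" using spl_deriv[OF j] real_differentiable_def by metis
  qed (simp add: deriv_funpow_spl continuous_spl)
  show "scaled_perfect_spline r N \<xi> (?s 0)"
    unfolding scaled_perfect_spline_def
  proof (intro conjI exI[of _ ts] exI[of _ e] allI impI)
    show "1 \<le> length ts" using ts(3) by (cases ts) auto
    fix i assume i: "i < length ts"
    show "\<forall>t\<in>{knot ts i<..<knot ts (Suc i)}. (deriv ^^ r) (?s 0) t = (-1) ^ i * e * \<xi>" using dr[OF i] by auto
  qed (use ts len e Ck piece periodic2pi_spl in auto)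
  define T where "T = (\<Union>i<length ts. range (\<lambda>k::int. ts ! i - 2 * pi * of_int k))"
  show "Linf_norm ((deriv ^^ r) (?s 0)) = ereal \<bar>\<xi>\<bar>"
  proof (rule Linf_norm_AE_const)
    show "countable T" unfolding T_def by auto
    fix t assume t: "t \<notin> T"
    obtain k :: int where k: "hd ts \<le> t + 2 * pi * of_int k" "t + 2 * pi * of_int k < hd ts + 2 * pi" by (rule reduce_mod_2pi)
    define t' where "t' = t + 2 * pi * of_int k"
    have t': "t' \<noteq> ts ! i" if "i < length ts" for i
    proof
      assume "t' = ts ! i"
      then have "t = ts ! i - 2 * pi * of_int k" by (simp add: t'_def)
      then show False using t that by (auto simp: T_def)
    qed
    \<comment> \<open>The index of the knot interval containing \<open>t'\<close>, the
      representative of \<open>t\<close> in the period that starts at the first knot.\<close>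
    define i where "i = Max {i. i < length ts \<and> ts ! i \<le> t'}"
    have "0 \<in> {i. i < length ts \<and> ts ! i \<le> t'}" using ts(3) k by (simp add: hd_conv_nth t'_def)
    then have "i \<in> {i. i < length ts \<and> ts ! i \<le> t'}" unfolding i_def by (intro Max_in) auto
    then have i: "i < length ts" "ts ! i < t'" using t' by (auto simp: less_le)
    have "t' < knot ts (Suc i)"
    proof (cases "Suc i < length ts")
      case True
      have "\<not> ts ! Suc i \<le> t'"
      proof
        assume "ts ! Suc i \<le> t'"
        then have "Suc i \<in> {i. i < length ts \<and> ts ! i \<le> t'}" using True by simp
        then have "Suc i \<le> i" unfolding i_def by (intro Max_ge) auto
        then show False by simp
      qed
      then show ?thesis using True by (simp add: knot_def)
    qed (use k in \<open>simp add: knot_def t'_def\<close>)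
    then have "\<bar>(deriv ^^ r) (?s 0) t'\<bar> = \<bar>\<xi>\<bar>"
      using dr[OF i(1)] i e by (auto simp: knot_def abs_mult)
    moreover have "periodic2pi ((deriv ^^ j) (?s 0))" for j
      by (induction j) (auto intro: periodic2pi_deriv_any periodic2pi_spl)
    ultimately show "\<bar>(deriv ^^ r) (?s 0) t\<bar> = \<bar>\<xi>\<bar>" using periodic2pi_of_int unfolding t'_def by metis
  qed
qed

text \<open>For \<open>\<xi> = 0\<close> the mean condition on the cut points is void and they need
  not form admissible knots; a constant with a single arbitrary knot takes over.\<close>

lemma zero_perfect_spline:
  assumes "r \<ge> 1" "N \<ge> 1"
  shows "scaled_perfect_spline r N 0 (\<lambda>_. \<kappa>)" "Linf_norm ((deriv ^^ r) (\<lambda>_::real. \<kappa>)) = ereal \<bar>0\<bar>"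
proof -
  have d: "(deriv ^^ j) (\<lambda>_::real. \<kappa>) = (\<lambda>_. if j = 0 then \<kappa> else 0)" for j
    by (induction j) simp_all
  show "Linf_norm ((deriv ^^ r) (\<lambda>_::real. \<kappa>)) = ereal \<bar>0\<bar>"
    by (rule Linf_norm_AE_const[of "{}"]) (use assms in \<open>auto simp: d\<close>)
  have "\<exists>p. degree p \<le> r \<and> (\<forall>t\<in>{a..b}. \<kappa> = poly p t)" for a b :: real
    by (intro exI[of _ "[:\<kappa>:]"]) auto
  then show "scaled_perfect_spline r N 0 (\<lambda>_. \<kappa>)"
    unfolding scaled_perfect_spline_def using assms
    by (intro conjI exI[of _ "[0]"] exI[of _ 1]) (auto simp: d Ck_def periodic2pi_def)
qed

section \<open>The limit\<close>

lemma increasing_chain_le: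
  fixes t :: "nat \<Rightarrow> real"
  assumes "\<And>i. i < k \<Longrightarrow> t i \<le> t (Suc i)" "p \<le> q" "q \<le> k"
  shows "t p \<le> t q"
  using assms(2,3)
proof (induction q rule: dec_induct)
  case (step q)
  then show ?case using assms(1)[of q] by simp
qed simp

text \<open>This is how multiple interpolation survives the limit: \<open>k + 1\<close> zeros of an
  error in a shrinking cluster force a zero of each derivative up to order \<open>k\<close> in the
  same cluster.\<close>

lemma iterated_Rolle:
  fixes D :: "nat \<Rightarrow> real \<Rightarrow> real" and t :: "nat \<Rightarrow> real"
  assumes D: "\<And>i x. i < k \<Longrightarrow> (D i has_real_derivative D (Suc i) x) (at x)"
    and t: "\<And>i. i < k \<Longrightarrow> t i < t (Suc i)" "\<And>i. i \<le> k \<Longrightarrow> D 0 (t i) = 0" and j: "j \<le> k"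
  shows "\<exists>y. t 0 \<le> y \<and> y \<le> t k \<and> D j y = 0"
proof -
  have mono: "t p \<le> t q" if "p \<le> q" "q \<le> k" for p q
    by (rule increasing_chain_le[of k t, OF _ that]) (use t(1) in \<open>auto intro: less_imp_le\<close>)
  have "j \<le> k \<Longrightarrow> \<exists>s. (\<forall>i<k - j. s i < s (Suc i)) \<and> (\<forall>i\<le>k - j. D j (s i) = 0 \<and> t 0 \<le> s i \<and> s i \<le> t k)"
  proof (induction j)
    case 0
    then show ?case using t mono by (intro exI[of _ t]) auto
  next
    case (Suc j)
    then obtain s where s: "\<forall>i<k - j. s i < s (Suc i)" "\<forall>i\<le>k - j. D j (s i) = 0 \<and> t 0 \<le> s i \<and> s i \<le> t k" by auto
    have "\<exists>z. s i < z \<and> z < s (Suc i) \<and> D (Suc j) z = 0" if i: "i < k - j" for i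
    proof -
      have lt: "s i < s (Suc i)" using s(1) i by blast
      obtain z where "s i < z" "z < s (Suc i)" "D j (s (Suc i)) - D j (s i) = (s (Suc i) - s i) * D (Suc j) z"
        using MVT2[OF lt, of "D j" "D (Suc j)"] D[of j] Suc.prems by auto
      then show ?thesis using s(2) i lt by (intro exI[of _ z]) auto
    qed
    then obtain z where z: "\<And>i. i < k - j \<Longrightarrow> s i < z i" "\<And>i. i < k - j \<Longrightarrow> z i < s (Suc i)" "\<And>i. i < k - j \<Longrightarrow> D (Suc j) (z i) = 0"
      by metis
    show ?case
    proof (intro exI[of _ z] conjI allI impI)
      fix i assume "i < k - Suc j"
      then have "Suc i < k - j" by linarith
      then show "z i < z (Suc i)" using z(2)[of i] z(1)[of "Suc i"] by simp
    next
      fix i assume "i \<le> k - Suc j"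
      then have i: "i < k - j" using Suc.prems by simp
      then show "D (Suc j) (z i) = 0" using z(3) by simp
      have "t 0 \<le> s i" "s (Suc i) \<le> t k" using s(2) i by auto
      then show "t 0 \<le> z i" "z i \<le> t k" using z(1)[OF i] z(2)[OF i] by auto
    qed
  qed
  then obtain s where "\<forall>i\<le>k - j. D j (s i) = 0 \<and> t 0 \<le> s i \<and> s i \<le> t k" using j by blast
  then show ?thesis by (intro exI[of _ "s 0"]) simp
qed

lemma smooth_bounded:
  assumes h: "continuous_on UNIV h" and C: "\<And>x. \<bar>h x\<bar> \<le> C"
  shows "\<bar>smooth n h y\<bar> \<le> C"
proof -
  have "norm (smooth n h y) \<le> integral {0..2*pi} (\<lambda>u. C * dlvp n u)"
    unfolding smooth_def
  proof (rule integral_norm_bound_integral)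
    show "norm (dlvp n u * h (y - u)) \<le> C * dlvp n u" for u
      using mult_right_mono[OF C[of "y - u"] dlvp_nonneg[of n u]] dlvp_nonneg[of n u]
      by (simp add: abs_mult mult.commute)
  qed (intro integrable_continuous_real continuous_intros continuous_on_compose2[OF h]; simp)+
  then show ?thesis using integral_dlvp[of n] by simp
qed

lemma alternating_sum_const: "(\<Sum>i=1..2*m. (-1) ^ i * (c::real)) = 0"
proof (induction m)
  case (Suc m)
  have "{1..2 * Suc m} = insert (2*m+2) (insert (2*m+1) {1..2*m})" by auto
  then show ?case using Suc by simp
qed simp

text \<open>The number of terms is even, so the unspecified constant in
  \<open>smooth_prim_Q0\<close> cancels.\<close>

lemma smoothed_kernel_sum:
  assumes r: "r \<ge> 1"
  shows "(\<Sum>i=1..2*m. (-1) ^ i * (prim ^^ Suc r) (beta0 n) (y - z i)) =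
    (\<Sum>i=1..2*m. (-1) ^ i * smooth n ((prim ^^ (r - 1)) Q0) (y - z i))"
proof -
  have "r - 1 + 2 = Suc r" using r by simp
  then obtain c where c: "\<And>y. smooth n ((prim ^^ (r - 1)) Q0) y = (prim ^^ Suc r) (beta0 n) y + c"
    using smooth_prim_Q0[of n "r - 1"] by metis
  show ?thesis unfolding c distrib_left sum.distrib alternating_sum_const by simp
qed

section \<open>Clusters of simple nodes and convergent subsequences\<close>

lemma gap_exists:
  fixes x :: "nat \<Rightarrow> real"
  assumes "\<forall>i. 1 \<le> i \<and> i < l \<longrightarrow> x i < x (Suc i)" "x l < b"
  obtains \<delta> where "\<delta> > 0" "\<And>i. 1 \<le> i \<Longrightarrow> i < l \<Longrightarrow> x i + \<delta> \<le> x (Suc i)" "x l + \<delta> \<le> b"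
proof
  define S where "S = insert (b - x l) ((\<lambda>i. x (Suc i) - x i) ` {1..<l})"
  have S: "finite S" "S \<noteq> {}" by (auto simp: S_def)
  show "Min S > 0" using assms S by (auto simp: S_def)
  show "x i + Min S \<le> x (Suc i)" if "1 \<le> i" "i < l" for i
    using Min_le[OF S(1), of "x (Suc i) - x i"] that by (auto simp: S_def)
  have "b - x l \<in> S" by (simp add: S_def)
  then show "x l + Min S \<le> b" using Min_le[OF S(1)] by fastforce
qed

text \<open>Each progression is too short to reach the next node or 2 pi, so all points are distinct
  and the count of simple nodes is the total multiplicity.\<close>

lemma clustered_nodes:
  fixes x :: "nat \<Rightarrow> real"
  assumes x0: "0 \<le> x 1" and \<delta>: "\<And>i. 1 \<le> i \<Longrightarrow> i < l \<Longrightarrow> x i + \<delta> \<le> x (Suc i)" "x l + \<delta> \<le> 2 * pi" "\<delta> > 0"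
    and \<eta>: "\<eta> > 0" "\<And>i. i \<in> {1..l} \<Longrightarrow> real (k i) * \<eta> < \<delta>"
  shows "finite ((\<lambda>(i, j). x i + real j * \<eta>) ` (SIGMA i:{1..l}. {..k i}))"
    "card ((\<lambda>(i, j). x i + real j * \<eta>) ` (SIGMA i:{1..l}. {..k i})) = (\<Sum>i=1..l. k i + 1)"
    "(\<lambda>(i, j). x i + real j * \<eta>) ` (SIGMA i:{1..l}. {..k i}) \<subseteq> {0..<2*pi}"
proof -
  have step: "x i + \<delta> \<le> x i'" if "1 \<le> i" "i < i'" "i' \<le> l" for i i'
    using that(2,3)
  proof (induction i')
    case (Suc i')
    then show ?case using \<delta>(1)[of i'] \<delta>(3) that(1) by (cases "i = i'") auto
  qed simp
  show "finite ((\<lambda>(i, j). x i + real j * \<eta>) ` (SIGMA i:{1..l}. {..k i}))" by auto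
  have less: "x i + real j * \<eta> < x i + \<delta>" if "i \<in> {1..l}" "j \<le> k i" for i j
  proof -
    have "real j * \<eta> \<le> real (k i) * \<eta>" using that \<eta>(1) by (intro mult_right_mono) auto
    then show ?thesis using \<eta>(2)[OF that(1)] by simp
  qed
  have lt: "x i + real j * \<eta> < x i' + real j' * \<eta>" if "i \<in> {1..l}" "j \<le> k i" "i' \<in> {1..l}" "i < i'" for i j i' j'
  proof -
    have "x i + real j * \<eta> < x i'" using less[OF that(1,2)] step[of i i'] that by simp
    also have "x i' \<le> x i' + real j' * \<eta>" using \<eta>(1) by simp
    finally show ?thesis .
  qed
  have "inj_on (\<lambda>(i, j). x i + real j * \<eta>) (SIGMA i:{1..l}. {..k i})"
  proof (rule inj_onI)
    fix p p' assume p: "p \<in> (SIGMA i:{1..l}. {..k i})" "p' \<in> (SIGMA i:{1..l}. {..k i})"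
      "(\<lambda>(i, j). x i + real j * \<eta>) p = (\<lambda>(i, j). x i + real j * \<eta>) p'"
    obtain i j i' j' where pp: "p = (i, j)" "p' = (i', j')" by (cases p, cases p')
    then have *: "i \<in> {1..l}" "j \<in> {..k i}" "i' \<in> {1..l}" "j' \<in> {..k i'}" "x i + real j * \<eta> = x i' + real j' * \<eta>"
      using p by auto
    then have "i = i'" using lt[of i j i' j'] lt[of i' j' i j] by (cases i i' rule: linorder_cases) auto
    then show "p = p'" using * \<eta>(1) by (auto simp: pp)
  qed
  then show "card ((\<lambda>(i, j). x i + real j * \<eta>) ` (SIGMA i:{1..l}. {..k i})) = (\<Sum>i=1..l. k i + 1)"
    by (subst card_image) auto
  show "(\<lambda>(i, j). x i + real j * \<eta>) ` (SIGMA i:{1..l}. {..k i}) \<subseteq> {0..<2*pi}"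
  proof (rule subsetI)
    fix p assume "p \<in> (\<lambda>(i, j). x i + real j * \<eta>) ` (SIGMA i:{1..l}. {..k i})"
    then obtain i j where ij: "i \<in> {1..l}" "j \<in> {..k i}" and p: "p = x i + real j * \<eta>" by auto
    have "0 \<le> x i" using x0 step[of 1 i] ij \<delta>(3) by (cases "i = 1") auto
    moreover have "x i + \<delta> \<le> 2 * pi" using \<delta> step[of i l] ij by (cases "i = l") auto
    ultimately show "p \<in> {0..<2 * pi}" using less[of i j] ij \<eta>(1) by (auto simp: p)
  qed
qed

lemma convergent_knots:
  fixes \<xi> \<kappa> :: "nat \<Rightarrow> real" and z :: "nat \<Rightarrow> nat \<Rightarrow> real"
  assumes "\<And>n. \<bar>\<xi> n\<bar> \<le> M" "\<And>n. \<bar>\<kappa> n\<bar> \<le> C" "\<And>n q. q \<le> K \<Longrightarrow> z n q \<in> {a..b}" "a \<le> b"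
  obtains \<sigma> \<xi>' \<kappa>' z' where "strict_mono (\<sigma> :: nat \<Rightarrow> nat)" "(\<lambda>n. \<xi> (\<sigma> n)) \<longlonglongrightarrow> \<xi>'" "(\<lambda>n. \<kappa> (\<sigma> n)) \<longlonglongrightarrow> \<kappa>'"
    "\<And>q. q \<le> K \<Longrightarrow> (\<lambda>n. z (\<sigma> n) q) \<longlonglongrightarrow> z' q"
proof -
  let ?S = "{-M..M} \<times> {-C..C} \<times> {a' :: nat \<Rightarrow> real. \<forall>i. a' i \<in> {a..b}}"
  have "compact ?S" by (intro compact_Times compact_Icc compact_real_box)
  then have "seq_compact ?S" by (simp add: compact_eq_seq_compact_metric)
  \<comment> \<open>Entries beyond \<open>K\<close> receive the default value \<open>a\<close>,
    which places the whole sequence in a compact product.\<close>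
  moreover have "\<forall>n. (\<xi> n, \<kappa> n, \<lambda>q. if q \<le> K then z n q else a) \<in> ?S"
    using assms by (auto simp: abs_le_iff minus_le_iff)
  ultimately obtain L \<sigma> where L: "L \<in> ?S" "strict_mono (\<sigma> :: nat \<Rightarrow> nat)"
    "((\<lambda>n. (\<xi> n, \<kappa> n, \<lambda>q. if q \<le> K then z n q else a)) \<circ> \<sigma>) \<longlonglongrightarrow> L"
    by (rule seq_compactE)
  have lim: "(\<lambda>n. (\<xi> (\<sigma> n), \<kappa> (\<sigma> n), \<lambda>q. if q \<le> K then z (\<sigma> n) q else a)) \<longlonglongrightarrow> L" using L(3) by (simp add: o_def)
  have l1: "(\<lambda>n. \<xi> (\<sigma> n)) \<longlonglongrightarrow> fst L" using tendsto_fst[OF lim] by simp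
  have l2: "(\<lambda>n. \<kappa> (\<sigma> n)) \<longlonglongrightarrow> fst (snd L)" using tendsto_fst[OF tendsto_snd[OF lim]] by simp
  have l3: "(\<lambda>n. \<lambda>q. if q \<le> K then z (\<sigma> n) q else a) \<longlonglongrightarrow> snd (snd L)" using tendsto_snd[OF tendsto_snd[OF lim]] by simp
  have l4: "(\<lambda>n. z (\<sigma> n) q) \<longlonglongrightarrow> snd (snd L) q" if "q \<le> K" for q
    using continuous_on_tendsto_compose[OF continuous_on_product_coordinates[of q] l3] that by simp
  show thesis using that[OF L(2) l1 l2 l4] .
qed

text \<open>Only weak inequalities between the \<open>z i\<close> survive the limit, so knots may
  coincide here; \<open>reduce_knots\<close> repairs this later.\<close>

lemma Hermite_limit:
  assumes r: "r \<ge> 1" and x: "0 \<le> x 1" "\<forall>i. 1 \<le> i \<and> i < l \<longrightarrow> x i < x (Suc i)" "x l < 2 * pi"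
    and k: "\<forall>i\<in>{1..l}. k i \<le> r - 1" "(\<Sum>j=1..l. k j + 1) = 2 * m + 1"
    and fd: "\<And>i x. i < r - 1 \<Longrightarrow> (fd i has_real_derivative fd (Suc i) x) (at x)"
    and c: "\<And>i. i \<le> r - 1 \<Longrightarrow> continuous_on UNIV (fd i)" and per: "\<And>i. i \<le> r - 1 \<Longrightarrow> periodic2pi (fd i)"
    and lip: "\<And>x y. \<bar>fd (r - 1) y - fd (r - 1) x\<bar> \<le> M * \<bar>y - x\<bar>"
  shows "\<exists>\<xi> \<kappa> z. \<bar>\<xi>\<bar> \<le> M \<and> z 0 = 0 \<and> z (2*m + 1) = 2 * pi \<and> (\<forall>i\<le>2*m. z i \<le> z (Suc i)) \<and>
     \<xi> * (pi - (\<Sum>i=1..2*m. (-1) ^ i * z i)) = 0 \<and>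
     (\<forall>i\<in>{1..l}. \<forall>j\<le>k i. fd j (x i) = (if j = 0 then \<kappa> else 0) + 2 * \<xi> * (\<Sum>q=1..2*m. (-1) ^ q * (prim ^^ (r - 1 - j)) Q0 (x i - z q)))"
proof -
  obtain \<delta> where \<delta>: "\<delta> > 0" "\<And>i. 1 \<le> i \<Longrightarrow> i < l \<Longrightarrow> x i + \<delta> \<le> x (Suc i)" "x l + \<delta> \<le> 2 * pi"
    using gap_exists[OF x(2,3)] by metis
  \<comment> \<open>\<open>real r\<close> exceeds every \<open>k i\<close>, so a cluster is shorter
    than \<open>\<delta>\<close>; the factor \<open>real n + 1\<close> makes it shrink to a
    point.\<close>
  define \<eta> where "\<eta> n = \<delta> / (real r * (real n + 1))" for n :: nat
  have \<eta>: "\<eta> n > 0" for n using \<delta>(1) r by (simp add: \<eta>_def)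
  have \<eta>k: "real (k i) * \<eta> n < \<delta>" if "i \<in> {1..l}" for i n
  proof -
    have "real (k i) < real r" using k(1) that r by fastforce
    then have "real (k i) * \<eta> n < real r * \<eta> n" using \<eta> by simp
    also have "\<dots> = \<delta> / (real n + 1)" using r by (simp add: \<eta>_def)
    also have "\<dots> \<le> \<delta>" using \<delta>(1) by (simp add: field_simps)
    finally show ?thesis .
  qed
  define X where "X n = (\<lambda>(i, j). x i + real j * \<eta> n) ` (SIGMA i:{1..l}. {..k i})" for n
  have X: "finite (X n)" "card (X n) = 2 * m + 1" "X n \<subseteq> {0..<2*pi}" for n
    using clustered_nodes[OF x(1) \<delta>(2,3,1) \<eta>[of n] \<eta>k[of _ n]] k(2) unfolding X_def by simp_all
  let ?B = "\<lambda>j. (prim ^^ j) Q0"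
  \<comment> \<open>The kernel index is \<open>n + m\<close> because
    \<open>smoothed_interpolation\<close> needs it to be at least \<open>m\<close>.\<close>
  define P where "P n \<xi> z \<kappa> \<longleftrightarrow> \<bar>\<xi>\<bar> \<le> M \<and> z 0 = 0 \<and> z (2*m + 1) = 2 * pi \<and> (\<forall>i\<le>2*m. z i \<le> z (Suc i)) \<and>
     \<xi> * (pi - (\<Sum>i=1..2*m. (-1) ^ i * z i)) = 0 \<and>
     (\<forall>y\<in>X n. smooth (n + m) (fd 0) y = \<kappa> + 2 * \<xi> * (\<Sum>i=1..2*m. (-1) ^ i * smooth (n + m) (?B (r - 1)) (y - z i)))"
    for n \<xi> \<kappa> and z :: "nat \<Rightarrow> real"
  have "\<exists>\<xi> z \<kappa>. P n \<xi> z \<kappa>" for n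
    using smoothed_interpolation[OF r X[of n] le_add2[of m n] fd c per lip]
    unfolding P_def smoothed_kernel_sum[OF r] .
  then obtain \<xi> z \<kappa> where "\<And>n. P n (\<xi> n) (z n) (\<kappa> n)" by metis
  then have A: "\<And>n. \<bar>\<xi> n\<bar> \<le> M" "\<And>n. z n 0 = 0" "\<And>n. z n (2*m + 1) = 2 * pi" "\<And>n. \<forall>i\<le>2*m. z n i \<le> z n (Suc i)"
    "\<And>n. \<xi> n * (pi - (\<Sum>i=1..2*m. (-1) ^ i * z n i)) = 0"
    "\<And>n. \<forall>y\<in>X n. smooth (n + m) (fd 0) y = \<kappa> n + 2 * \<xi> n * (\<Sum>i=1..2*m. (-1) ^ i * smooth (n + m) (?B (r - 1)) (y - z n i))"
    unfolding P_def by blast+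
  have l1: "1 \<in> {1..l}" using k(2) by (cases l) auto
  obtain Cf where Cf: "Cf > 0" "\<And>x. \<bar>fd 0 x\<bar> \<le> Cf" using periodic2pi_bounded[OF c[of 0] per[of 0]] by auto
  obtain CB where CB: "CB > 0" "\<And>x. \<bar>?B (r - 1) x\<bar> \<le> CB" using periodic2pi_bounded[OF continuous_prim_Q0 periodic2pi_prim_Q0] by metis
  have M0: "M \<ge> 0" using A(1)[of 0] by simp
  \<comment> \<open>The interpolation equation at the single node \<open>x 1\<close> expresses
    \<open>\<kappa> n\<close> by quantities bounded independently of \<open>n\<close>.\<close>
  have \<kappa>b: "\<bar>\<kappa> n\<bar> \<le> Cf + 2 * M * (2 * real m * CB)" for n
  proof -
    have "(1, 0) \<in> (SIGMA i:{1..l}. {..k i})" using l1 by simp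
    then have "x 1 \<in> X n" unfolding X_def by (force intro: rev_image_eqI)
    then have "\<kappa> n = smooth (n + m) (fd 0) (x 1) - 2 * \<xi> n * (\<Sum>i=1..2*m. (-1) ^ i * smooth (n + m) (?B (r - 1)) (x 1 - z n i))"
      using A(6)[of n] by simp
    moreover have "\<bar>\<Sum>i=1..2*m. (-1) ^ i * smooth (n + m) (?B (r - 1)) (x 1 - z n i)\<bar> \<le> 2 * real m * CB"
    proof -
      have bd: "\<bar>(-1) ^ i * smooth (n + m) (?B (r - 1)) (x 1 - z n i)\<bar> \<le> CB" for i
        using smooth_bounded[OF continuous_prim_Q0 CB(2), of "n + m" "x 1 - z n i"] by (simp add: abs_mult)
      have "\<bar>\<Sum>i=1..2*m. (-1) ^ i * smooth (n + m) (?B (r - 1)) (x 1 - z n i)\<bar> \<le> (\<Sum>i=1..2*m. CB)"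
        using bd by (intro order_trans[OF sum_abs sum_mono])
      then show ?thesis by simp
    qed
    then have "\<bar>2 * \<xi> n * (\<Sum>i=1..2*m. (-1) ^ i * smooth (n + m) (?B (r - 1)) (x 1 - z n i))\<bar> \<le> 2 * M * (2 * real m * CB)"
      unfolding abs_mult using A(1)[of n] M0 by (intro mult_mono) auto
    moreover have "\<bar>smooth (n + m) (fd 0) (x 1)\<bar> \<le> Cf" using smooth_bounded[OF c[of 0] Cf(2)] by simp
    ultimately show ?thesis by linarith
  qed
  have zmono: "z n p \<le> z n q" if "p \<le> q" "q \<le> 2*m + 1" for n p q
    by (rule increasing_chain_le[of "2*m + 1" "z n", OF _ that]) (use A(4)[of n] in auto)
  have zb: "z n q \<in> {0..2*pi}" if "q \<le> 2*m + 1" for n q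
    using zmono[of 0 q n] zmono[of q "2*m + 1" n] that A(2,3)[of n] by auto
  have pi0: "(0::real) \<le> 2 * pi" by simp
  obtain \<sigma> \<xi>' \<kappa>' z' where lim: "strict_mono (\<sigma> :: nat \<Rightarrow> nat)" "(\<lambda>n. \<xi> (\<sigma> n)) \<longlonglongrightarrow> \<xi>'" "(\<lambda>n. \<kappa> (\<sigma> n)) \<longlonglongrightarrow> \<kappa>'"
    "\<And>q. q \<le> 2*m + 1 \<Longrightarrow> (\<lambda>n. z (\<sigma> n) q) \<longlonglongrightarrow> z' q"
    using convergent_knots[of \<xi> M \<kappa> _ "2*m + 1" z 0 "2*pi", OF A(1) \<kappa>b zb pi0] by blast
  have \<sigma>: "filterlim (\<lambda>n. \<sigma> n + m) at_top sequentially"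
    using filterlim_subseq[OF lim(1)] by (intro filterlim_at_top_mono[OF filterlim_subseq[OF lim(1)]]) auto
  have z'0: "z' 0 = 0" using LIMSEQ_unique[OF lim(4)[of 0]] A(2) by simp
  have z'1: "z' (2*m + 1) = 2 * pi" using LIMSEQ_unique[OF lim(4)[of "2*m + 1"]] A(3) by simp
  have z'm: "z' i \<le> z' (Suc i)" if "i \<le> 2*m" for i
    by (rule LIMSEQ_le[OF lim(4) lim(4)]) (use that A(4) in auto)
  have "(\<lambda>n. \<xi> (\<sigma> n) * (pi - (\<Sum>i=1..2*m. (-1) ^ i * z (\<sigma> n) i))) \<longlonglongrightarrow> \<xi>' * (pi - (\<Sum>i=1..2*m. (-1) ^ i * z' i))"
    by (intro tendsto_intros lim) auto
  then have mean: "\<xi>' * (pi - (\<Sum>i=1..2*m. (-1) ^ i * z' i)) = 0" using A(5) LIMSEQ_unique by (metis (no_types, lifting) ext tendsto_const)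
  have \<xi>'M: "\<bar>\<xi>'\<bar> \<le> M" by (rule LIMSEQ_le_const2[OF tendsto_rabs[OF lim(2)]]) (use A(1) in auto)
  have interp: "fd j (x i) = (if j = 0 then \<kappa>' else 0) + 2 * \<xi>' * (\<Sum>q=1..2*m. (-1) ^ q * ?B (r - 1 - j) (x i - z' q))"
    if i: "i \<in> {1..l}" and j: "j \<le> k i" for i j
  proof -
    have jr: "j \<le> r - 1" using k(1) i j by force
    \<comment> \<open>\<open>D n j\<close> is the j-th derivative of the error of the smoothed
      interpolant; for \<open>j = 0\<close> it vanishes on the whole cluster at
      \<open>x i\<close>.\<close>
    define D where "D n j y = smooth (n + m) (fd j) y - ((if j = 0 then \<kappa> n else 0) + 2 * \<xi> n * (\<Sum>q=1..2*m. (-1) ^ q * smooth (n + m) (?B (r - 1 - j)) (y - z n q)))" for n j y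
    have D: "(D n j has_real_derivative D n (Suc j) y) (at y)" if "j < r - 1" for n j y
    proof -
      have eq: "r - 1 - j = Suc (r - 1 - Suc j)" using that by simp
      have s1: "(smooth (n + m) (fd j) has_real_derivative smooth (n + m) (fd (Suc j)) y) (at y)"
        using that by (intro smooth_has_derivative fd c) auto
      have "(smooth (n + m) (?B (r - 1 - j)) has_real_derivative smooth (n + m) (?B (r - 1 - Suc j)) x) (at x)" for x
        unfolding eq by (intro smooth_has_derivative prim_funpow_has_derivative mean_free_Q0 continuous_prim_Q0)
      from DERIV_translate[OF this]
      have s2: "((\<lambda>y. smooth (n + m) (?B (r - 1 - j)) (y - a)) has_real_derivative smooth (n + m) (?B (r - 1 - Suc j)) (y - a)) (at y)" for a
        by (metis (no_types, lifting) ext diff_conv_add_uminus)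
      have "(D n j has_real_derivative smooth (n + m) (fd (Suc j)) y - (0 + 2 * \<xi> n * (\<Sum>q=1..2*m. (-1) ^ q * smooth (n + m) (?B (r - 1 - Suc j)) (y - z n q)))) (at y)"
        unfolding D_def[abs_def] by (intro DERIV_diff DERIV_add DERIV_const DERIV_cmult DERIV_sum s1 s2)
      then show ?thesis by (simp add: D_def)
    qed
    have "\<exists>y. x i + real 0 * \<eta> n \<le> y \<and> y \<le> x i + real (k i) * \<eta> n \<and> D n j y = 0" for n
    proof (rule iterated_Rolle[of "k i" "D n" "\<lambda>p. x i + real p * \<eta> n", OF _ _ _ j])
      show "(D n p has_real_derivative D n (Suc p) y) (at y)" if "p < k i" for p y
      proof -
        have "k i \<le> r - 1" using k(1) i by blast
        then show ?thesis using that by (intro D) simp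
      qed
      show "x i + real p * \<eta> n < x i + real (Suc p) * \<eta> n" for p using \<eta>[of n] by simp
      show "D n 0 (x i + real p * \<eta> n) = 0" if "p \<le> k i" for p
      proof -
        have "(i, p) \<in> (SIGMA i:{1..l}. {..k i})" using i that by simp
        then have "x i + real p * \<eta> n \<in> X n" unfolding X_def by (force intro: rev_image_eqI)
        then show ?thesis using A(6)[of n] by (simp add: D_def)
      qed
    qed
    then obtain y where y: "\<And>n. x i \<le> y n" "\<And>n. y n \<le> x i + real (k i) * \<eta> n" "\<And>n. D n j (y n) = 0"
      by (metis (no_types, lifting) add.right_neutral mult_zero_left of_nat_0)
    have "(\<lambda>n. x i + real (k i) * \<eta> n) \<longlonglongrightarrow> x i"
      unfolding \<eta>_def using r by real_asymp
    then have "y \<longlonglongrightarrow> x i"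
      by (rule tendsto_sandwich[OF _ _ tendsto_const, rotated 2]) (use y in auto)
    then have ylim: "(\<lambda>n. y (\<sigma> n)) \<longlonglongrightarrow> x i" using LIMSEQ_subseq_LIMSEQ[OF _ lim(1)] by (simp add: o_def)
    have "(\<lambda>n. D (\<sigma> n) j (y (\<sigma> n))) \<longlonglongrightarrow> fd j (x i) - ((if j = 0 then \<kappa>' else 0) + 2 * \<xi>' * (\<Sum>q=1..2*m. (-1) ^ q * ?B (r - 1 - j) (x i - z' q)))"
      unfolding D_def
    proof (intro tendsto_diff tendsto_add tendsto_mult tendsto_const tendsto_sum lim(2))
      show "(\<lambda>n. smooth (\<sigma> n + m) (fd j) (y (\<sigma> n))) \<longlonglongrightarrow> fd j (x i)"
        by (rule smooth_LIMSEQ[OF c[OF jr] per[OF jr] ylim \<sigma>])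
      show "(\<lambda>n. if j = 0 then \<kappa> (\<sigma> n) else 0) \<longlonglongrightarrow> (if j = 0 then \<kappa>' else 0)" using lim(3) by (cases "j = 0") auto
      fix q assume "q \<in> {1..2*m}"
      then have "(\<lambda>n. y (\<sigma> n) - z (\<sigma> n) q) \<longlonglongrightarrow> x i - z' q" by (intro tendsto_diff ylim lim(4)) auto
      then show "(\<lambda>n. smooth (\<sigma> n + m) (?B (r - 1 - j)) (y (\<sigma> n) - z (\<sigma> n) q)) \<longlonglongrightarrow> ?B (r - 1 - j) (x i - z' q)"
        by (rule smooth_LIMSEQ[OF continuous_prim_Q0 periodic2pi_prim_Q0 _ \<sigma>])
    qed
    moreover have "(\<lambda>n. D (\<sigma> n) j (y (\<sigma> n))) \<longlonglongrightarrow> 0" using y(3) by simp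
    ultimately show ?thesis using LIMSEQ_unique by fastforce
  qed
  show ?thesis using \<xi>'M z'0 z'1 z'm mean interp
    by (intro exI[of _ \<xi>'] exI[of _ \<kappa>'] exI[of _ z']) auto
qed

lemma sum_conv_alt_sum: "(\<Sum>q=1..N. (-1) ^ q * h (z q)) = - alt_sum h (map z [1..<Suc N])"
proof -
  have "(\<Sum>q=1..N. (-1) ^ q * h (z q)) = (\<Sum>q<N. (-1) ^ Suc q * h (z (Suc q)))"
    by (rule sum.reindex_bij_witness[of _ Suc "\<lambda>q. q - 1"]) auto
  also have "\<dots> = - alt_sum h (map z [1..<Suc N])"
    unfolding alt_sum_conv_sum by (simp add: sum_negf del: upt_Suc)
  finally show ?thesis .
qed

theorem theorem2:
  fixes r m l :: nat and x :: "nat \<Rightarrow> real" and k :: "nat \<Rightarrow> nat"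
    and f :: "real \<Rightarrow> real"
  assumes "r \<ge> 1" and "m \<ge> 1"
    and "0 \<le> x 1" and "\<forall>i. 1 \<le> i \<and> i < l \<longrightarrow> x i < x (Suc i)" and "x l < 2 * pi"
    and "\<forall>i\<in>{1..l}. k i \<le> r - 1"
    and "(\<Sum>j=1..l. k j + 1) = 2 * m + 1"
    and "Linf_r r f"
  shows "\<exists>\<xi> s. scaled_perfect_spline r (2 * m) \<xi> s \<and>
           (\<forall>i\<in>{1..l}. \<forall>j\<le>k i. (deriv ^^ j) s (x i) = (deriv ^^ j) f (x i)) \<and>
           Linf_norm ((deriv ^^ r) s) = ereal \<bar>\<xi>\<bar> \<and>
           ereal \<bar>\<xi>\<bar> \<le> Linf_norm ((deriv ^^ r) f)"
proof -
  define fd where "fd j = (deriv ^^ j) f" for j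
  have f: "periodic2pi f" "Ck (r - 1) f" "\<And>u v. abs_cont_on u v (fd (r - 1))" "Linf_norm (fd r) < \<infinity>"
    using assms(8) by (auto simp: Linf_r_def fd_def)
  have fdd: "(fd i has_real_derivative fd (Suc i) t) (at t)" if "i < r - 1" for i t
    using f(2) that unfolding Ck_def fd_def by (simp add: DERIV_deriv_iff_real_differentiable)
  have c: "continuous_on UNIV (fd i)" if "i \<le> r - 1" for i
  proof (cases "i = r - 1")
    case True
    then show ?thesis using f(2) by (simp add: Ck_def fd_def)
  next
    case False
    then show ?thesis using that by (intro DERIV_imp_continuous_on[OF fdd]) auto
  qed
  have per: "periodic2pi (fd i)" for i
    unfolding fd_def by (induction i) (auto intro: f(1) periodic2pi_deriv_any)
  have fdr: "fd r = deriv (fd (r - 1))" unfolding fd_def using assms(1) by (cases r) auto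
  have ae: "AE t in lebesgue. ereal \<bar>fd r t\<bar> \<le> Linf_norm (fd r)" unfolding Linf_norm_def by (rule esssup_AE)
  \<comment> \<open>Lebesgue measure is not zero, so the almost everywhere bound holds at some point
    and the extended real is nonnegative there.\<close>
  have "Linf_norm (fd r) \<ge> 0"
  proof -
    have "\<exists>t. ereal \<bar>fd r t\<bar> \<le> Linf_norm (fd r)"
    proof (rule ccontr)
      assume "\<not> ?thesis"
      then have "AE t in (lebesgue :: real measure). False" using ae by simp
      then have "ae_filter (lebesgue :: real measure) = bot" by (simp add: trivial_limit_def)
      then show False using ae_filter_eq_bot_iff[of "lebesgue :: real measure"] by simp
    qed
    then show ?thesis by (meson abs_ge_zero ereal_less_eq(5) order_trans)
  qed
  then obtain M where M: "Linf_norm (fd r) = ereal M" "M \<ge> 0" using f(4) by (cases "Linf_norm (fd r)") auto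
  have lip: "\<bar>fd (r - 1) y - fd (r - 1) t\<bar> \<le> M * \<bar>y - t\<bar>" for t y
    by (rule abs_cont_Lipschitz[OF f(3)]) (use ae M fdr in auto)
  obtain \<xi> \<kappa> z where H: "\<bar>\<xi>\<bar> \<le> M" "z 0 = 0" "z (2*m + 1) = 2 * pi" "\<forall>i\<le>2*m. z i \<le> z (Suc i)"
     "\<xi> * (pi - (\<Sum>i=1..2*m. (-1) ^ i * z i)) = 0"
     "\<forall>i\<in>{1..l}. \<forall>j\<le>k i. fd j (x i) = (if j = 0 then \<kappa> else 0) + 2 * \<xi> * (\<Sum>q=1..2*m. (-1) ^ q * (prim ^^ (r - 1 - j)) Q0 (x i - z q))"
    using Hermite_limit[OF assms(1,3-7) fdd c per lip] by blast
  have le: "ereal \<bar>\<xi>\<bar> \<le> Linf_norm ((deriv ^^ r) f)" using H(1) M(1) by (simp add: fd_def)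
  show ?thesis
  proof (cases "\<xi> = 0")
    case True
    have d: "(deriv ^^ j) (\<lambda>_::real. \<kappa>) = (\<lambda>_. if j = 0 then \<kappa> else 0)" for j
      by (induction j) simp_all
    have "2 * m \<ge> 1" using assms(2) by simp
    from zero_perfect_spline[OF assms(1) this, of \<kappa>] show ?thesis
      using le H(6) True by (intro exI[of _ 0] exI[of _ "\<lambda>_. \<kappa>"]) (auto simp: d fd_def)
  next
    case False
    \<comment> \<open>Only interior cut points become knots: the number of sign intervals is odd, so
      0 and 2 pi separate intervals of equal sign on the circle.\<close>
    define zs where "zs = map z [1..<Suc (2*m)]"
    have zmono: "z p \<le> z q" if "p \<le> q" "q \<le> 2*m + 1" for p q
      by (rule increasing_chain_le[of "2*m + 1" z, OF _ that]) (use H(4) in auto)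
    have len: "length zs = 2 * m" by (simp add: zs_def)
    have "sorted zs" unfolding zs_def sorted_iff_nth_mono using zmono by (auto simp del: upt_Suc)
    moreover have "even (length zs)" using len by simp
    moreover have "last zs \<le> hd zs + 2 * pi" if "zs \<noteq> []"
    proof -
      have "last zs = z (2*m)" using assms(2) by (simp add: zs_def)
      moreover have "hd zs = z 1" using assms(2) by (simp add: zs_def upt_conv_Cons del: upt_Suc)
      ultimately show ?thesis using zmono[of "2*m" "2*m+1"] zmono[of 0 1] H(2,3) assms(2) by simp
    qed
    moreover have "alt_sum (\<lambda>z. z) zs = - pi"
      using H(5) False sum_conv_alt_sum[of "\<lambda>z. z" z "2*m"] by (simp add: zs_def del: upt_Suc)
    ultimately obtain ts e where ts: "(e = 1 \<or> e = (-1::real))" "sorted_wrt (<) ts" "even (length ts)" "length ts \<le> length zs"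
      "ts \<noteq> []" "last ts < hd ts + 2 * pi" "alt_sum (\<lambda>z. z) ts = - pi"
      "\<And>h. periodic2pi h \<Longrightarrow> alt_sum h zs = e * alt_sum h ts"
      using reduce_knots[of zs] by blast
    \<comment> \<open>The minus sign compensates for the sum over \<open>1..2*m\<close>, which
      starts with an odd index and hence with a negative term.\<close>
    let ?s = "spl r \<kappa> (- e * \<xi>) ts"
    have e: "- e = 1 \<or> - e = -1" using ts(1) by auto
    have lts: "length ts \<le> 2*m" using ts(4) len by simp
    note sp = perfect_spline_from_knots(1)[OF assms(1) ts(2,3,5-7) lts e, of \<xi> \<kappa>]
      perfect_spline_from_knots(2)[OF assms(1) ts(2,3,5-7) lts e, of \<kappa> \<xi>]
    have "(deriv ^^ j) (?s 0) (x i) = (deriv ^^ j) f (x i)" if ij: "i \<in> {1..l}" "j \<le> k i" for i j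
    proof -
      let ?h = "\<lambda>u. (prim ^^ (r - 1 - j)) Q0 (x i - u)"
      have jr: "j \<le> r - 1" using ij assms(6) by force
      have "(deriv ^^ j) f (x i) = (if j = 0 then \<kappa> else 0) + 2 * \<xi> * (- alt_sum ?h zs)"
        using H(6) ij sum_conv_alt_sum[of ?h z "2*m"] by (simp add: fd_def zs_def del: upt_Suc)
      also have "alt_sum ?h zs = e * alt_sum ?h ts"
        by (rule ts(8)) (rule periodic2pi_reflect[OF periodic2pi_prim_Q0])
      finally show ?thesis using deriv_funpow_spl[OF jr, of \<kappa> "- e * \<xi>" ts] by (simp add: spl_def)
    qed
    then show ?thesis using sp le by (intro exI[of _ \<xi>] exI[of _ "?s 0"]) auto
  qed
qed

end
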